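(* Let $p\ge1$ be an integer and let $H$ be a two-diagonal Hessenberg matrix (defined in the context) with $a_j>0$ for all $j$. Fix $n\in\mathbb N$ and $k\in[0:p-1]$. Then: (a) We have $P_{k,n}(x)=x^{m_{k,n}}\widetilde P_{k,n}(x^{p+1})$, for a polynomial $\widetilde P_{k,n}$ with $\widetilde P_{k,n}(0)\ne0$ and with $$m_{k,n}=\begin{cases}(j-k)(k+1),&\text{if } n\equiv j \bmod (p+1),\ j\in[k:p],\\ (k-j)(p-k),&\text{if } n\equiv j\bmod (p+1),\ j\in[-1:k].\end{cases}$$ The zeros of $\widetilde P_{k,n}$ all lie in $\mathbb R_+$ if $k$ is even, and in $\mathbb R_-$ if $k$ is odd. (b) Denote the zeros of $\widetilde P_{k,n}$ and $\widetilde P_{k,n+1}$ as $(x_i)_{i=1,2,\dots}$ and $(y_i)_{i=1,2,\dots}$ respectively, counting multiplicities and ordered by increasing modulus. We have the weak interlacing relation $$0<|x_1|\le|y_1|\le|x_2|\le|y_2|\le\cdots$$ if $n\equiv j\bmod(p+1)$, $j\in[k:p-1]$, and $$0<|y_1|\le|x_1|\le|y_2|\le|x_2|\le\cdots$$ if $n\equiv j\bmod(p+1)$, $j\in[-1:k-1]$. (c) Let $(x_i)_{i=1,2,\dots}$ be the zeros of $\widetilde P_{k,n}$, as in (b), and let $(w_i)_{i=1,2,\dots}$ be the zeros of $\widetilde P_{k,n+p+1}$, counting multiplicities and ordered by increasing modulus. We have $$0<|w_1|\le|x_1|\le|w_2|\le|x_2|\le\cdots.$$ The moduli can be removed if $k$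 is even and replaced by minus signs if $k$ is odd.
   Context: Notation: $\mathbb N=\{1,2,3,\dots\}$ and $[i:j]=\{i,i+1,\dots,j\}$. The two-diagonal Hessenberg matrix $H=(H_{i,j})_{i,j=0}^\infty$ has $H_{j-1,j}=1$ for $j\ge1$, $H_{j+p,j}=a_j$ for $j\ge0$, and all other entries $0$; $H_n=(H_{i,j})_{i,j=0}^{n-1}$ is its $n\times n$ leading principal submatrix. $P_{k,n}(x)$ is the determinant of the submatrix of $H_n-xI_n$ obtained by skipping the first $k$ rows and the last $k$ columns; for $n\le k$ one sets $P_{k,n}(x)\equiv1$. The interlacing chains run through the (finitely many) zeros of the two polynomials involved, alternating as indicated.
   Formalization: Writing n=(p+1)r+j with 0≤j≤p, the theorem assumes r+j≥k if j≤k and r≥k if j>k; for the other (finitely many) n the factorization in (a) fails, since n<k (P=1, m>0) or P_{k,n}≡0, e.g. p=2, k=1, n=2. Part (b) is claimed only when the tilde polynomial for n+1 exists. *)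

theory Defs
  imports
    "HOL-Computational_Algebra.Fundamental_Theorem_Algebra"
    "HOL-Number_Theory.Cong"
    "Jordan_Normal_Form.Determinant"
begin

definition hessenberg :: "nat \<Rightarrow> (nat \<Rightarrow> real) \<Rightarrow> nat \<Rightarrow> nat \<Rightarrow> complex" where
  "hessenberg p a i j =
     (if j = i + 1 then 1 else if i = j + p then complex_of_real (a j) else 0)"

definition hessenberg_mat :: "nat \<Rightarrow> (nat \<Rightarrow> real) \<Rightarrow> nat \<Rightarrow> complex mat" where
  "hessenberg_mat p a n = mat n n (\<lambda>(i, j). hessenberg p a i j)"

text \<open>The matrix \<open>H\<^sub>n - x I\<^sub>n\<close>, with \<open>x\<close> the polynomial indeterminate.\<close>

definition hessenberg_minus_x :: "nat \<Rightarrow> (nat \<Rightarrow> real) \<Rightarrow> nat \<Rightarrow> complex poly mat" where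
  "hessenberg_minus_x p a n =
     map_mat (\<lambda>c. [:c:]) (hessenberg_mat p a n) - [:0, 1:] \<cdot>\<^sub>m 1\<^sub>m n"

definition P_poly :: "nat \<Rightarrow> (nat \<Rightarrow> real) \<Rightarrow> nat \<Rightarrow> nat \<Rightarrow> complex poly" where
  "P_poly p a k n =
     (if n \<le> k then 1
      else det (mat (n - k) (n - k) (\<lambda>(i, j). hessenberg_minus_x p a n $$ (i + k, j))))"

text \<open>
  The residue \<open>j \<in> [-1:p]\<close> of \<open>n\<close> modulo \<open>p + 1\<close> is normalised to \<open>[0:p]\<close>, so that \<open>j = -1\<close>
  becomes \<open>j = p\<close>. The two lemmas below recover both cases of the usual piecewise formula;
  in particular the formulas agree where the cases overlap.
\<close>

definition m_exp :: "nat \<Rightarrow> nat \<Rightarrow> nat \<Rightarrow> nat" where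
  "m_exp p k n =
     (let j = n mod (p + 1) in if k \<le> j then (j - k) * (k + 1) else (k - j) * (p - k))"

lemma m_exp_upper:
  assumes "[n = j] (mod (p + 1))" "j \<in> {k..p}"
  shows "m_exp p k n = (j - k) * (k + 1)"
proof -
  have "n mod (p + 1) = j"
    using assms by (simp add: cong_def)
  then show ?thesis
    using assms by (simp add: m_exp_def)
qed

lemma m_exp_lower:
  assumes "k < p" "[int n = j] (mod (int p + 1))" "j \<in> {-1..int k}"
  shows "int (m_exp p k n) = (int k - j) * (int p - int k)"
proof (cases "j = -1")
  case True
  have "int n mod (int p + 1) = (-1) mod (int p + 1)"
    using assms True by (simp add: cong_def)
  also have "\<dots> = int p"
    by (simp add: zmod_minus1)
  finally have "int (n mod (p + 1)) = int p"
    by (simp add: zmod_int add.commute)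
  then have "n mod (p + 1) = p"
    by linarith
  then show ?thesis
    using assms(1) True by (simp add: m_exp_def of_nat_diff) (simp add: algebra_simps)
next
  case False
  have "int n mod (int p + 1) = j mod (int p + 1)"
    using assms by (simp add: cong_def)
  also have "\<dots> = j"
    using assms False by (intro mod_pos_pos_trivial) auto
  finally have *: "int (n mod (p + 1)) = j"
    by (simp add: zmod_int add.commute)
  then have "n mod (p + 1) \<le> k"
    using assms by auto
  then show ?thesis
    using assms(1) * by (auto simp: m_exp_def Let_def of_nat_diff)
qed

text \<open>
  The factorization in \<open>is_P_tilde\<close> below does not exist for every \<open>n\<close>: for \<open>n < k\<close> one has
  \<open>P\<^sub>k\<^sub>,\<^sub>n = 1\<close> although the exponent is positive, and for some small \<open>n > k\<close> the
  determinant \<open>P\<^sub>k\<^sub>,\<^sub>n\<close> vanishes identically (e.g. \<open>p = 2\<close>, \<open>k = 1\<close>, \<open>n = 2\<close>, where the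
  submatrix is the \<open>1 \<times> 1\<close> zero matrix). The following condition excludes these
  \<open>n\<close>; it holds for all \<open>n \<ge> k * (p + 1)\<close>, and always if \<open>k = 0\<close>.
\<close>

definition nondegenerate :: "nat \<Rightarrow> nat \<Rightarrow> nat \<Rightarrow> bool" where
  "nondegenerate p k n \<longleftrightarrow>
     (let j = n mod (p + 1); r = n div (p + 1) in if j \<le> k then k \<le> r + j else k \<le> r)"

lemma nondegenerate_if_large:
  assumes "k * (p + 1) \<le> n"
  shows "nondegenerate p k n"
proof -
  have "k * (p + 1) div (p + 1) \<le> n div (p + 1)"
    using assms by (rule div_le_mono)
  then have "k \<le> n div (p + 1)"
    by (simp only: nonzero_mult_div_cancel_right add_is_0 one_neq_zero simp_thms not_False_eq_True)
  then show ?thesis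
    by (auto simp: nondegenerate_def Let_def intro: trans_le_add1)
qed

text \<open>\<open>R\<close> is the polynomial written \<open>P\<close>-tilde with indices \<open>k, n\<close>.\<close>

definition is_P_tilde ::
    "nat \<Rightarrow> (nat \<Rightarrow> real) \<Rightarrow> nat \<Rightarrow> nat \<Rightarrow> complex poly \<Rightarrow> bool" where
  "is_P_tilde p a k n R \<longleftrightarrow>
     P_poly p a k n = monom 1 (m_exp p k n) * pcompose R (monom 1 (p + 1)) \<and> poly R 0 \<noteq> 0"

definition zeros_by_modulus :: "complex poly \<Rightarrow> complex list \<Rightarrow> bool" where
  "zeros_by_modulus R zs \<longleftrightarrow> mset zs = proots R \<and> sorted (map cmod zs)"

text \<open>
  The finite chain \<open>0 < u\<^sub>0 \<le> v\<^sub>0 \<le> u\<^sub>1 \<le> v\<^sub>1 \<le> \<dots>\<close> running through all entries of both lists.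
  As the entries alternate, starting with \<open>u\<^sub>0\<close>, the list \<open>us\<close> has as many entries as \<open>vs\<close>
  or one more.
\<close>

definition interlacing_chain :: "real list \<Rightarrow> real list \<Rightarrow> bool" where
  "interlacing_chain us vs \<longleftrightarrow>
     (length us = length vs \<or> length us = length vs + 1) \<and>
     (us \<noteq> [] \<longrightarrow> 0 < us ! 0) \<and>
     (\<forall>i < length vs. us ! i \<le> vs ! i) \<and>
     (\<forall>i. i + 1 < length us \<longrightarrow> vs ! i \<le> us ! (i + 1))"

end

theory Submission
  imports Defs
begin

text \<open>
  Up to sign and a power of \<open>x\<close>, the determinant \<open>P\<^sub>k\<^sub>,\<^sub>n\<close> is a minor of size \<open>k + 1\<close> of the fundamental
  solutions of the recurrence of \<open>H - x\<close> (complementary minors of a triangular matrix and its inverse).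
  In the variable \<open>v = (-1)\<^sup>k\<^sup>+\<^sup>1 / x\<^sup>p\<^sup>+\<^sup>1\<close> this minor is a polynomial \<open>G\<close>, called
  \<open>signed_minor\<close> below, with nonnegative coefficients, which
  count weighted evolutions of \<open>k + 1\<close> particles hopping on a cycle of \<open>p + 1\<close> sites; this yields its
  degree, and control of its order of vanishing at \<open>0\<close>. The Desnanot-Jacobi identity relates the minors of
  sizes \<open>k\<close>, \<open>k + 1\<close> and \<open>k + 2\<close>. As the variables for \<open>k\<close> and \<open>k \<plusminus> 1\<close> have opposite signs, the minors of
  sizes \<open>k\<close> and \<open>k + 2\<close> are positive for \<open>v < 0\<close>, so at the zeros of one \<open>G\<close> two neighbouring ones have
  opposite signs. By induction on \<open>n\<close> and the intermediate value theorem, all nonzero zeros are negative,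
  simple, and interlace. The same identity with the last column moved by \<open>p + 1\<close> yields part (c).
\<close>

text \<open>\<open>minor\<close> sees only which sites are occupied; the exponent \<open>b\<close>
  of the variable records how far the labels are shifted, and so the total distance travelled. One
  more shift saves \<open>p + 1\<close> hops. Hence the top degree belongs to the cheapest
  evolution, whose number of hops is \<open>m_exp\<close>, and \<open>nondegenerate\<close> gives
  this evolution the time it needs. The sign argument needs a nonzero minor of size
  \<open>k + 2\<close>, which is secured only from about \<open>(k + 1) * (p + 1)\<close> on. Before
  that time particle \<open>k\<close> cannot have passed site \<open>p\<close>, so \<open>G\<close>
  is a monomial without nonzero zeros, and the induction starts there. Dropping the first
  fundamental solution replaces the weights \<open>a j\<close> by \<open>a (Suc j)\<close>. The
  induction therefore runs over all weight sequences at once and also compares with the shifted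
  weights. After division by a known power of the variable, sign changes locate all zeros but one.
  The last one is forced by the degree, and nonnegative coefficients keep it from being positive; it
  may be \<open>0\<close>, so orders of vanishing have to be compared through evolutions.\<close>

subsection \<open>Particles on a cycle\<close>

text \<open>
  A configuration of \<open>k + 1\<close> particles on a cycle of \<open>p + 1\<close> sites, lifted to the integers: \<open>y i\<close> is
  the position of particle \<open>i\<close>, and particle \<open>i + k + 1\<close> is a copy of particle \<open>i\<close> one turn ahead.
\<close>

definition conf :: "nat \<Rightarrow> nat \<Rightarrow> (int \<Rightarrow> int) \<Rightarrow> bool" where
  "conf p k y \<longleftrightarrow> (\<forall>i. y i < y (i + 1)) \<and> (\<forall>i. y (i + (int k + 1)) = y i + (int p + 1))"

definition occupied :: "nat \<Rightarrow> (int \<Rightarrow> int) \<Rightarrow> int \<Rightarrow> bool" where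
  "occupied p y s \<longleftrightarrow> (\<exists>i. y i mod (int p + 1) = s mod (int p + 1))"

definition hop_back :: "nat \<Rightarrow> int \<Rightarrow> (int \<Rightarrow> int) \<Rightarrow> int \<Rightarrow> int" where
  "hop_back p s y = (\<lambda>i. if y i mod (int p + 1) = s mod (int p + 1) then y i - 1 else y i)"

text \<open>The initial configuration is dictated by the minors: at the sites \<open>0\<close>, ...,
  \<open>k\<close> the matrix of fundamental solutions is unitriangular.\<close>

definition packed :: "nat \<Rightarrow> nat \<Rightarrow> int \<Rightarrow> int" where
  "packed p k i = i mod (int k + 1) + (int p + 1) * (i div (int k + 1))"

text \<open>
  The total weight of the evolutions from \<open>packed\<close> to \<open>y\<close>: in step \<open>t \<ge> k\<close> a particle at \<open>t\<close> may hop to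
  \<open>t + 1\<close> if that site is vacant, and a particle that was at \<open>t + 1\<close> already contributes \<open>a (t - p)\<close>.
  The truncation of \<open>t - p\<close> is harmless, as no particle is at \<open>t + 1\<close> already in a step \<open>t < p\<close>.
\<close>

fun cnt :: "nat \<Rightarrow> nat \<Rightarrow> (nat \<Rightarrow> real) \<Rightarrow> nat \<Rightarrow> (int \<Rightarrow> int) \<Rightarrow> real" where
  "cnt p k a 0 y = (if y = packed p k then 1 else 0)"
| "cnt p k a (Suc t) y =
     (if t < k \<or> \<not> occupied p y (int t + 1) then cnt p k a t y
      else a (t - p) * cnt p k a t y +
        (if occupied p y (int t) then 0 else cnt p k a t (hop_back p (int t + 1) y)))"

lemma conf_less: "conf p k y \<Longrightarrow> i < j \<Longrightarrow> y i < y j"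
proof -
  assume c: "conf p k y" and "i < j"
  have "y i < y (i + 1 + int d)" for d
  proof (induction d)
    case (Suc d)
    then show ?case
      using c unfolding conf_def by (metis (no_types) add.assoc add.commute less_trans of_nat_Suc)
  qed (use c in \<open>simp add: conf_def\<close>)
  from this[of "nat (j - i - 1)"] show ?thesis
    using \<open>i < j\<close> by simp
qed

lemma conf_less_iff: "conf p k y \<Longrightarrow> y i < y j \<longleftrightarrow> i < j"
  by (metis conf_less linorder_neqE not_less_iff_gr_or_eq)

lemma conf_le_iff: "conf p k y \<Longrightarrow> y i \<le> y j \<longleftrightarrow> i \<le> j"
  by (metis conf_less_iff linorder_not_less)

lemma conf_eq_iff: "conf p k y \<Longrightarrow> y i = y j \<longleftrightarrow> i = j"
  by (metis conf_less linorder_neqE less_irrefl)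

lemma conf_gap: "conf p k y \<Longrightarrow> y i + d \<le> y (i + d)" if "d \<ge> 0"
proof -
  assume c: "conf p k y"
  have "y i + int d \<le> y (i + int d)" for d
  proof (induction d)
    case (Suc d)
    have "y (i + int d) < y (i + int d + 1)"
      using c by (simp add: conf_def)
    with Suc show ?case
      by (simp add: add_ac)
  qed simp
  from this[of "nat d"] that show ?thesis
    by simp
qed

lemma conf_period: "conf p k y \<Longrightarrow> y (i + (int k + 1) * z) = y i + (int p + 1) * z"
proof -
  assume c: "conf p k y"
  have *: "y (i + (int k + 1) * int d) = y i + (int p + 1) * int d" for i d
  proof (induction d)
    case (Suc d)
    have "y (i + (int k + 1) * int (Suc d)) = y (i + (int k + 1) * int d + (int k + 1))"
      by (simp add: algebra_simps)
    also have "\<dots> = y (i + (int k + 1) * int d) + (int p + 1)"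
      using c unfolding conf_def by blast
    finally show ?case
      using Suc by (simp add: algebra_simps)
  qed simp
  show ?thesis
  proof (cases "z \<ge> 0")
    case True
    then show ?thesis
      using *[of i "nat z"] by simp
  next
    case False
    then show ?thesis
      using *[of "i + (int k + 1) * z" "nat (- z)"] by (simp add: algebra_simps)
  qed
qed

lemma conf_mod_eq_iff:
  assumes "conf p k y"
  shows "y i mod (int p + 1) = s mod (int p + 1) \<longleftrightarrow> (\<exists>z. y (i + (int k + 1) * z) = s)"
proof
  assume "y i mod (int p + 1) = s mod (int p + 1)"
  then obtain z where "s = y i + (int p + 1) * z"
    by (metis mod_eqE mult.commute)
  then show "\<exists>z. y (i + (int k + 1) * z) = s"
    using conf_period[OF assms] by metis
next
  assume "\<exists>z. y (i + (int k + 1) * z) = s"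
  then show "y i mod (int p + 1) = s mod (int p + 1)"
    using conf_period[OF assms] by (metis mod_mult_self2)
qed

lemma occupied_iff: "conf p k y \<Longrightarrow> occupied p y s \<longleftrightarrow> (\<exists>i. y i = s)"
  unfolding occupied_def using conf_mod_eq_iff by metis

lemma conf_shift: "conf p k y \<Longrightarrow> conf p k (\<lambda>i. y (i - b))"
  unfolding conf_def by (metis (no_types, opaque_lifting) add_diff_eq diff_add_eq)

lemma conf_add: "conf p k y \<Longrightarrow> conf p k (\<lambda>i. d + y i)"
  unfolding conf_def by auto

lemma occupied_shift: "occupied p (\<lambda>i. y (i - b)) s \<longleftrightarrow> occupied p y s"
  unfolding occupied_def by (metis diff_add_cancel add_diff_cancel)

lemma hop_back_shift: "hop_back p s (\<lambda>i. y (i - b)) = (\<lambda>i. hop_back p s y (i - b))"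
  by (simp add: hop_back_def)

lemma conf_hop_back:
  assumes c: "conf p k y" and o: "\<not> occupied p y (s - 1)"
  shows "conf p k (hop_back p s y)"
  unfolding conf_def
proof (intro conjI allI)
  fix i
  have lt: "y i < y (i + 1)"
    using c by (simp add: conf_def)
  have "y (i + 1) - 1 \<noteq> y i" if "y (i + 1) mod (int p + 1) = s mod (int p + 1)"
  proof
    assume "y (i + 1) - 1 = y i"
    then have "y i mod (int p + 1) = (s - 1) mod (int p + 1)"
      using that by (metis mod_diff_left_eq)
    with o show False
      by (auto simp: occupied_def)
  qed
  then show "hop_back p s y i < hop_back p s y (i + 1)"
    using lt by (auto simp: hop_back_def)
  show "hop_back p s y (i + (int k + 1)) = hop_back p s y i + (int p + 1)"
    using c by (simp add: hop_back_def conf_def)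
qed

lemma hop_back_bounds: "hop_back p s y i \<le> y i" "y i \<le> hop_back p s y i + 1"
  by (auto simp: hop_back_def)

lemma packed_small: "0 \<le> i \<Longrightarrow> i \<le> int k \<Longrightarrow> packed p k i = i"
  by (simp add: packed_def)

lemma packed_period: "packed p k (i + (int k + 1) * z) = packed p k i + (int p + 1) * z"
  unfolding packed_def by (subst mod_mult_self2, subst div_mult_self2) (auto simp: distrib_left)

lemma label_cases:
  fixes i :: int
  obtains j z where "0 \<le> j" "j \<le> int k" "i = j + (int k + 1) * z"
proof
  show "0 \<le> i mod (int k + 1)" "i mod (int k + 1) \<le> int k"
    using pos_mod_bound[of "int k + 1" i] by (auto simp del: pos_mod_bound)
  show "i = i mod (int k + 1) + (int k + 1) * (i div (int k + 1))"
    by simp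
qed

lemma conf_packed: "k \<le> p \<Longrightarrow> conf p k (packed p k)"
  unfolding conf_def
proof (intro conjI allI)
  fix i assume kp: "k \<le> p"
  obtain j z where j: "0 \<le> j" "j \<le> int k" "i = j + (int k + 1) * z"
    by (rule label_cases)
  show "packed p k i < packed p k (i + 1)"
  proof (cases "j = int k")
    case True
    have "i + 1 = 0 + (int k + 1) * (z + 1)"
      using True j by (simp add: algebra_simps)
    then have "packed p k (i + 1) = packed p k 0 + (int p + 1) * (z + 1)"
      by (simp only: packed_period)
    moreover have "packed p k i = int k + (int p + 1) * z"
      using j True by (simp only: packed_period) (simp add: packed_small)
    ultimately show ?thesis
      using kp by (simp add: packed_small distrib_left)
  next
    case False
    have "i + 1 = (j + 1) + (int k + 1) * z"
      using j by simp
    then have "packed p k (i + 1) = packed p k (j + 1) + (int p + 1) * z"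
      by (simp only: packed_period)
    then show ?thesis
      using j False by (simp add: packed_period packed_small)
  qed
next
  fix i
  show "packed p k (i + (int k + 1)) = packed p k i + (int p + 1)"
    using packed_period[of p k i 1] by simp
qed

section \<open>Reachable configurations\<close>

lemma cnt_nonneg: "(\<And>j. a j > 0) \<Longrightarrow> cnt p k a t y \<ge> 0"
proof (induction t arbitrary: y)
  case (Suc t)
  then have "0 \<le> a (t - p) * cnt p k a t y"
    by (simp add: less_imp_le)
  with Suc show ?case
    by simp
qed simp

lemma cnt_Suc_ge:
  assumes "\<And>j. a j > 0"
  obtains w where "w > 0" "cnt p k a (Suc t) y \<ge> w * cnt p k a t y"
proof (cases "t < k \<or> \<not> occupied p y (int t + 1)")
  case True
  then show ?thesis
    using that[of 1] by simp
next
  case False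
  then show ?thesis
    using that[of "a (t - p)"] assms cnt_nonneg[OF assms] by auto
qed

lemma cnt_pos_Suc: "(\<And>j. a j > 0) \<Longrightarrow> cnt p k a t y > 0 \<Longrightarrow> cnt p k a (Suc t) y > 0"
  by (metis cnt_Suc_ge less_le_trans mult_pos_pos)

lemma cnt_pos_mono:
  assumes "\<And>j. a j > 0" "cnt p k a t y > 0" "t \<le> t'"
  shows "cnt p k a t' y > 0"
  using assms(3)
proof (induction t' rule: dec_induct)
  case (step n)
  then show ?case
    using cnt_pos_Suc[of a, OF assms(1)] by blast
qed (use assms(2) in simp)

lemma cnt_Suc_cases:
  assumes "cnt p k a (Suc t) y \<noteq> 0"
  obtains "cnt p k a t y \<noteq> 0"
  | "t \<ge> k" "occupied p y (int t + 1)" "\<not> occupied p y (int t)"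
    "cnt p k a t (hop_back p (int t + 1) y) \<noteq> 0"
  using assms by (cases "cnt p k a t y = 0") (auto split: if_splits)

lemma cnt_ge_packed: "cnt p k a t y \<noteq> 0 \<Longrightarrow> packed p k i \<le> y i"
proof (induction t arbitrary: y)
  case (Suc t)
  from Suc.prems show ?case
    by (cases rule: cnt_Suc_cases) (use Suc.IH hop_back_bounds(1) order_trans in blast)+
qed (auto split: if_splits)

lemma cnt_front_le:
  assumes "cnt p k a t y \<noteq> 0" "t \<ge> k"
  shows "y (int k) \<le> int t"
  using assms
proof (induction t arbitrary: y)
  case (Suc t)
  have early: "y = packed p k" if "cnt p k a s y \<noteq> 0" "s \<le> k" for s y
    using that by (induction s) (auto split: if_splits)
  show ?case
  proof (cases "Suc t = k")
    case True
    then show ?thesis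
      using early[OF Suc.prems(1)] by (simp add: packed_small)
  next
    case False
    then have "t \<ge> k"
      using Suc.prems by simp
    from Suc.prems(1) show ?thesis
    proof (cases rule: cnt_Suc_cases)
      case 1
      then show ?thesis
        using Suc.IH[OF _ \<open>t \<ge> k\<close>] by fastforce
    next
      case 2
      then show ?thesis
        using Suc.IH[OF _ \<open>t \<ge> k\<close>] hop_back_bounds(2)[of y "int k" p "int t + 1"] by fastforce
    qed
  qed
qed (auto simp: packed_small split: if_splits)

text \<open>Particles that stop as soon as they reach their position in \<open>y\<close> never collide, so every
  configuration between the initial one and a reachable one is reachable.\<close>

lemma cnt_pos_truncate:
  assumes a: "\<And>j. a j > 0"
  shows "conf p k y \<Longrightarrow> conf p k y' \<Longrightarrow> (\<And>i. packed p k i \<le> y i) \<Longrightarrow> (\<And>i. y i \<le> y' i) \<Longrightarrow>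
    cnt p k a t y' \<noteq> 0 \<Longrightarrow> cnt p k a t y > 0"
proof (induction t arbitrary: y y')
  case 0
  then have "y' = packed p k"
    by (simp split: if_splits)
  with 0 have "y = packed p k"
    by (intro ext antisym) auto
  then show ?case
    by simp
next
  case (Suc t)
  note c = \<open>conf p k y\<close> and c' = \<open>conf p k y'\<close>
  let ?M = "int p + 1" and ?s = "int t + 1"
  from Suc.prems(5) show ?case
  proof (cases rule: cnt_Suc_cases)
    case 1
    then show ?thesis
      using Suc.IH[OF c c' Suc.prems(3,4)] cnt_pos_Suc[of a, OF a] by blast
  next
    case 2
    have ch': "conf p k (hop_back p ?s y')"
      using conf_hop_back[OF c'] 2 by simp
    show ?thesis
    proof (cases "\<forall>i. y i \<le> hop_back p ?s y' i")
      case True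
      then show ?thesis
        using Suc.IH[OF c ch' Suc.prems(3) _ 2(4)] cnt_pos_Suc[of a, OF a] by blast
    next
      \<comment> \<open>Some particle has the same position in \<open>y\<close> and
        \<open>y'\<close> and makes the last hop. Then all its copies agree as well, the site
        \<open>t\<close> is vacant in \<open>y\<close> too, and the hop can be undone in both
        configurations.\<close>
      case False
      then obtain i where "\<not> y i \<le> hop_back p ?s y' i"
        by blast
      then have i: "y i = y' i" "y' i mod ?M = ?s mod ?M"
        using Suc.prems(4)[of i] by (auto simp: hop_back_def split: if_splits)
      have all: "y i' = y' i'" if "y' i' mod ?M = ?s mod ?M" for i'
      proof -
        from that i(2) have "y' i mod ?M = y' i' mod ?M"
          by simp
        then obtain z where z: "y' (i + (int k + 1) * z) = y' i'"
          using conf_mod_eq_iff[OF c'] by blast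
        then have "i' = i + (int k + 1) * z"
          using conf_eq_iff[OF c'] by metis
        then show ?thesis
          using conf_period[OF c] conf_period[OF c'] i(1) by simp
      qed
      have un: "\<not> occupied p y (int t)"
      proof
        assume "occupied p y (int t)"
        obtain z where z: "y' (i + (int k + 1) * z) = ?s"
          using conf_mod_eq_iff[OF c'] i by blast
        define l where "l = i + (int k + 1) * z"
        have yl: "y l = ?s" "y' l = ?s"
          using z all[of l] by (auto simp: l_def)
        obtain l' where l': "y l' = int t"
          using \<open>occupied p y (int t)\<close> occupied_iff[OF c] by blast
        then have "l' < l"
          using conf_less_iff[OF c, of l' l] yl by simp
        then have "y' l' < ?s"
          using conf_less[OF c'] yl by metis
        then have "y' l' = int t"
          using Suc.prems(4)[of l'] l' by simp
        then show False
          using 2(3) occupied_iff[OF c'] by blast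
      qed
      have hb: "y j mod ?M = ?s mod ?M \<longleftrightarrow> y' j mod ?M = ?s mod ?M" for j
      proof
        assume "y j mod ?M = ?s mod ?M"
        then have "y i mod ?M = y j mod ?M"
          using i by simp
        then obtain z where "y (i + (int k + 1) * z) = y j"
          using conf_mod_eq_iff[OF c] by blast
        then have "j = i + (int k + 1) * z"
          using conf_eq_iff[OF c] by metis
        then show "y' j mod ?M = ?s mod ?M"
          using conf_period[OF c'] i by simp
      qed (use all in auto)
      have "cnt p k a t (hop_back p ?s y) > 0"
      proof (rule Suc.IH[OF _ ch' _ _ 2(4)])
        show "conf p k (hop_back p ?s y)"
          using conf_hop_back[OF c] un by simp
        fix j
        show "packed p k j \<le> hop_back p ?s y j"
        proof (cases "y' j mod ?M = ?s mod ?M")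
          case True
          then show ?thesis
            using cnt_ge_packed[OF 2(4), of j] all[OF True] by (simp add: hop_back_def)
        next
          case False
          then show ?thesis
            using hb Suc.prems(3) by (simp add: hop_back_def)
        qed
        show "hop_back p ?s y j \<le> hop_back p ?s y' j"
          using hb[of j] Suc.prems(4)[of j] by (simp add: hop_back_def)
      qed
      moreover have "occupied p y ?s"
        unfolding occupied_def using i by metis
      moreover have "0 \<le> a (t - p) * cnt p k a t y"
        by (simp add: less_imp_le a cnt_nonneg[of a, OF a])
      ultimately show ?thesis
        using un 2(1) by simp
    qed
  qed
qed

section \<open>Timing of extremal evolutions\<close>

definition stretched :: "nat \<Rightarrow> nat \<Rightarrow> nat \<Rightarrow> nat \<Rightarrow> nat \<Rightarrow> int \<Rightarrow> int" where
  "stretched p k l e d i =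
     packed p k i + (if i mod (int k + 1) < int l then 0
       else if i mod (int k + 1) = int l then int e else int d)"

lemma stretched_small:
  "0 \<le> i \<Longrightarrow> i \<le> int k \<Longrightarrow>
    stretched p k l e d i = (if i < int l then i else if i = int l then i + int e else i + int d)"
  by (simp add: stretched_def packed_small)

lemma stretched_period:
  "stretched p k l e d (i + (int k + 1) * z) = stretched p k l e d i + (int p + 1) * z"
  unfolding stretched_def by (simp only: packed_period mod_mult_self2)

lemma mod_eq_small_iff:
  fixes x :: int
  assumes "0 \<le> x" "x < m" "0 \<le> y" "y < m"
  shows "x mod m = y mod m \<longleftrightarrow> x = y"
  using assms by simp

lemma cnt_packed_pos: "(\<And>j. a j > 0) \<Longrightarrow> cnt p k a t (packed p k) > 0"
  by (rule cnt_pos_mono[of a p k 0]) auto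

text \<open>The bound \<open>d + k \<le> p\<close> keeps particles \<open>0\<close>, ...,
  \<open>k\<close> inside the sites \<open>0\<close>, ..., \<open>p\<close>, where residues
  determine sites. So step \<open>t\<close> moves particle \<open>l\<close> and its copies only, and
  \<open>e < d\<close> keeps the site ahead free.\<close>

lemma stretched_hop:
  assumes a: "\<And>j. a j > 0" and "l \<le> k" "e < d" "d + k \<le> p" "k \<le> t"
    and t: "int t mod (int p + 1) = int (l + e) mod (int p + 1)"
    and pos: "cnt p k a t (stretched p k l e d) > 0"
  shows "cnt p k a (Suc t) (stretched p k l (Suc e) d) > 0"
proof -
  let ?M = "int p + 1" and ?y = "stretched p k l (Suc e) d"
  have small: "?y j mod ?M = s mod ?M \<longleftrightarrow> ?y j = s"
    if "0 \<le> j" "j \<le> int k" "0 \<le> s" "s < ?M" for j s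
    using that assms(2-4) by (intro mod_eq_small_iff) (auto simp: stretched_small)
  have t1: "(int t + 1) mod ?M = int (l + e + 1) mod ?M"
    using t by (metis mod_add_left_eq of_nat_1 of_nat_add)
  have "?y (int l) mod ?M = (int t + 1) mod ?M"
  proof -
    have "?y (int l) = int (l + e + 1)"
      using assms(2) by (simp add: stretched_small)
    then show ?thesis
      by (simp only: t1)
  qed
  then have o1: "occupied p ?y (int t + 1)"
    unfolding occupied_def by blast
  have o2: "\<not> occupied p ?y (int t)"
  proof
    assume "occupied p ?y (int t)"
    then obtain i where i: "?y i mod ?M = int (l + e) mod ?M"
      unfolding occupied_def t by blast
    obtain j z where j: "0 \<le> j" "j \<le> int k" "i = j + (int k + 1) * z"
      by (rule label_cases)
    have "?y j mod ?M = int (l + e) mod ?M"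
      using i unfolding j(3) stretched_period by (simp only: mod_mult_self2)
    then have "?y j = int (l + e)"
      using small[OF j(1,2), of "int (l + e)"] assms(2-4) by linarith
    then show False
      using j assms(2-4) by (auto simp: stretched_small split: if_splits)
  qed
  have "hop_back p (int t + 1) ?y = stretched p k l e d"
  proof
    fix i
    obtain j z where j: "0 \<le> j" "j \<le> int k" "i = j + (int k + 1) * z"
      by (rule label_cases)
    have "?y i mod ?M = (int t + 1) mod ?M \<longleftrightarrow> ?y j mod ?M = int (l + e + 1) mod ?M"
      unfolding j(3) stretched_period t1 by (simp only: mod_mult_self2)
    also have "\<dots> \<longleftrightarrow> ?y j = int (l + e + 1)"
      using small[OF j(1,2)] assms(2-4) by simp
    also have "\<dots> \<longleftrightarrow> j = int l"
      using j assms(2-4) by (auto simp: stretched_small)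
    finally show "hop_back p (int t + 1) ?y i = stretched p k l e d i"
      using j unfolding hop_back_def j(3) stretched_period by (auto simp: stretched_small)
  qed
  moreover have "0 \<le> a (t - p) * cnt p k a t ?y"
    by (simp add: less_imp_le a cnt_nonneg[of a, OF a])
  ultimately show ?thesis
    using o1 o2 pos \<open>k \<le> t\<close> by simp
qed

text \<open>Particle \<open>k - s\<close> performs all its hops during round \<open>s\<close>.\<close>

lemma cnt_stretched_pos:
  assumes a: "\<And>j. a j > 0" and "l \<le> k" "e \<le> d" "d + k \<le> p"
    and "t \<ge> l + e + (k - l) * (p + 1)"
  shows "cnt p k a t (stretched p k l e d) > 0"
  using assms(2-)
proof (induction "k - l" arbitrary: l e t)
  case 0
  have "stretched p k k 0 d = packed p k"
  proof (intro ext)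
    fix i
    obtain j z where j: "0 \<le> j" "j \<le> int k" "i = j + (int k + 1) * z"
      by (rule label_cases)
    then show "stretched p k k 0 d i = packed p k i"
      by (simp only: stretched_period packed_period) (simp add: stretched_small packed_small)
  qed
  then have base: "cnt p k a k (stretched p k k 0 d) > 0"
    using cnt_packed_pos[of a, OF a] by simp
  have "cnt p k a (k + e') (stretched p k k e' d) > 0" if "e' \<le> d" for e'
    using that
  proof (induction e')
    case (Suc e')
    then show ?case
      using stretched_hop[of a, OF a, of k k e' d p "k + e'"] \<open>d + k \<le> p\<close> by simp
  qed (use base in simp)
  moreover have "l = k"
    using 0 by simp
  ultimately show ?case
    using cnt_pos_mono[of a, OF a, of p k "k + e" _ t] 0 by simp
next
  case (Suc q)
  have lk: "l < k"
    using Suc by simp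
  let ?t = "\<lambda>e. l + e + (k - l) * (p + 1)"
  have ge: "(k - l) * (p + 1) = (k - Suc l) * (p + 1) + (p + 1)"
    using lk by (simp add: Suc_diff_Suc[symmetric])
  have tk: "k \<le> ?t e'" for e'
    using lk by (simp add: add_mult_distrib2)
  \<comment> \<open>One configuration in two encodings: the end of the round of particle
    \<open>Suc l\<close> is the start of the round of particle \<open>l\<close>.\<close>
  have "stretched p k l 0 d = stretched p k (Suc l) d d"
  proof
    fix i
    obtain j z where j: "0 \<le> j" "j \<le> int k" "i = j + (int k + 1) * z"
      by (rule label_cases)
    then show "stretched p k l 0 d i = stretched p k (Suc l) d d i"
      by (simp only: stretched_period) (auto simp: stretched_small)
  qed
  moreover have "cnt p k a (?t 0) (stretched p k (Suc l) d d) > 0"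
    by (rule Suc.hyps(1)) (use Suc lk ge in auto)
  ultimately have base: "cnt p k a (?t 0) (stretched p k l 0 d) > 0"
    by simp
  have "cnt p k a (?t e') (stretched p k l e' d) > 0" if "e' \<le> d" for e'
    using that
  proof (induction e')
    case (Suc e')
    have "int (?t e') = int (l + e') + int (k - l) * (int p + 1)"
      by (simp add: distrib_left)
    then have "int (?t e') mod (int p + 1) = int (l + e') mod (int p + 1)"
      by (metis mod_mult_self1)
    then have "cnt p k a (Suc (?t e')) (stretched p k l (Suc e') d) > 0"
      using stretched_hop[of a, OF a, of l k e' d p "?t e'"] \<open>d + k \<le> p\<close> lk tk[of e'] Suc by simp
    then show ?case
      by simp
  qed (use base in simp)
  from this[of e] show ?case
    using cnt_pos_mono[of a, OF a] Suc.prems by blast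
qed

text \<open>Particle \<open>i\<close> can leave site \<open>i\<close> only in a step congruent to
  \<open>i\<close> modulo \<open>p + 1\<close>, and only after particle \<open>i + 1\<close> has
  left \<open>i + 1\<close>; every particle ahead thus costs a further turn. The bound is the time
  from which \<open>cnt_stretched_pos\<close> lets particle \<open>i\<close> hop.\<close>

lemma cnt_waiting:
  assumes "k \<le> p" "1 \<le> p"
  shows "conf p k y \<Longrightarrow> cnt p k a t y \<noteq> 0 \<Longrightarrow> i \<le> k \<Longrightarrow> t \<le> i + (k - i) * (p + 1) \<Longrightarrow> y (int i) = int i"
proof (induction t arbitrary: y i)
  case 0
  then show ?case
    by (auto simp: packed_small split: if_splits)
next
  case (Suc t)
  let ?M = "int p + 1" and ?h = "hop_back p (int t + 1) y"
  from Suc.prems(2) show ?case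
  proof (cases rule: cnt_Suc_cases)
    case 1
    then show ?thesis
      using Suc by simp
  next
    case 2
    have ch: "conf p k ?h"
      using conf_hop_back[OF Suc.prems(1)] 2 by simp
    note IH = Suc.IH[OF ch 2(4)]
    have hi: "?h (int i) = int i"
      using IH Suc.prems by simp
    show ?thesis
    proof (rule ccontr)
      assume "y (int i) \<noteq> int i"
      then have *: "y (int i) - 1 = int i" "y (int i) mod ?M = (int t + 1) mod ?M"
        using hi by (auto simp: hop_back_def split: if_splits)
      then have yi: "y (int i) = int i + 1" "(int i + 1) mod ?M = (int t + 1) mod ?M"
        by (simp, metis diff_add_cancel)
      have ti: "int t mod ?M = int i mod ?M"
        using yi(2) by (metis add_diff_cancel_right' mod_diff_left_eq)
      have "i < k"
        using Suc.prems 2(1) by (cases "i = k") auto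
      \<comment> \<open>\<open>t\<close> is congruent to \<open>i\<close> and strictly below the
        bound for particle \<open>i\<close>, hence at most that bound minus a full turn. At such a
        time particle \<open>i + 1\<close> is still waiting.\<close>
      have "t \<le> i + (k - i - 1) * (p + 1)"
      proof (rule ccontr)
        assume "\<not> ?thesis"
        then have "int (i + (k - i - 1) * (p + 1)) < int t"
          by (simp only: of_nat_less_iff not_le)
        then have lt: "int i + (int k - int i - 1) * ?M < int t"
          using Suc_leI[OF \<open>i < k\<close>] by (simp add: of_nat_diff) (simp add: algebra_simps)
        have "int (Suc t) \<le> int (i + (k - i) * (p + 1))"
          using Suc.prems(4) by (simp only: of_nat_le_iff)
        then have lt2: "int t < int i + (int k - int i) * ?M"
          using \<open>i < k\<close> by (simp add: of_nat_diff) (simp add: algebra_simps)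
        obtain z where z: "int t = int i + ?M * z"
          using ti by (metis mod_eqE mult.commute)
        have "(int k - int i - 1) * ?M < z * ?M" "z * ?M < (int k - int i) * ?M"
          using lt lt2 z by (simp_all add: mult.commute)
        then have "int k - int i - 1 < z" "z < int k - int i"
          by (simp_all add: mult_less_cancel_right)
        then show False
          by simp
      qed
      then have "?h (int (Suc i)) = int (Suc i)"
        using \<open>i < k\<close> by (intro IH) (auto simp: Suc_diff_Suc)
      moreover have "y (int i) < y (int (Suc i))"
        using conf_less[OF Suc.prems(1)] by simp
      ultimately have "(int i + 2) mod ?M = (int t + 1) mod ?M"
        using yi by (auto simp: hop_back_def add_ac split: if_splits)
      then have "?M dvd (int i + 2) - (int i + 1)"
        using yi(2) by (metis mod_eq_dvd_iff)
      then show False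
        using \<open>1 \<le> p\<close> by simp
    qed
  qed
qed

text \<open>Site \<open>p + 1\<close> is the initial site of the copy of particle \<open>0\<close>,
  which waits there up to time \<open>k * (p + 1)\<close>. Particle \<open>k\<close> can enter it
  only in a step with \<open>t + 1\<close> divisible by \<open>p + 1\<close>, so the first chance
  comes at time \<open>(k + 1) * (p + 1)\<close>.\<close>

lemma cnt_front_bound:
  assumes "k \<le> p" "1 \<le> p"
  shows "conf p k y \<Longrightarrow> cnt p k a t y \<noteq> 0 \<Longrightarrow> t < (k + 1) * (p + 1) \<Longrightarrow> y (int k) \<le> int p"
proof (induction t arbitrary: y)
  case 0
  then show ?case
    using assms by (auto simp: packed_small split: if_splits)
next
  case (Suc t)
  let ?M = "int p + 1" and ?h = "hop_back p (int t + 1) y"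
  from Suc.prems(2) show ?case
  proof (cases rule: cnt_Suc_cases)
    case 1
    then show ?thesis
      using Suc by simp
  next
    case 2
    have ch: "conf p k ?h"
      using conf_hop_back[OF Suc.prems(1)] 2 by simp
    have hk: "?h (int k) \<le> int p"
      using Suc.IH[OF ch 2(4)] Suc.prems by simp
    show ?thesis
    proof (rule ccontr)
      assume "\<not> ?thesis"
      then have *: "y (int k) = int p + 1" "y (int k) mod ?M = (int t + 1) mod ?M"
        using hk by (auto simp: hop_back_def split: if_splits)
      then have yk: "y (int k) = int p + 1" "(int p + 1) mod ?M = (int t + 1) mod ?M"
        by simp_all
      then obtain z where z: "int t + 1 = ?M * z"
        by (metis dvdE mod_0_imp_dvd mod_self)
      have "int (Suc t) < int ((k + 1) * (p + 1))"
        using Suc.prems(3) by (simp only: of_nat_less_iff)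
      then have "int t + 1 < (int k + 1) * ?M"
        by (simp add: algebra_simps)
      then have "z * ?M < (int k + 1) * ?M"
        using z by (simp add: mult.commute)
      then have "z \<le> int k"
        by (simp only: mult_less_cancel_right)  (simp split: if_splits)
      then have "z * ?M \<le> int k * ?M"
        by (intro mult_right_mono) auto
      then have "int t \<le> int (k * (p + 1))"
        using z by (simp add: algebra_simps)
      then have "t \<le> k * (p + 1)"
        by (simp only: of_nat_le_iff)
      then have h0: "?h 0 = 0"
        using cnt_waiting[OF assms ch 2(4), of 0] by simp
      have "y (int k) < y (0 + (int k + 1) * 1)"
        using conf_less[OF Suc.prems(1)] by simp
      then have "y 0 \<ge> 1"
        using yk conf_period[OF Suc.prems(1), of 0 1] by simp
      then have "1 mod ?M = (int t + 1) mod ?M"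
        using h0 by (auto simp: hop_back_def split: if_splits)
      then show False
        using yk \<open>1 \<le> p\<close> by simp
    qed
  qed
qed

section \<open>Evolutions that end in an arc of consecutive sites\<close>

definition arc :: "nat \<Rightarrow> nat \<Rightarrow> nat \<Rightarrow> int \<Rightarrow> int" where
  "arc p k n i = int n - int k + packed p k i"

text \<open>The largest \<open>b\<close> for which the shifted arc still dominates \<open>packed\<close>; it becomes the degree.\<close>

definition top_shift :: "nat \<Rightarrow> nat \<Rightarrow> nat \<Rightarrow> int" where
  "top_shift p k n = (let j = n mod (p + 1); r = n div (p + 1) in
     (int k + 1) * int r - (if k \<le> j then 0 else int k - int j))"

lemma conf_arc: "k \<le> p \<Longrightarrow> conf p k (\<lambda>i. arc p k n (i - b))"
  unfolding arc_def using conf_shift[OF conf_add[OF conf_packed]] by blast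

lemma conf_arc0: "k \<le> p \<Longrightarrow> conf p k (arc p k n)"
  using conf_arc[of k p n 0] by simp

lemma arc_small: "0 \<le> i \<Longrightarrow> i \<le> int k \<Longrightarrow> arc p k n i = int n - int k + i"
  by (simp add: arc_def packed_small)

lemma arc_period: "arc p k n (i + (int k + 1) * z) = arc p k n i + (int p + 1) * z"
  by (simp add: arc_def packed_period)

text \<open>Let \<open>j\<close> be the residue of \<open>n\<close>. Moved back by whole turns, the
  arc lies at \<open>j - k\<close>, ..., \<open>j\<close>. If \<open>j < k\<close>, its lower part
  would fall below \<open>0\<close> and is taken one turn up instead: particles \<open>0\<close>,
  ..., \<open>j\<close> rest, the others advance by \<open>p - k\<close>. The hops add up to
  \<open>(j - k) * (k + 1)\<close> and \<open>(k - j) * (p - k)\<close>, the two cases of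
  \<open>m_exp\<close>.\<close>

lemma arc_top_shift:
  assumes "k \<le> p"
  shows "arc p k n (i - top_shift p k n) =
    (if k \<le> n mod (p + 1) then stretched p k 0 (n mod (p + 1) - k) (n mod (p + 1) - k) i
     else stretched p k (n mod (p + 1) + 1) (p - k) (p - k) i)" (is "?l i = ?r i")
proof -
  let ?j = "n mod (p + 1)" and ?q = "n div (p + 1)"
  have n: "int n = int ?j + (int p + 1) * int ?q"
    unfolding of_nat_mod of_nat_div by (simp only: of_nat_add of_nat_1) (simp only: mod_mult_div_eq)
  obtain l z where l: "0 \<le> l" "l \<le> int k" "i = l + (int k + 1) * z"
    by (rule label_cases)
  have "?l i = ?l (l + (int k + 1) * z)"
    using l by simp
  also have "\<dots> = ?l l + (int p + 1) * z"
    using arc_period[of p k n "l - top_shift p k n" z] by (simp add: algebra_simps)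
  finally have li: "?l i = ?l l + (int p + 1) * z" .
  have ri: "?r i = ?r l + (int p + 1) * z"
    unfolding l(3) stretched_period by simp
  have "?l l = ?r l"
  proof (cases "k \<le> ?j")
    case True
    then have "l - top_shift p k n = l + (int k + 1) * (- int ?q)"
      by (simp add: top_shift_def Let_def)
    then have "?l l = arc p k n l + (int p + 1) * (- int ?q)"
      by (simp only: arc_period)
    then show ?thesis
      using l True n by (simp add: arc_small stretched_small of_nat_diff)
  next
    case False
    have lj: "l - top_shift p k n = (l + int k - int ?j) + (int k + 1) * (- int ?q)"
      using False by (simp add: top_shift_def Let_def)
    show ?thesis
    proof (cases "l \<le> int ?j")
      case True
      have "?l l = arc p k n (l + int k - int ?j) + (int p + 1) * (- int ?q)"
        by (simp only: lj arc_period)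
      then show ?thesis
        using l True False n by (simp add: arc_small stretched_small)
    next
      case False': False
      have "l + int k - int ?j = (l - int ?j - 1) + (int k + 1) * 1"
        by simp
      then have "arc p k n (l + int k - int ?j) = arc p k n (l - int ?j - 1) + (int p + 1) * 1"
        by (simp only: arc_period)
      moreover have "?l l = arc p k n (l + int k - int ?j) + (int p + 1) * (- int ?q)"
        by (simp only: lj arc_period)
      moreover have "arc p k n (l - int ?j - 1) = int n - int k + (l - int ?j - 1)"
        using False' l by (intro arc_small) auto
      moreover have "int (p - k) = int p - int k"
        using assms by (simp add: of_nat_diff)
      ultimately show ?thesis
        using l False False' n by (simp add: stretched_small)
    qed
  qed
  then show ?thesis
    using li ri by simp
qed

lemma packed_le_arc_top:
  assumes "k \<le> p" "b \<le> top_shift p k n"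
  shows "packed p k i \<le> arc p k n (i - b)"
proof -
  have "packed p k i \<le> arc p k n (i - top_shift p k n)"
    unfolding arc_top_shift[OF assms(1)] by (simp add: stretched_def)
  also have "\<dots> \<le> arc p k n (i - b)"
    using assms conf_le_iff[OF conf_arc0] by simp
  finally show ?thesis .
qed

text \<open>With one more label shift, particle \<open>0\<close> (if \<open>k \<le> j\<close>) or
  particle \<open>j + 1\<close> (otherwise) would end below its initial site.\<close>

lemma cnt_arc_shift_le:
  assumes "k \<le> p" "cnt p k a t (\<lambda>i. arc p k n (i - b)) \<noteq> 0"
  shows "b \<le> top_shift p k n"
proof (rule ccontr)
  let ?j = "n mod (p + 1)"
  assume "\<not> ?thesis"
  then have le: "arc p k n (i - b) \<le> arc p k n (i - 1 - top_shift p k n)" for i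
    using conf_le_iff[OF conf_arc0[OF assms(1)]] by simp
  have ge: "packed p k i \<le> arc p k n (i - 1 - top_shift p k n)" for i
    using cnt_ge_packed[OF assms(2), of i] le[of i] by simp
  have jp: "int ?j \<le> int p"
    by (simp add: less_Suc_eq_le[symmetric])
  show False
  proof (cases "k \<le> ?j")
    case True
    have "arc p k n (0 - 1 - top_shift p k n) = stretched p k 0 (?j - k) (?j - k) (int k + (int k + 1) * (-1))"
      unfolding arc_top_shift[OF assms(1)] using True by simp
    also have "\<dots> = int k + int (?j - k) - (int p + 1)"
      unfolding stretched_period by (simp add: stretched_small)
    finally have e: "arc p k n (0 - 1 - top_shift p k n) = int k + int (?j - k) - (int p + 1)" .
    have "int (?j - k) = int ?j - int k"
      using True by (rule of_nat_diff)
    moreover have "packed p k 0 = 0"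
      by (simp add: packed_small)
    ultimately show False
      using ge[of 0] e jp by linarith
  next
    case False
    have "arc p k n (int ?j + 1 - 1 - top_shift p k n) = stretched p k (?j + 1) (p - k) (p - k) (int ?j)"
      unfolding arc_top_shift[OF assms(1)] using False by simp
    then show False
      using ge[of "int ?j + 1"] False by (simp add: packed_small stretched_small)
  qed
qed

text \<open>This is the origin of \<open>nondegenerate\<close>: it supplies the time that
  \<open>cnt_stretched_pos\<close> asks for. For \<open>j = k\<close> no hop is required.\<close>

lemma cnt_arc_top_pos:
  assumes a: "\<And>j. a j > 0" and "k \<le> p" "nondegenerate p k n"
  shows "cnt p k a n (\<lambda>i. arc p k n (i - top_shift p k n)) > 0"
proof -
  let ?j = "n mod (p + 1)" and ?r = "n div (p + 1)"
  have jp: "?j \<le> p"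
    by (simp add: less_Suc_eq_le[symmetric])
  have n: "n = ?r * (p + 1) + ?j"
    by (rule div_mult_mod_eq[symmetric])
  show ?thesis
  proof (cases "k \<le> ?j")
    case True
    show ?thesis
    proof (cases "?j = k")
      case True
      then have "(\<lambda>i. arc p k n (i - top_shift p k n)) = packed p k"
        unfolding arc_top_shift[OF assms(2)] by (simp add: stretched_def fun_eq_iff)
      then show ?thesis
        using cnt_packed_pos[of a, OF a] by simp
    next
      case False
      then have "k \<le> ?r"
        using True assms(3) by (simp add: nondegenerate_def Let_def split: if_splits)
      then have "k * (p + 1) \<le> ?r * (p + 1)"
        by (rule mult_right_mono) simp
      then have "?j - k + k * (p + 1) \<le> n"
        using n by linarith
      then show ?thesis
        unfolding arc_top_shift[OF assms(2)] using True jp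
        by (auto intro!: cnt_stretched_pos a)
    qed
  next
    case False
    then have "k \<le> ?r + ?j"
      using assms(3) by (simp add: nondegenerate_def Let_def)
    then have "(k - ?j) * (p + 1) \<le> ?r * (p + 1)"
      by (intro mult_right_mono) auto
    moreover have "(k - ?j) * (p + 1) = (k - (?j + 1)) * (p + 1) + (p + 1)"
      using False by (simp add: Suc_diff_Suc[symmetric])
    ultimately have "?j + 1 + (p - k) + (k - (?j + 1)) * (p + 1) \<le> n"
      using n False assms(2) by linarith
    then show ?thesis
      unfolding arc_top_shift[OF assms(2)] using False assms(2)
      by (auto intro!: cnt_stretched_pos a)
  qed
qed

text \<open>A smaller shift would put particle \<open>k\<close> at or beyond the place that particle
  \<open>k + 1\<close> has for \<open>top_shift\<close>. That place is at least
  \<open>p + 1\<close>, which \<open>cnt_front_bound\<close> excludes.\<close>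

lemma cnt_arc_monomial:
  assumes "k \<le> p" "1 \<le> p" "n < (k + 1) * (p + 1)" "b \<noteq> top_shift p k n"
  shows "cnt p k a n (\<lambda>i. arc p k n (i - b)) = 0"
proof (rule ccontr)
  assume *: "cnt p k a n (\<lambda>i. arc p k n (i - b)) \<noteq> 0"
  then have "b < top_shift p k n"
    using cnt_arc_shift_le[OF assms(1) *] assms(4) by simp
  then have "arc p k n (0 + (int k + 1) * 1 - top_shift p k n) \<le> arc p k n (int k - b)"
    using conf_le_iff[OF conf_arc0[OF assms(1)]] by simp
  moreover have "arc p k n (int k - b) \<le> int p"
    using cnt_front_bound[OF assms(1,2) conf_arc[OF assms(1)] * assms(3)] by simp
  moreover have "arc p k n (0 + (int k + 1) * 1 - top_shift p k n) = arc p k n (0 - top_shift p k n) + (int p + 1) * 1"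
    using arc_period[of p k n "- top_shift p k n" 1] by (simp add: algebra_simps)
  ultimately show False
    using packed_le_arc_top[OF assms(1) order_refl, of 0 n] by (simp add: packed_small)
qed

lemma occupied_arc_iff:
  assumes "k \<le> p" "- int k \<le> s" "s \<le> int p"
  shows "occupied p (\<lambda>i. arc p k n (i - b)) (int n + s) \<longleftrightarrow> - int k \<le> s \<and> s \<le> 0 \<or> s \<ge> int p + 1 - int k"
proof -
  have "(\<exists>i. arc p k n i = int n + s) \<longleftrightarrow> - int k \<le> s \<and> s \<le> 0 \<or> s \<ge> int p + 1 - int k" (is "?l \<longleftrightarrow> ?r")
  proof
    assume ?l
    then obtain i where i: "arc p k n i = int n + s"
      by blast
    obtain j z where j: "0 \<le> j" "j \<le> int k" "i = j + (int k + 1) * z"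
      by (rule label_cases)
    have kp: "int k \<le> int p"
      using assms(1) by simp
    have eq: "j - int k + (int p + 1) * z = s"
      using i unfolding j(3) arc_period using j by (simp add: arc_small)
    define w where "w = (int p + 1) * z"
    have "w < (int p + 1) * 2"
      using eq[folded w_def] j(1,2) assms(2,3) kp by (simp add: algebra_simps)
    then have "z < 2"
      unfolding w_def by (simp only: mult_less_cancel_left split: if_splits)
    have "(int p + 1) * (- 1) \<le> w"
      using eq[folded w_def] j(1,2) assms(2,3) kp by (simp add: algebra_simps)
    then have "z \<ge> -1"
      unfolding w_def by (simp only: mult_le_cancel_left split: if_splits)
    with \<open>z < 2\<close> consider "z = -1" | "z = 0" | "z = 1"
      by linarith
    then show ?r
      using eq j assms by cases auto
  next
    assume ?r
    then show ?l
    proof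
      assume "- int k \<le> s \<and> s \<le> 0"
      then have "arc p k n (s + int k) = int n + s"
        by (simp add: arc_small)
      then show ?l
        by blast
    next
      assume "s \<ge> int p + 1 - int k"
      then have "arc p k n ((s - (int p + 1) + int k) + (int k + 1) * 1) = int n + s"
        unfolding arc_period using assms by (simp add: arc_small)
      then show ?l
        by blast
    qed
  qed
  then show ?thesis
    using occupied_iff[OF conf_arc0[OF assms(1)]] by (simp add: occupied_shift)
qed

text \<open>The sites \<open>n + 1\<close>, ..., \<open>n + p - k\<close> are vacant in the arc, so
  the steps that look at them change nothing.\<close>

lemma cnt_arc_delay:
  assumes "k \<le> p" "s + k \<le> p"
  shows "cnt p k a (n + s) (\<lambda>i. arc p k n (i - b)) = cnt p k a n (\<lambda>i. arc p k n (i - b))"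
  using assms(2)
proof (induction s)
  case (Suc s)
  then have "\<not> occupied p (\<lambda>i. arc p k n (i - b)) (int n + (int s + 1))"
    by (subst occupied_arc_iff[OF assms(1)]) auto
  then show ?case
    using Suc by (simp add: add_ac)
qed simp

lemma arc_add_period: "arc p k (n + p + 1) i = arc p k n (i + (int k + 1))"
  using arc_period[of p k n i 1] by (simp add: arc_def)

text \<open>For the polynomials below: the order of vanishing at \<open>0\<close> does not decrease with \<open>n\<close>.\<close>

lemma cnt_arc_Suc:
  assumes a: "\<And>j. a j > 0" and kp: "k < p" and nd: "nondegenerate p k n"
    and nz: "cnt p k a (n + 1) (\<lambda>i. arc p k (n + 1) (i - b)) \<noteq> 0"
  shows "\<exists>b'\<le>b. cnt p k a n (\<lambda>i. arc p k n (i - b')) \<noteq> 0"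
proof (cases "b \<le> top_shift p k n")
  case True
  have "cnt p k a (n + 1) (\<lambda>i. arc p k n (i - b)) > 0"
    by (rule cnt_pos_truncate[of a, OF a conf_arc conf_arc _ _ nz])
      (use kp packed_le_arc_top[of k p b n] True in \<open>auto simp: arc_def\<close>)
  then show ?thesis
    using cnt_arc_delay[of k p 1 a n b] kp by auto
next
  case False
  then show ?thesis
    using cnt_arc_top_pos[of a, OF a _ nd] kp by (intro exI[of _ "top_shift p k n"]) auto
qed

text \<open>Over a full period the order of vanishing at \<open>0\<close> grows by at least
  \<open>k\<close>. In the last \<open>k\<close> steps both relevant sites belong to the arc, so no
  hop ends there and the arc was complete at time \<open>n + p + 1 - k\<close>. The target for
  \<open>n\<close>, with labels shifted by \<open>b - k\<close>, lies at least one site behind for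
  every particle; this slack allows one more step to be undone, and the remaining
  \<open>p - k\<close> steps are idle by \<open>cnt_arc_delay\<close>.\<close>

lemma cnt_arc_add_period:
  assumes a: "\<And>j. a j > 0" and kp: "k < p" and nd: "nondegenerate p k n"
    and nz: "cnt p k a (n + p + 1) (\<lambda>i. arc p k (n + p + 1) (i - b)) \<noteq> 0"
  shows "\<exists>b'\<le>b - int k. cnt p k a n (\<lambda>i. arc p k n (i - b')) \<noteq> 0"
proof (cases "b - int k \<le> top_shift p k n")
  case True
  define y' where "y' = (\<lambda>i. arc p k (n + p + 1) (i - b))"
  define y where "y = (\<lambda>i. arc p k n (i - (b - int k)))"
  define t where "t = n + p - k"
  have y': "conf p k y'" and y: "conf p k y"
    unfolding y'_def y_def using kp by (intro conf_arc, simp)+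
  have "cnt p k a (Suc (t + s)) y' \<noteq> 0 \<longrightarrow> cnt p k a (Suc t) y' \<noteq> 0" if "s \<le> k" for s
    using that
  proof (induction s)
    case (Suc s)
    let ?i = "int s + 1 - int k"
    have "int (Suc (t + s)) = int (n + p + 1) + (?i - 1)" "int (Suc (t + s)) + 1 = int (n + p + 1) + ?i"
      using kp by (auto simp: t_def of_nat_diff)
    then have "occupied p y' (int (Suc (t + s)))" "occupied p y' (int (Suc (t + s)) + 1)"
      using Suc.prems kp unfolding y'_def by (simp_all only:) (subst occupied_arc_iff; simp)+
    then show ?case
      using Suc by auto
  qed simp
  from this[of k] have "cnt p k a (Suc t) y' \<noteq> 0"
    using nz kp by (simp add: t_def y'_def)
  moreover have yy': "y i = y' (i - 1)" for i
    unfolding y_def y'_def arc_add_period by (simp add: algebra_simps)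
  have lt: "y i + 1 \<le> y' i" for i
    using conf_gap[OF _ y', of 1 "i - 1"] yy' by simp
  have pk: "packed p k i \<le> y i" for i
    unfolding y_def using packed_le_arc_top[OF _ True] kp by simp
  from \<open>cnt p k a (Suc t) y' \<noteq> 0\<close> have "cnt p k a t y > 0"
  proof (cases rule: cnt_Suc_cases)
    case 1
    then show ?thesis
      using lt by (intro cnt_pos_truncate[of a, OF a y y' pk]) (auto intro: order_trans[OF _ lt])
  next
    case 2
    have "conf p k (hop_back p (int t + 1) y')"
      using conf_hop_back[OF y'] 2 by simp
    moreover have "y i \<le> hop_back p (int t + 1) y' i" for i
      using lt[of i] hop_back_bounds(2)[of y' i p "int t + 1"] by simp
    ultimately show ?thesis
      using cnt_pos_truncate[of a, OF a y _ pk] 2 by blast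
  qed
  then show ?thesis
    using cnt_arc_delay[of k p "p - k" a n "b - int k"] kp
    by (intro exI[of _ "b - int k"]) (auto simp: t_def y_def)
next
  case False
  then show ?thesis
    using cnt_arc_top_pos[of a, OF a _ nd] kp by (intro exI[of _ "top_shift p k n"]) auto
qed

lemma cnt_arc_shift_nonneg:
  assumes "k \<le> p" "k \<le> n" "cnt p k a n (\<lambda>i. arc p k n (i - b)) \<noteq> 0"
  shows "0 \<le> b"
proof -
  have "arc p k n (int k - b) \<le> arc p k n (int k)"
    using cnt_front_le[OF assms(3,2)] by (simp add: arc_small)
  then show ?thesis
    using conf_le_iff[OF conf_arc0[OF assms(1)]] by simp
qed

text \<open>Particle \<open>0\<close> is still waiting at site \<open>0\<close>, whereas the arc
  covers the residues \<open>1\<close>, ..., \<open>k + 1\<close> only.\<close>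

lemma cnt_arc_degenerate:
  assumes "k < p" "1 \<le> p" "n mod (p + 1) = k + 1" "n \<le> k * (p + 1)"
  shows "cnt p k a n (\<lambda>i. arc p k n (i - b)) = 0"
proof (rule ccontr)
  assume "\<not> ?thesis"
  then have "arc p k n (int 0 - b) = int 0"
    using assms by (intro cnt_waiting[OF _ _ conf_arc]) auto
  then have "occupied p (\<lambda>i. arc p k n (i - b)) 0"
    unfolding occupied_def by (intro exI[of _ 0]) simp
  moreover have "0 mod (int p + 1) = (int n + (int p - int k)) mod (int p + 1)"
  proof -
    have "int n mod (int p + 1) = int k + 1"
      using assms(3) by (metis of_nat_1 of_nat_add of_nat_mod)
    then have "(int n + (int p - int k)) mod (int p + 1) = (int k + 1 + (int p - int k)) mod (int p + 1)"
      by (metis mod_add_left_eq)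
    then show ?thesis
      by (simp add: add.commute[of 1])
  qed
  ultimately have "occupied p (\<lambda>i. arc p k n (i - b)) (int n + (int p - int k))"
    unfolding occupied_def by simp
  then show False
    using occupied_arc_iff[of k p "int p - int k" n b] assms by simp
qed

subsection \<open>Fundamental solutions and their minors\<close>

fun fund_sol :: "nat \<Rightarrow> (nat \<Rightarrow> real) \<Rightarrow> nat \<Rightarrow> real poly" where
  "fund_sol p a 0 = 1"
| "fund_sol p a (Suc n) = fund_sol p a n + (if p \<le> n then [:0, a (n - p):] * fund_sol p a (n - p) else 0)"

text \<open>The solution of \<open>q\<^sub>n\<^sub>+\<^sub>1 = q\<^sub>n + u a\<^sub>n\<^sub>-\<^sub>p q\<^sub>n\<^sub>-\<^sub>p\<close> that vanishes before \<open>i\<close> and is \<open>1\<close> at \<open>i\<close>, as a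
  polynomial in \<open>u\<close>. It is the solution of \<open>(H - x) q = 0\<close> up to powers of \<open>x\<close>, with \<open>u = -x\<^sup>-\<^sup>p\<^sup>-\<^sup>1\<close>.\<close>

definition sol :: "nat \<Rightarrow> (nat \<Rightarrow> real) \<Rightarrow> nat \<Rightarrow> int \<Rightarrow> real poly" where
  "sol p a i z = (if int i \<le> z then fund_sol p (\<lambda>m. a (m + i)) (nat z - i) else 0)"

definition minor :: "nat \<Rightarrow> (nat \<Rightarrow> real) \<Rightarrow> nat \<Rightarrow> (int \<Rightarrow> int) \<Rightarrow> real poly" where
  "minor p a m y = det (mat m m (\<lambda>(i, j). sol p a i (y (int j))))"

lemma sol_less: "z < int i \<Longrightarrow> sol p a i z = 0"
  by (simp add: sol_def)

lemma sol_eq [simp]: "sol p a i (int i) = 1"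
  by (simp add: sol_def)

lemma sol_rec:
  assumes "int i \<le> t"
  shows "sol p a i (t + 1) = sol p a i t + [:0, a (nat (t - int p)):] * sol p a i (t - int p)"
proof -
  define n where "n = nat t - i"
  have t: "t = int n + int i"
    using assms by (simp add: n_def)
  have n1: "nat (t + 1) - i = Suc n" "nat t - i = n"
    using t by simp_all
  show ?thesis
  proof (cases "p \<le> n")
    case True
    then have "nat (t - int p) = n - p + i" "nat (t - int p) - i = n - p"
      using t by (auto simp: nat_diff_distrib' nat_add_distrib)
    then show ?thesis
      using True t n1 by (simp add: sol_def)
  next
    case False
    then show ?thesis
      using t n1 by (simp add: sol_def)
  qed
qed

text \<open>Deleting the first row of a minor therefore amounts to shifting the weights and the
  columns by one; this is where the sequence \<open>a (Suc n)\<close> comes from.\<close>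

lemma sol_Suc: "sol p a (Suc i) z = sol p (\<lambda>n. a (Suc n)) i (z - 1)"
proof (cases "int i \<le> z - 1")
  case True
  then have "nat z - Suc i = nat (z - 1) - i"
    by (simp add: nat_diff_distrib')
  then show ?thesis
    using True by (simp add: sol_def)
qed (simp add: sol_def)

lemma minor_cong: "(\<And>j. 0 \<le> j \<Longrightarrow> j < int m \<Longrightarrow> y j = y' j) \<Longrightarrow> minor p a m y = minor p a m y'"
  unfolding minor_def by (intro arg_cong[of _ _ det] cong_mat) auto

text \<open>The cofactors are written with the last column blanked out, so that they visibly do not
  depend on \<open>y (int k)\<close>. This gives linearity in that column.\<close>

lemma minor_last_column:
  fixes k :: nat
  shows "minor p a (Suc k) y =
    (\<Sum>i<Suc k. sol p a i (y (int k)) * cofactor (mat (Suc k) (Suc k) (\<lambda>(i, j). if j < k then sol p a i (y (int j)) else 0)) i k)"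
proof -
  let ?A = "mat (Suc k) (Suc k) (\<lambda>(i, j). sol p a i (y (int j)))"
  let ?B = "mat (Suc k) (Suc k) (\<lambda>(i, j). if j < k then sol p a i (y (int j)) else 0)"
  have "cofactor ?A i k = cofactor ?B i k" if "i < Suc k" for i
  proof -
    have "mat_delete ?A i k = mat_delete ?B i k"
      unfolding mat_delete_def by (rule eq_matI) auto
    then show ?thesis
      unfolding Determinant.cofactor_def by simp
  qed
  then show ?thesis
    unfolding minor_def by (subst laplace_expansion_column[of _ "Suc k" k]) auto
qed

lemma minor_rec:
  assumes "y (int k) = t + 1" "int k \<le> t"
  shows "minor p a (Suc k) y = minor p a (Suc k) (y(int k := t)) +
    [:0, a (nat (t - int p)):] * minor p a (Suc k) (y(int k := t - int p))"
proof -
  have *: "mat (Suc k) (Suc k) (\<lambda>(i, j). if j < k then sol p a i ((y(int k := s)) (int j)) else 0) =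
    mat (Suc k) (Suc k) (\<lambda>(i, j). if j < k then sol p a i (y (int j)) else 0)" for s
    by (intro cong_mat) auto
  have "sol p a i (t + 1) = sol p a i t + [:0, a (nat (t - int p)):] * sol p a i (t - int p)" if "i < Suc k" for i
    using that assms(2) by (intro sol_rec) simp
  then show ?thesis
    unfolding minor_last_column * using assms(1)
    by (simp add: ring_distribs sum.distrib sum_distrib_left mult.assoc del: sum.lessThan_Suc mult_pCons_left cong: sum.cong_simp)
qed

lemma minor_rotate:
  "minor p a (Suc k) y = (-1) ^ k * minor p a (Suc k) (\<lambda>j. if j = 0 then y (int k) else y (j - 1))"
proof -
  have "mat (1 + k) (1 + k) (\<lambda>(i, j). mat (Suc k) (Suc k) (\<lambda>(i, j). sol p a i (y (int j))) $$ (i, if j < 1 then j + k else j - 1)) =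
    mat (Suc k) (Suc k) (\<lambda>(i, j). sol p a i (if int j = 0 then y (int k) else y (int j - 1)))"
    by (intro eq_matI) (auto simp: of_nat_diff)
  then show ?thesis
    unfolding minor_def by (subst det_swap_cols[of _ 1 k]) auto
qed

lemma minor_equal_columns:
  assumes "y (int i) = y (int j)" "i < j" "j < m"
  shows "minor p a m y = 0"
  unfolding minor_def using assms
  by (intro det_identical_columns[of _ m i j]) (auto simp: col_def)

lemma conf_occupied_before:
  assumes c: "conf p k y" and "1 \<le> p" "y (int k) = t + 1"
  shows "occupied p y t \<longleftrightarrow> k > 0 \<and> y (int k - 1) = t"
proof
  assume "occupied p y t"
  then obtain i where i: "y i = t"
    using occupied_iff[OF c] by blast
  then have "i < int k"
    using conf_less_iff[OF c, of i "int k"] assms by simp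
  then have "t \<le> y (int k - 1)" "y (int k - 1) < t + 1"
    using i conf_le_iff[OF c, of i "int k - 1"] conf_less[OF c, of "int k - 1" "int k"] assms by auto
  then have t: "y (int k - 1) = t"
    by simp
  moreover have "k > 0"
  proof (rule ccontr)
    assume "\<not> k > 0"
    then have "y (- 1 + (int k + 1) * 1) = t + 1" "y (- 1) = t"
      using assms(3) t by auto
    then show False
      using conf_period[OF c, of "- 1" 1] \<open>1 \<le> p\<close> by simp
  qed
  ultimately show "k > 0 \<and> y (int k - 1) = t"
    by simp
next
  assume "k > 0 \<and> y (int k - 1) = t"
  then show "occupied p y t"
    using occupied_iff[OF c] by blast
qed

text \<open>The recurrence in the last column becomes the dynamics. Column \<open>t\<close> is a hop
  undone, or repeats a column if site \<open>t\<close> is occupied. Column \<open>t - p\<close> is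
  the position of particle \<open>-1\<close>, so after a cyclic rotation it is a shift of
  labels.\<close>

lemma minor_conf_rec:
  assumes c: "conf p k y" and "1 \<le> p" and yk: "y (int k) = t + 1" and "int k \<le> t"
  shows "minor p a (Suc k) y =
    (if occupied p y t then 0 else minor p a (Suc k) (hop_back p (t + 1) y)) +
    [:0, (-1) ^ k * a (nat (t - int p)):] * minor p a (Suc k) (\<lambda>i. y (i - 1))"
proof -
  have "minor p a (Suc k) (y(int k := t)) = (if occupied p y t then 0 else minor p a (Suc k) (hop_back p (t + 1) y))"
  proof (cases "occupied p y t")
    case True
    then have "k > 0" "y (int k - 1) = t"
      using conf_occupied_before[OF c assms(2) yk] by auto
    then have "minor p a (Suc k) (y(int k := t)) = 0"
      by (intro minor_equal_columns[of _ "k - 1" k]) (auto simp: of_nat_diff)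
    then show ?thesis
      using True by simp
  next
    case False
    have "y j mod (int p + 1) \<noteq> (t + 1) mod (int p + 1)" if "0 \<le> j" "j < int k" for j
    proof
      assume "y j mod (int p + 1) = (t + 1) mod (int p + 1)"
      then obtain z where "y (j + (int k + 1) * z) = y (int k)"
        using conf_mod_eq_iff[OF c] yk by metis
      then have "j + (int k + 1) * z = int k"
        using conf_eq_iff[OF c] by simp
      then have "int k mod (int k + 1) = j mod (int k + 1)"
        by (metis mod_mult_self2)
      then show False
        using that by simp
    qed
    then have "minor p a (Suc k) (y(int k := t)) = minor p a (Suc k) (hop_back p (t + 1) y)"
      using yk by (intro minor_cong) (auto simp: hop_back_def)
    then show ?thesis
      using False by simp
  qed
  moreover have "minor p a (Suc k) (y(int k := t - int p)) = (-1) ^ k * minor p a (Suc k) (\<lambda>i. y (i - 1))"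
  proof (subst minor_rotate, rule arg_cong[of _ _ "\<lambda>x. (-1) ^ k * x"], rule minor_cong)
    fix j :: int assume "0 \<le> j" "j < int (Suc k)"
    moreover have "y (- 1) = t - int p"
      using conf_period[OF c, of "- 1" 1] yk by simp
    ultimately show "(if j = 0 then (y(int k := t - int p)) (int k) else (y(int k := t - int p)) (j - 1)) = y (j - 1)"
      by auto
  qed
  moreover have "[:0, (-1) ^ k * a (nat (t - int p)):] = [:0, a (nat (t - int p)):] * ((-1) ^ k :: real poly)"
    by (cases "even k") auto
  ultimately show ?thesis
    using minor_rec[of y k t, OF yk \<open>int k \<le> t\<close>, of p a] by (simp only: mult.assoc)
qed

lemma cnt_initial: "t \<le> k \<Longrightarrow> cnt p k a t y = (if y = packed p k then 1 else 0)"
  by (induction t) auto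

lemma conf_eq_packedI:
  assumes c: "conf p k y" and "0 \<le> y 0" "y (int k) \<le> int k"
  shows "y = packed p k"
proof
  fix i
  obtain j z where j: "0 \<le> j" "j \<le> int k" "i = j + (int k + 1) * z"
    by (rule label_cases)
  have "y j = j"
    using conf_gap[OF _ c, of j 0] conf_gap[OF _ c, of "int k - j" j] assms j by simp
  then show "y i = packed p k i"
    using j by (simp only: conf_period[OF c] packed_period) (simp add: packed_small)
qed

text \<open>Moving the column \<open>t - p\<close> past the \<open>k\<close> others is where the sign \<open>(-1)\<^sup>k\<close> comes from.\<close>

lemma coeff_minor:
  assumes "k \<le> p" "1 \<le> p"
  shows "conf p k y \<Longrightarrow> k \<le> t \<Longrightarrow> int t - int p \<le> y 0 \<Longrightarrow> y (int k) \<le> int t \<Longrightarrow>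
    coeff (minor p a (Suc k) y) b = (-1) ^ (k * b) * cnt p k a t (\<lambda>i. y (i - int b))"
proof (induction "t - k" arbitrary: t y b)
  case 0
  then have tk: "t = k"
    by simp
  show ?case
  proof (cases "y = packed p k")
    case True
    have "minor p a (Suc k) y = 1"
      unfolding minor_def
    proof (subst det_upper_triangular[of _ "Suc k"])
      show "upper_triangular (mat (Suc k) (Suc k) (\<lambda>(i, j). sol p a i (y (int j))))"
        using True by (auto simp: packed_small sol_less)
      show "prod_list (diag_mat (mat (Suc k) (Suc k) (\<lambda>(i, j). sol p a i (y (int j))))) = 1"
        using True unfolding prod_list_diag_prod by (auto simp: packed_small intro!: prod.neutral)
    qed auto
    moreover have "(\<lambda>i. y (i - int b)) = packed p k \<longleftrightarrow> b = 0"
    proof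
      assume "(\<lambda>i. y (i - int b)) = packed p k"
      then have "y (0 - int b) = y 0"
        using True by metis
      then show "b = 0"
        using conf_eq_iff[OF 0(2)] by simp
    qed (use True in auto)
    ultimately show ?thesis
      by (simp add: cnt_initial tk)
  next
    \<comment> \<open>Any other configuration in the window has \<open>y 0 < 0\<close>, where all
      fundamental solutions vanish; no shift \<open>b \<ge> 0\<close> can bring particle
      \<open>0\<close> up to site \<open>0\<close>.\<close>
    case False
    then have "y 0 < 0"
      using conf_eq_packedI[OF 0(2)] 0 tk by fastforce
    then have "minor p a (Suc k) y = 0"
      unfolding minor_def by (subst laplace_expansion_column[of _ "Suc k" 0]) (auto simp: sol_less)
    moreover have "(\<lambda>i. y (i - int b)) \<noteq> packed p k"
    proof
      assume eq: "(\<lambda>i. y (i - int b)) = packed p k"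
      then have "y (0 - int b) = packed p k 0"
        by metis
      then have "y 0 < y (0 - int b)"
        using \<open>y 0 < 0\<close> by (simp add: packed_small)
      then show False
        using conf_less_iff[OF 0(2)] by simp
    qed
    ultimately show ?thesis
      by (simp add: cnt_initial tk)
  qed
next
  case (Suc q)
  then obtain s where s: "t = Suc s" "k \<le> s"
    by (cases t) auto
  note IH = Suc.hyps(1)[of s]
  note c = Suc.prems(1)
  show ?case
  proof (cases "y (int k) \<le> int s")
    case True
    \<comment> \<open>The window from \<open>t - p\<close> to \<open>t\<close> meets every residue
      once, so only particle \<open>k\<close> could be at \<open>t\<close>, that is, at
      \<open>s + 1\<close>.\<close>
    have "\<not> occupied p y (int s + 1)"
    proof
      assume "occupied p y (int s + 1)"
      then obtain i where i: "y i = int s + 1"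
        using occupied_iff[OF c] by blast
      then have "int k < i"
        using conf_less_iff[OF c, of "int k" i] True by simp
      then have "y (0 + (int k + 1) * 1) \<le> y i"
        using conf_le_iff[OF c] by simp
      then show False
        unfolding conf_period[OF c] using i Suc.prems s by simp
    qed
    then show ?thesis
      using IH[of y b] Suc.prems Suc.hyps(2) True s by (simp add: occupied_shift)
  next
    case False
    then have yk: "y (int k) = int s + 1"
      using Suc.prems s by simp
    let ?h = "hop_back p (int s + 1) y"
    have occ: "occupied p y (int s + 1)"
      using occupied_iff[OF c] yk by blast
    have 1: "coeff (if occupied p y (int s) then 0 else minor p a (Suc k) ?h) b =
        (-1) ^ (k * b) * (if occupied p y (int s) then 0 else cnt p k a s (\<lambda>i. ?h (i - int b)))"
    proof (cases "occupied p y (int s)")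
      case False
      have "coeff (minor p a (Suc k) ?h) b = (-1) ^ (k * b) * cnt p k a s (\<lambda>i. ?h (i - int b))"
      proof (rule IH)
        show "conf p k ?h"
          using conf_hop_back[OF c] False by simp
        show "?h (int k) \<le> int s"
          using yk by (simp add: hop_back_def)
        show "int s - int p \<le> ?h 0"
          using hop_back_bounds(2)[of y 0 p "int s + 1"] Suc.prems s by simp
      qed (use Suc.hyps s in auto)
      then show ?thesis
        using False by simp
    qed simp
    \<comment> \<open>The factor \<open>u\<close> lowers the exponent by one and the label shift
      makes up for it. For \<open>b = 0\<close> the count vanishes as well, since particle
      \<open>k\<close> cannot be at \<open>s + 1\<close> at time \<open>s\<close>.\<close>
    have 2: "coeff ([:0, (-1) ^ k * a (s - p):] * minor p a (Suc k) (\<lambda>i. y (i - 1))) b =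
        (-1) ^ (k * b) * (a (s - p) * cnt p k a s (\<lambda>i. y (i - int b)))"
    proof (cases b)
      case 0
      have "cnt p k a s y = 0"
        using cnt_front_le[of p k a s y] yk s by force
      then show ?thesis
        using 0 by simp
    next
      case (Suc b')
      have "coeff (minor p a (Suc k) (\<lambda>i. y (i - 1))) b' =
          (-1) ^ (k * b') * cnt p k a s (\<lambda>i. y (i - int b' - 1))"
      proof (rule IH)
        show "conf p k (\<lambda>i. y (i - 1))"
          using conf_shift[OF c] .
        show "y (int k - 1) \<le> int s"
          using conf_less[OF c, of "int k - 1" "int k"] yk by simp
        show "int s - int p \<le> y (0 - 1)"
          using conf_period[OF c, of "- 1" 1] yk by simp
      qed (use Suc.hyps s in auto)
      then show ?thesis
        using Suc by (simp add: power_add algebra_simps)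
    qed
    have "nat (int s - int p) = s - p"
      by simp
    then have "coeff (minor p a (Suc k) y) b = (-1) ^ (k * b) *
        (a (s - p) * cnt p k a s (\<lambda>i. y (i - int b)) +
          (if occupied p y (int s) then 0 else cnt p k a s (\<lambda>i. ?h (i - int b))))"
      using minor_conf_rec[OF c assms(2) yk, of a] s 1 2 by (simp only: coeff_add ring_distribs)
    then show ?thesis
      using s occ by (simp add: occupied_shift hop_back_shift)
  qed
qed

subsection \<open>A determinant identity and interlacing polynomials\<close>

lemma det_single_column:
  fixes A :: "'a :: comm_ring_1 mat"
  assumes "A \<in> carrier_mat n n" "j < n" "l < n" "\<And>i. i < n \<Longrightarrow> i \<noteq> l \<Longrightarrow> A $$ (i, j) = 0"
  shows "det A = A $$ (l, j) * cofactor A l j"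
proof -
  have "det A = (\<Sum>i<n. A $$ (i, j) * cofactor A i j)"
    by (rule laplace_expansion_column) fact+
  also have "\<dots> = (\<Sum>i\<in>{l}. A $$ (i, j) * cofactor A i j)"
    using assms by (intro sum.mono_neutral_right) auto
  finally show ?thesis
    by simp
qed

text \<open>Column \<open>1\<close> is a unit vector, so row and column \<open>1\<close> can be
  deleted until only the two outer indices remain.\<close>

lemma det_outer_columns:
  fixes \<alpha> \<beta> :: "nat \<Rightarrow> 'a :: comm_ring_1"
  shows "det (mat (m + 2) (m + 2) (\<lambda>(i, j). if j = 0 then \<alpha> i else if j = m + 1 then \<beta> i else if i = j then 1 else 0)) =
    \<alpha> 0 * \<beta> (m + 1) - \<alpha> (m + 1) * \<beta> 0"
proof (induction m arbitrary: \<alpha> \<beta>)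
  case 0
  show ?case
    by (subst laplace_expansion_column[of _ "0 + 2" 0]; simp add: Determinant.cofactor_def numeral_2_eq_2)
      (subst (1 2) laplace_expansion_column[of _ 1 0]; simp add: mat_delete_def Determinant.cofactor_def)
next
  case (Suc m)
  let ?A = "mat (Suc m + 2) (Suc m + 2)
    (\<lambda>(i, j). if j = 0 then \<alpha> i else if j = Suc m + 1 then \<beta> i else if i = j then 1 else 0)"
  let ?ins = "\<lambda>i. if i < 1 then i else Suc i"
  have del: "mat_delete ?A 1 1 = mat (m + 2) (m + 2)
      (\<lambda>(i, j). if j = 0 then \<alpha> (?ins i) else if j = m + 1 then \<beta> (?ins i) else if i = j then 1 else 0)"
    unfolding mat_delete_def by (intro eq_matI) auto
  have "det ?A = ?A $$ (1, 1) * cofactor ?A 1 1"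
    by (rule det_single_column) auto
  also have "\<dots> = \<alpha> 0 * \<beta> (Suc m + 1) - \<alpha> (Suc m + 1) * \<beta> 0"
    unfolding Determinant.cofactor_def del Suc.IH by simp
  finally show ?case .
qed

text \<open>Multiply the matrix by the identity with outer columns replaced by those of the adjugate.\<close>

lemma desnanot_jacobi:
  fixes g :: "nat \<Rightarrow> nat \<Rightarrow> 'a :: idom"
  defines "D \<equiv> \<lambda>m r s. det (mat m m (\<lambda>(i, j). g (i + r) (j + s)))"
  assumes nz: "D (m + 2) 0 0 \<noteq> 0"
  shows "D (m + 2) 0 0 * D m 1 1 = D (m + 1) 0 0 * D (m + 1) 1 1 - D (m + 1) 0 1 * D (m + 1) 1 0"
proof -
  define n where "n = m + 2"
  define M where "M = mat n n (\<lambda>(i, j). g i j)"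
  define Y where "Y = mat n n (\<lambda>(i, j). if j = 0 then adj_mat M $$ (i, 0)
    else if j = m + 1 then adj_mat M $$ (i, m + 1) else if i = j then 1 else 0)"
  define Z where "Z = mat n n (\<lambda>(i, j). if j = 0 then (if i = 0 then det M else 0)
    else if j = m + 1 then (if i = m + 1 then det M else 0) else g i j)"
  have M: "M \<in> carrier_mat n n" and Y: "Y \<in> carrier_mat n n" and Z: "Z \<in> carrier_mat n n"
    by (simp_all add: M_def Y_def Z_def)
  have DM: "det M = D (m + 2) 0 0"
    by (simp add: D_def M_def n_def)
  have adj: "adj_mat M \<in> carrier_mat n n" "M * adj_mat M = det M \<cdot>\<^sub>m 1\<^sub>m n"
    using adj_mat[OF M] by auto
  have "M * Y = Z"
  proof (rule eq_matI)
    fix i j assume "i < dim_row Z" "j < dim_col Z"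
    then have ij: "i < n" "j < n"
      by (auto simp: Z_def)
    have MY: "(M * Y) $$ (i, j) = (\<Sum>l = 0..<n. M $$ (i, l) * Y $$ (l, j))"
      using ij M Y by (simp add: scalar_prod_def)
    have MA: "(\<Sum>l = 0..<n. M $$ (i, l) * adj_mat M $$ (l, j)) = (if i = j then det M else 0)"
    proof -
      have "(M * adj_mat M) $$ (i, j) = (\<Sum>l = 0..<n. M $$ (i, l) * adj_mat M $$ (l, j))"
        using ij M adj(1) by (simp add: scalar_prod_def)
      then show ?thesis
        using ij by (cases "i = j") (auto simp: adj(2))
    qed
    show "(M * Y) $$ (i, j) = Z $$ (i, j)"
    proof (cases "j = 0 \<or> j = m + 1")
      case True
      then have "(M * Y) $$ (i, j) = (\<Sum>l = 0..<n. M $$ (i, l) * adj_mat M $$ (l, j))"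
        unfolding MY using ij by (intro sum.cong) (auto simp: Y_def)
      then show ?thesis
        unfolding MA Z_def using ij True by auto
    next
      case False
      then have "(M * Y) $$ (i, j) = (\<Sum>l = 0..<n. if l = j then M $$ (i, j) else 0)"
        unfolding MY using ij by (intro sum.cong) (auto simp: Y_def)
      also have "\<dots> = g i j"
        using ij by (simp add: M_def)
      finally show ?thesis
        using ij False by (simp add: Z_def)
    qed
  qed (use M Y Z in auto)
  then have "det M * det Y = det Z"
    using det_mult[OF M Y] by simp
  moreover have "det Z = det M * det M * D m 1 1"
  proof -
    define Z' where "Z' = mat (m + 1) (m + 1) (\<lambda>(i, j). if j = m then (if i = m then det M else 0) else g (i + 1) (j + 1))"
    have "mat_delete Z 0 0 = Z'"
      unfolding mat_delete_def Z_def Z'_def n_def by (intro eq_matI) auto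
    moreover have "det Z = Z $$ (0, 0) * cofactor Z 0 0"
      using Z by (intro det_single_column) (auto simp: Z_def n_def)
    moreover have "mat_delete Z' m m = mat m m (\<lambda>(i, j). g (i + 1) (j + 1))"
      unfolding mat_delete_def Z'_def by (intro eq_matI) auto
    moreover have "det Z' = Z' $$ (m, m) * cofactor Z' m m"
      by (intro det_single_column[of _ "m + 1"]) (auto simp: Z'_def)
    ultimately show ?thesis
      by (simp add: Determinant.cofactor_def D_def Z'_def Z_def n_def)
  qed
  moreover have "det Y = D (m + 1) 1 1 * D (m + 1) 0 0 - D (m + 1) 1 0 * D (m + 1) 0 1"
  proof -
    have del: "mat_delete M 0 0 = mat (m + 1) (m + 1) (\<lambda>(i, j). g (i + 1) (j + 1))"
      "mat_delete M (m + 1) (m + 1) = mat (m + 1) (m + 1) (\<lambda>(i, j). g (i + 0) (j + 0))"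
      "mat_delete M 0 (m + 1) = mat (m + 1) (m + 1) (\<lambda>(i, j). g (i + 1) (j + 0))"
      "mat_delete M (m + 1) 0 = mat (m + 1) (m + 1) (\<lambda>(i, j). g (i + 0) (j + 1))"
      unfolding mat_delete_def M_def n_def by (intro eq_matI; auto)+
    have entries: "adj_mat M $$ (i, j) = cofactor M j i" if "i < n" "j < n" for i j
      using that M by (simp add: adj_mat_def)
    have "det Y = adj_mat M $$ (0, 0) * adj_mat M $$ (m + 1, m + 1) - adj_mat M $$ (m + 1, 0) * adj_mat M $$ (0, m + 1)"
      unfolding Y_def n_def by (rule det_outer_columns)
    also have "\<dots> = D (m + 1) 1 1 * D (m + 1) 0 0 -
        ((-1) ^ (m + 1) * D (m + 1) 1 0) * ((-1) ^ (m + 1) * D (m + 1) 0 1)"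
      by (simp only: entries n_def Determinant.cofactor_def del D_def) (simp add: n_def entries Determinant.cofactor_def del D_def)
    finally show ?thesis
      by simp
  qed
  ultimately have "det M * (D (m + 1) 1 1 * D (m + 1) 0 0 - D (m + 1) 1 0 * D (m + 1) 0 1) = det M * (det M * D m 1 1)"
    by (simp only: mult.assoc)
  then show ?thesis
    using nz unfolding DM[symmetric] by (simp add: mult.commute)
qed

section \<open>Real polynomials with simple negative zeros and interlacing\<close>

definition neg_split :: "real poly \<Rightarrow> nat \<Rightarrow> real list \<Rightarrow> bool" where
  "neg_split C \<beta> cs \<longleftrightarrow> (\<exists>l>0. C = Polynomial.smult l (monom 1 \<beta> * (\<Prod>c\<leftarrow>cs. [:- c, 1:]))) \<and>
     sorted_wrt (<) cs \<and> (\<forall>c\<in>set cs. c < 0)"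

definition alternating :: "real list \<Rightarrow> real list \<Rightarrow> bool" where
  "alternating us vs \<longleftrightarrow> (length us = length vs \<or> length us = length vs + 1) \<and>
     (\<forall>i<length vs. us ! i < vs ! i) \<and> (\<forall>i. i + 1 < length us \<longrightarrow> vs ! i < us ! (i + 1))"

text \<open>The lists contain the nonzero zeros only, while the degrees also count the zero at
  \<open>0\<close>. The degrees decide which list starts; the lengths allowed by
  \<open>alternating\<close> then make the order of vanishing of \<open>A\<close> at
  \<open>0\<close> that of \<open>C\<close> or one larger.\<close>

definition precedes :: "real poly \<Rightarrow> real poly \<Rightarrow> bool" where
  "precedes C A \<longleftrightarrow> (\<exists>\<beta> cs \<gamma> as. neg_split C \<beta> cs \<and> neg_split A \<gamma> as \<and>
     (degree A = degree C \<and> alternating cs as \<or> degree A = degree C + 1 \<and> alternating as cs))"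

lemma degree_linear_factors:
  fixes cs :: "'a :: idom list"
  shows "degree (\<Prod>c\<leftarrow>cs. [:- c, 1:]) = length cs \<and> lead_coeff (\<Prod>c\<leftarrow>cs. [:- c, 1:]) = 1"
proof (induction cs)
  case (Cons c cs)
  then have "(\<Prod>c\<leftarrow>cs. [:- c, 1:]) \<noteq> 0"
    by auto
  then have deg: "degree (\<Prod>c\<leftarrow>c # cs. [:- c, 1:]) = length (c # cs)"
    using Cons by (simp add: degree_mult_eq del: mult_pCons_left)
  have "lead_coeff (\<Prod>c\<leftarrow>c # cs. [:- c, 1:]) = lead_coeff [:- c, 1:] * lead_coeff (\<Prod>c\<leftarrow>cs. [:- c, 1:])"
    by (simp add: lead_coeff_mult del: mult_pCons_left)
  moreover have "lead_coeff [:- c, 1:] = 1" "lead_coeff (\<Prod>c\<leftarrow>cs. [:- c, 1:]) = 1"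
    using Cons by (simp, blast)
  ultimately show ?case
    using deg by (metis mult_1)
qed simp

lemma linear_factors_nz: "(\<Prod>c\<leftarrow>cs. [:- c, 1:]) \<noteq> (0 :: 'a :: idom poly)"
  using degree_linear_factors[of cs] by auto

lemma poly_linear_factors:
  fixes x :: "'a :: idom"
  shows "poly (\<Prod>c\<leftarrow>cs. [:- f c, 1:]) x = (\<Prod>c\<leftarrow>cs. x - f c)"
  by (induction cs) (simp_all add: algebra_simps)

lemma neg_split_degree: "neg_split C \<beta> cs \<Longrightarrow> degree C = \<beta> + length cs"
proof -
  assume "neg_split C \<beta> cs"
  then obtain l where "l > 0" "C = Polynomial.smult l (monom 1 \<beta> * (\<Prod>c\<leftarrow>cs. [:- c, 1:]))"
    by (auto simp: neg_split_def)
  then show ?thesis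
    using linear_factors_nz[of cs] degree_linear_factors[of cs]
    by (simp add: degree_mult_eq degree_monom_eq)
qed

lemma sign_linear_factors:
  fixes x :: real
  shows "x \<notin> set as \<Longrightarrow> 0 < (-1) ^ length (filter (\<lambda>c. x < c) as) * (\<Prod>c\<leftarrow>as. x - c)"
proof (induction as)
  case (Cons c as)
  let ?P = "(-1) ^ length (filter (\<lambda>c. x < c) as) * (\<Prod>c\<leftarrow>as. x - c)"
  have "0 < ?P"
    using Cons by simp
  then have "0 < \<bar>x - c\<bar> * ?P"
    using Cons.prems by simp
  also have "\<bar>x - c\<bar> * ?P = (-1) ^ length (filter (\<lambda>c. x < c) (c # as)) * (\<Prod>c\<leftarrow>c # as. x - c)"
    by (auto simp: algebra_simps)
  finally show ?case .
qed simp

text \<open>For \<open>x < 0\<close> the power of \<open>x\<close> contributes its own sign, so only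
  the full degree enters and not the order of vanishing at \<open>0\<close>.\<close>

lemma neg_split_sign:
  assumes A: "neg_split A \<gamma> as" and "x < 0" "r \<le> length as"
    and below: "\<And>i. i < r \<Longrightarrow> as ! i < x" and above: "\<And>i. r \<le> i \<Longrightarrow> i < length as \<Longrightarrow> x < as ! i"
  shows "0 < (-1) ^ (degree A + r) * poly A x"
proof -
  obtain l where l: "l > 0" "A = Polynomial.smult l (monom 1 \<gamma> * (\<Prod>c\<leftarrow>as. [:- c, 1:]))"
    using A by (auto simp: neg_split_def)
  have "{i. i < length as \<and> x < as ! i} = {r..<length as}"
    using below above by (force simp: not_le[symmetric])
  then have len: "length (filter (\<lambda>c. x < c) as) = length as - r"
    by (simp add: length_filter_conv_card)
  have "x \<notin> set as"
    using below above by (metis in_set_conv_nth less_irrefl not_le)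
  then have 1: "0 < (-1) ^ (length as - r) * (\<Prod>c\<leftarrow>as. x - c)"
    using sign_linear_factors[of x as] len by simp
  have 2: "0 < (-1) ^ \<gamma> * x ^ \<gamma>"
    using \<open>x < 0\<close> by (simp flip: power_mult_distrib)
  have "0 < l * ((-1) ^ \<gamma> * x ^ \<gamma>) * ((-1) ^ (length as - r) * (\<Prod>c\<leftarrow>as. x - c))"
    using mult_pos_pos[OF mult_pos_pos[OF l(1) 2] 1] .
  also have "\<dots> = (-1) ^ (\<gamma> + (length as - r)) * poly A x"
    by (simp add: l(2) poly_linear_factors poly_monom power_add)
  also have "(-1) ^ (\<gamma> + (length as - r)) = ((-1) ^ (degree A + r) :: real)"
  proof -
    have "even (\<gamma> + (length as - r)) \<longleftrightarrow> even (degree A + r)"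
      using neg_split_degree[OF A] \<open>r \<le> length as\<close> by (simp add: even_diff_nat)
    then show ?thesis
      by (simp add: minus_one_power_iff)
  qed
  finally show ?thesis .
qed

text \<open>Below \<open>cs ! i\<close> there are \<open>i + 1\<close> zeros of \<open>B\<close> if
  the degrees agree, and \<open>i\<close> if \<open>C\<close> has one degree more. The parity in
  \<open>neg_split_sign\<close> is the same in both cases.\<close>

lemma precedes_sign:
  assumes "precedes B C"
  obtains \<beta> cs where "neg_split C \<beta> cs" "\<And>i. i < length cs \<Longrightarrow> (-1) ^ (degree C + i) * poly B (cs ! i) < 0"
proof -
  obtain \<gamma> bs \<beta> cs where B: "neg_split B \<gamma> bs" and C: "neg_split C \<beta> cs"
    and alt: "degree C = degree B \<and> alternating bs cs \<or> degree C = degree B + 1 \<and> alternating cs bs"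
    using assms by (auto simp: precedes_def)
  have sb: "sorted_wrt (<) bs"
    using B by (simp add: neg_split_def)
  show ?thesis
  proof (rule that[OF C])
    fix i assume i: "i < length cs"
    then have neg: "cs ! i < 0"
      using C by (simp add: neg_split_def)
    have mono: "bs ! j \<le> bs ! j'" if "j \<le> j'" "j' < length bs" for j j'
      using sb that sorted_wrt_nth_less[OF sb, of j j'] by (cases "j = j'") auto
    show "(-1) ^ (degree C + i) * poly B (cs ! i) < 0"
      using alt
    proof
      assume a: "degree C = degree B \<and> alternating bs cs"
      then have "0 < (-1) ^ (degree B + (i + 1)) * poly B (cs ! i)"
      proof (intro neg_split_sign[OF B neg])
        fix j assume "j < i + 1"
        then have "bs ! j \<le> bs ! i" "bs ! i < cs ! i"
          using a i mono[of j i] by (auto simp: alternating_def)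
        then show "bs ! j < cs ! i"
          by simp
      next
        fix j assume "i + 1 \<le> j" "j < length bs"
        then have "bs ! (i + 1) \<le> bs ! j" "cs ! i < bs ! (i + 1)"
          using a i mono[of "i + 1" j] by (auto simp: alternating_def)
        then show "cs ! i < bs ! j"
          by simp
      qed (use a i in \<open>auto simp: alternating_def\<close>)
      then show ?thesis
        using a by simp
    next
      assume a: "degree C = degree B + 1 \<and> alternating cs bs"
      then have "0 < (-1) ^ (degree B + i) * poly B (cs ! i)"
      proof (intro neg_split_sign[OF B neg])
        fix j assume "j < i"
        then have "bs ! j \<le> bs ! (i - 1)" "bs ! (i - 1) < cs ! i"
          using a i mono[of j "i - 1"] by (auto simp: alternating_def dest: spec[of _ "i - 1"])
        then show "bs ! j < cs ! i"
          by simp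
      next
        fix j assume "i \<le> j" "j < length bs"
        then have "bs ! i \<le> bs ! j" "cs ! i < bs ! i"
          using a i mono[of i j] by (auto simp: alternating_def)
        then show "cs ! i < bs ! j"
          by simp
      qed (use a i in \<open>auto simp: alternating_def\<close>)
      then show ?thesis
        using a by simp
    qed
  qed
qed

lemma linear_factors_dvd:
  fixes A :: "real poly"
  shows "distinct rs \<Longrightarrow> (\<And>r. r \<in> set rs \<Longrightarrow> poly A r = 0) \<Longrightarrow> (\<Prod>c\<leftarrow>rs. [:- c, 1:]) dvd A"
proof (induction rs)
  case (Cons r rs)
  then obtain B where B: "A = (\<Prod>c\<leftarrow>rs. [:- c, 1:]) * B"
    by (auto elim: dvdE)
  have "poly (\<Prod>c\<leftarrow>rs. [:- c, 1:]) r \<noteq> 0"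
    using Cons.prems(1) by (auto simp: poly_linear_factors prod_list_zero_iff)
  moreover have "poly A r = 0"
    using Cons.prems by simp
  ultimately have "[:- r, 1:] dvd B"
    by (simp add: B poly_eq_0_iff_dvd)
  then have "(\<Prod>c\<leftarrow>rs. [:- c, 1:]) * [:- r, 1:] dvd A"
    unfolding B by (intro mult_dvd_mono) auto
  then show ?case
    by (simp add: mult.commute del: mult_pCons_left mult_pCons_right)
qed simp

lemma poly_bottom_sign:
  fixes A :: "real poly"
  assumes "lead_coeff A > 0"
  obtains x where "x < y" "0 < (-1) ^ degree A * poly A x"
proof -
  define B where "B = Polynomial.smult ((-1) ^ degree A) (pcompose A [:0, -1:])"
  have "lead_coeff (pcompose A [:0, -1:]) = lead_coeff A * (-1) ^ degree A"
    by (subst lead_coeff_comp) auto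
  then have lc: "lead_coeff B = lead_coeff A"
    by (simp add: B_def lead_coeff_smult mult.assoc flip: power_mult_distrib)
  then obtain n where n: "\<And>x. x \<ge> n \<Longrightarrow> poly B x \<ge> lead_coeff B"
    using poly_pinfty_gt_lc[of B] assms by auto
  define x where "x = - max n (1 - y)"
  have "poly B (- x) > 0"
    using n[of "- x"] lc assms by (simp add: x_def)
  then have "0 < (-1) ^ degree A * poly A x"
    by (simp add: B_def poly_pcompose)
  moreover have "x < y"
    by (simp add: x_def)
  ultimately show thesis
    using that by blast
qed

text \<open>Dividing out the known zeros leaves \<open>[:t, l:]\<close> with \<open>l > 0\<close>,
  and \<open>t \<ge> 0\<close> because \<open>A\<close> is nonnegative at \<open>0\<close>. The flag
  \<open>b\<close> tells whether a point \<open>m\<close> above the known zeros with a negative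
  value is at hand; it forces the last zero to lie to the right of \<open>m\<close>.\<close>

lemma remaining_root:
  fixes A :: "real poly"
  assumes nonneg: "\<And>i. 0 \<le> coeff A i" and "A \<noteq> 0" and deg: "degree A = length rs + 1"
    and rs: "sorted_wrt (<) rs" "\<And>r. r \<in> set rs \<Longrightarrow> r < 0 \<and> poly A r = 0"
    and m: "b \<Longrightarrow> poly A m < 0 \<and> (\<forall>r\<in>set rs. r < m)" "\<not> b \<Longrightarrow> rs = []"
  shows "neg_split A 1 rs \<or> (\<exists>\<rho>. neg_split A 0 (rs @ [\<rho>]) \<and> (b \<longrightarrow> m < \<rho>))"
proof -
  let ?P = "\<Prod>c\<leftarrow>rs. [:- c, 1:]"
  have "distinct rs"
    using rs(1) by (simp add: strict_sorted_iff)
  then obtain B where B: "A = ?P * B"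
    using linear_factors_dvd[of rs A] rs(2) by (auto elim: dvdE)
  have "B \<noteq> 0"
    using B \<open>A \<noteq> 0\<close> by auto
  have "degree B = 1"
    using deg degree_linear_factors[of rs] degree_mult_eq[OF linear_factors_nz \<open>B \<noteq> 0\<close>, of rs] B by simp
  then obtain t l where Bt: "B = [:t, l:]" "l \<noteq> 0"
    by (metis degree1_coeffs One_nat_def)
  have "lead_coeff A = lead_coeff ?P * lead_coeff B"
    unfolding B lead_coeff_mult ..
  moreover have "lead_coeff ?P = 1" "lead_coeff B = l"
    using degree_linear_factors[of rs] Bt by (blast, simp)
  ultimately have "lead_coeff A = l"
    by (metis mult_1)
  then have l: "l > 0"
    using nonneg[of "degree A"] Bt by simp
  have pos: "0 < (\<Prod>c\<leftarrow>rs. x - c)" if "\<And>r. r \<in> set rs \<Longrightarrow> r < x" for x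
    using that by (induction rs) auto
  have "poly A 0 = (\<Prod>c\<leftarrow>rs. 0 - c) * t"
    by (simp only: B poly_mult poly_linear_factors) (simp add: Bt)
  then have "t \<ge> 0"
    using nonneg[of 0] pos[of 0] rs(2) by (simp add: poly_0_coeff_0 zero_le_mult_iff)
  show ?thesis
  proof (cases "t = 0")
    case True
    then have "A = Polynomial.smult l (monom 1 1 * ?P)"
      using B Bt by (simp add: monom_altdef mult.commute)
    then show ?thesis
      using l rs by (auto simp: neg_split_def)
  next
    case False
    define \<rho> where "\<rho> = - (t / l)"
    have "B = Polynomial.smult l [:- \<rho>, 1:]"
      using Bt l by (simp add: \<rho>_def)
    then have A: "A = Polynomial.smult l (monom 1 0 * (\<Prod>c\<leftarrow>rs @ [\<rho>]. [:- c, 1:]))"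
      using B by (simp only: mult_smult_right monom_eq_1 map_append prod_list.append list.map
        prod_list.Cons prod_list.Nil mult_1_left mult_1_right)
    have "\<rho> < 0"
      using False \<open>t \<ge> 0\<close> l by (simp add: \<rho>_def)
    have m\<rho>: "m < \<rho>" if b
    proof -
      have "poly A m = l * ((\<Prod>c\<leftarrow>rs. m - c) * (m - \<rho>))"
        unfolding A by (simp add: poly_linear_factors monom_0 del: mult_pCons_left mult_pCons_right)
      moreover have "0 < (\<Prod>c\<leftarrow>rs. m - c)"
        using m(1)[OF that] by (intro pos) blast
      ultimately show ?thesis
        using m(1)[OF that] l by (simp add: mult_less_0_iff)
    qed
    have "sorted_wrt (<) (rs @ [\<rho>])"
      using rs(1) m m\<rho> by (cases b) (auto simp: sorted_wrt_append intro: less_trans)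
    then have "neg_split A 0 (rs @ [\<rho>])"
      unfolding neg_split_def using A l rs(2) \<open>\<rho> < 0\<close> by auto
    then show ?thesis
      using m\<rho> by blast
  qed
qed

lemma neg_split_monom_mult: "neg_split A \<gamma> as \<Longrightarrow> neg_split (monom 1 \<beta> * A) (\<beta> + \<gamma>) as"
  unfolding neg_split_def by (auto simp: mult_monom mult.assoc[symmetric])

text \<open>After division by \<open>monom 1 \<beta>\<close>, each gap between neighbouring zeros of
  \<open>C\<close> contains a zero. If the degree grows, the sign near minus infinity yields another
  one below them all. Exactly one zero is then missing, and \<open>remaining_root\<close> places it
  at \<open>0\<close> or between the last zero of \<open>C\<close> and \<open>0\<close>.\<close>

lemma precedesI_alternating_signs:
  assumes C: "neg_split C \<beta> cs" and nonneg: "\<And>i. 0 \<le> coeff A i"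
    and deg: "degree A = degree C \<or> degree A = degree C + 1" and "A \<noteq> 0"
    and low: "\<And>i. i < \<beta> \<Longrightarrow> coeff A i = 0"
    and sign: "\<And>i. i < length cs \<Longrightarrow> 0 < (-1) ^ (degree C + i) * poly A (cs ! i)"
  shows "precedes C A"
proof -
  define L where "L = length cs"
  define A1 where "A1 = poly_shift \<beta> A"
  have dC: "degree C = \<beta> + L"
    using neg_split_degree[OF C] by (simp add: L_def)
  have scs: "sorted_wrt (<) cs" and ncs: "\<And>c. c \<in> set cs \<Longrightarrow> c < 0"
    using C by (auto simp: neg_split_def)
  have A: "A = monom 1 \<beta> * A1"
    using low by (intro poly_eqI) (auto simp: coeff_monom_mult A1_def coeff_poly_shift)
  have "A1 \<noteq> 0"
    using A \<open>A \<noteq> 0\<close> by auto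
  have dA: "degree A = \<beta> + degree A1"
    unfolding A using \<open>A1 \<noteq> 0\<close> by (simp add: degree_mult_eq degree_monom_eq)
  have nonneg1: "0 \<le> coeff A1 i" for i
    using nonneg by (simp add: A1_def coeff_poly_shift)
  have sign1: "0 < (-1) ^ (L + i) * poly A1 (cs ! i)" if "i < L" for i
  proof -
    have "cs ! i < 0"
      using that ncs by (simp add: L_def)
    then have p: "0 < (-1) ^ \<beta> * (cs ! i) ^ \<beta>"
      by (simp flip: power_mult_distrib)
    have "0 < ((-1) ^ \<beta> * (cs ! i) ^ \<beta>) * ((-1) ^ (L + i) * poly A1 (cs ! i))"
      using sign[of i] that by (simp add: A dC L_def poly_monom power_add mult_ac)
    then show ?thesis
      using p zero_less_mult_pos by blast
  qed
  have root: "\<exists>r>x. r < cs ! i \<and> poly A1 r = 0"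
    if "x < cs ! i" "i < L" "0 < (-1) ^ (L + i + 1) * poly A1 x" for x i
  proof (rule poly_IVT)
    have "0 < ((-1) ^ (L + i + 1) * poly A1 x) * ((-1) ^ (L + i) * poly A1 (cs ! i))"
      using mult_pos_pos[OF that(3) sign1[OF that(2)]] .
    also have "\<dots> = - (poly A1 x * poly A1 (cs ! i)) * ((-1) ^ (L + i) * (-1) ^ (L + i))"
      by simp
    finally show "poly A1 x * poly A1 (cs ! i) < 0"
      by (simp flip: power_mult_distrib)
  qed fact
  have between: "\<exists>r>cs ! i. r < cs ! (i + 1) \<and> poly A1 r = 0" if "i + 1 < L" for i
    using that scs sign1[of i] by (intro root) (auto simp: L_def sorted_wrt_nth_less)
  have last: "poly A1 (cs ! (L - 1)) < 0" if "L > 0"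
  proof -
    have "odd (L + (L - 1))"
      using that by simp
    then show ?thesis
      using sign1[of "L - 1"] that by simp
  qed
  have finish: "precedes C A" if rs: "length rs + 1 = degree A1" "sorted_wrt (<) rs"
      "\<And>r. r \<in> set rs \<Longrightarrow> poly A1 r = 0" "\<And>r. r \<in> set rs \<Longrightarrow> L > 0 \<and> r < cs ! (L - 1)"
    and alt: "\<And>as. as = rs \<or> (\<exists>\<rho>. as = rs @ [\<rho>] \<and> (L > 0 \<longrightarrow> cs ! (L - 1) < \<rho>)) \<Longrightarrow>
      degree A = degree C \<and> alternating cs as \<or> degree A = degree C + 1 \<and> alternating as cs" for rs
  proof -
    have "r < 0" if "r \<in> set rs" for r
      using rs(4)[OF that] ncs[of "cs ! (L - 1)"] by (simp add: L_def)
    moreover have "rs = []" if "\<not> L > 0"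
      using rs(4) that by (cases rs) auto
    ultimately have "neg_split A1 1 rs \<or> (\<exists>\<rho>. neg_split A1 0 (rs @ [\<rho>]) \<and> (L > 0 \<longrightarrow> cs ! (L - 1) < \<rho>))"
      using rs last by (intro remaining_root[OF nonneg1 \<open>A1 \<noteq> 0\<close>]) auto
    then obtain as \<gamma> where as: "neg_split A1 \<gamma> as" "as = rs \<or> (\<exists>\<rho>. as = rs @ [\<rho>] \<and> (L > 0 \<longrightarrow> cs ! (L - 1) < \<rho>))"
      by blast
    show ?thesis
      unfolding precedes_def using C neg_split_monom_mult[OF as(1), of \<beta>] alt[OF as(2)] A by auto
  qed
  consider "degree A1 = L" "L = 0" | "degree A1 = L" "L > 0" | "degree A1 = L + 1"
    using deg dA dC by force
  then show ?thesis
  proof cases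
    case 1
    then obtain l where l: "A1 = [:l:]"
      by (metis degree_0_id)
    then have "l > 0"
      using nonneg1[of 0] \<open>A1 \<noteq> 0\<close> by simp
    then have "neg_split A1 0 []"
      using l by (auto simp: neg_split_def monom_0)
    then have "neg_split A (\<beta> + 0) []"
      unfolding A by (rule neg_split_monom_mult)
    then show ?thesis
      unfolding precedes_def using C 1 dA dC by (fastforce simp: L_def alternating_def)
  next
    case 2
    obtain r where r: "\<And>i. i + 1 < L \<Longrightarrow> cs ! i < r i \<and> r i < cs ! (i + 1) \<and> poly A1 (r i) = 0"
      using between by metis
    have mono: "r i < r j" if "i < j" "j + 1 < L" for i j
    proof -
      have "cs ! (i + 1) \<le> cs ! j"
        using that scs sorted_wrt_nth_less[OF scs, of "i + 1" j] by (cases "i + 1 = j") (auto simp: L_def)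
      then show ?thesis
        using r[of i] r[of j] that by force
    qed
    have lt: "r i < cs ! (L - 1)" if "i + 1 < L" for i
    proof -
      have "cs ! (i + 1) \<le> cs ! (L - 1)"
      proof (cases "i + 1 = L - 1")
        case False
        then have "i + 1 < L - 1" "L - 1 < length cs"
          using that by (auto simp: L_def)
        then show ?thesis
          using sorted_wrt_nth_less[OF scs] by force
      qed simp
      then show ?thesis
        using r[of i] that by force
    qed
    show ?thesis
    proof (rule finish[of "map r [0..<L - 1]"])
      show "sorted_wrt (<) (map r [0..<L - 1])"
        using mono by (auto simp: sorted_wrt_iff_nth_less)
    next
      fix as
      assume as: "as = map r [0..<L - 1] \<or> (\<exists>\<rho>. as = map r [0..<L - 1] @ [\<rho>] \<and> (L > 0 \<longrightarrow> cs ! (L - 1) < \<rho>))"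
      have len: "length as = L - 1 \<or> length as = L" "length cs = L"
        using as 2 by (auto simp: L_def)
      have nth: "as ! i = r i" if "i + 1 < L" for i
        using as that by (auto simp: nth_append)
      have nth2: "cs ! i < as ! i" if "i + 1 = L" "i < length as" for i
        using as that by (auto simp: nth_append)
      have "alternating cs as"
        unfolding alternating_def
      proof (intro conjI allI impI)
        fix i assume "i < length as"
        then show "cs ! i < as ! i"
          using nth2[of i] nth[of i] r[of i] len by (cases "i + 1 = L") auto
      next
        fix i assume "i + 1 < length cs"
        then show "as ! i < cs ! (i + 1)"
          using nth[of i] r[of i] len by auto
      qed (use len 2 in auto)
      then show "degree A = degree C \<and> alternating cs as \<or> degree A = degree C + 1 \<and> alternating as cs"
        using 2 dA dC by simp
    qed (use 2 r lt in auto)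
  next
    case 3
    have "lead_coeff A1 > 0"
      using nonneg1[of "degree A1"] \<open>A1 \<noteq> 0\<close> by (simp add: less_le)
    have first: "\<exists>r<cs ! 0. poly A1 r = 0" if "L > 0"
    proof -
      obtain x where "x < cs ! 0" "0 < (-1) ^ degree A1 * poly A1 x"
        using poly_bottom_sign[OF \<open>lead_coeff A1 > 0\<close>] by blast
      then show ?thesis
        using root[of x 0] that 3 by auto
    qed
    have "\<exists>r. r < cs ! i \<and> poly A1 r = 0 \<and> (i > 0 \<longrightarrow> cs ! (i - 1) < r)" if "i < L" for i
    proof (cases i)
      case 0
      then show ?thesis
        using first that by auto
    next
      case (Suc j)
      then show ?thesis
        using between[of j] that by auto
    qed
    then obtain r where r: "\<And>i. i < L \<Longrightarrow> r i < cs ! i \<and> poly A1 (r i) = 0 \<and> (i > 0 \<longrightarrow> cs ! (i - 1) < r i)"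
      by metis
    have csle: "cs ! i \<le> cs ! j" if "i \<le> j" "j < L" for i j
      using that scs sorted_wrt_nth_less[OF scs, of i j] by (cases "i = j") (auto simp: L_def)
    have mono: "r i < r j" if "i < j" "j < L" for i j
      using csle[of i "j - 1"] r[of i] r[of j] that by force
    have lt: "r i < cs ! (L - 1)" if "i < L" for i
      using csle[of i "L - 1"] r[of i] that by force
    show ?thesis
    proof (rule finish[of "map r [0..<L]"])
      show "sorted_wrt (<) (map r [0..<L])"
        using mono by (auto simp: sorted_wrt_iff_nth_less)
    next
      fix as
      assume as: "as = map r [0..<L] \<or> (\<exists>\<rho>. as = map r [0..<L] @ [\<rho>] \<and> (L > 0 \<longrightarrow> cs ! (L - 1) < \<rho>))"
      have len: "length as = L \<or> length as = L + 1" "length cs = L"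
        using as by (auto simp: L_def)
      have nth: "as ! i = r i" if "i < L" for i
        using as that by (auto simp: nth_append)
      have nth2: "cs ! i < as ! (i + 1)" if "i + 1 = L" "i + 1 < length as" for i
        using as that by (auto simp: nth_append)
      have "alternating as cs"
        unfolding alternating_def
      proof (intro conjI allI impI)
        fix i assume "i < length cs"
        then show "as ! i < cs ! i"
          using nth[of i] r[of i] len by auto
      next
        fix i assume "i + 1 < length as"
        then show "cs ! i < as ! (i + 1)"
          using nth2[of i] nth[of "i + 1"] r[of "i + 1"] len by (cases "i + 1 = L") auto
      qed (use len in auto)
      then show "degree A = degree C \<and> alternating cs as \<or> degree A = degree C + 1 \<and> alternating as cs"
        using 3 dA dC by simp
    qed (use 3 r lt in auto)
  qed
qed

text \<open>\<open>B\<close> alternates in sign along the zeros of \<open>C\<close> by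
  \<open>precedes_sign\<close>, and \<open>A\<close> has the opposite sign there.\<close>

lemma precedes_step:
  assumes "precedes B C" and nonneg: "\<And>i. 0 \<le> coeff A i"
    and deg: "degree A = degree C \<or> degree A = degree C + 1" and "A \<noteq> 0"
    and low: "\<And>b. (\<And>i. i < b \<Longrightarrow> coeff C i = 0) \<Longrightarrow> (\<And>i. i < b \<Longrightarrow> coeff A i = 0)"
    and AB: "\<And>c. c < 0 \<Longrightarrow> poly C c = 0 \<Longrightarrow> poly A c * poly B c < 0"
  shows "precedes C A"
proof -
  obtain \<beta> cs where C: "neg_split C \<beta> cs"
    and sign: "\<And>i. i < length cs \<Longrightarrow> (-1) ^ (degree C + i) * poly B (cs ! i) < 0"
    using precedes_sign[OF \<open>precedes B C\<close>] by blast
  obtain l where l: "C = Polynomial.smult l (monom 1 \<beta> * (\<Prod>c\<leftarrow>cs. [:- c, 1:]))" "\<And>c. c \<in> set cs \<Longrightarrow> c < 0"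
    using C by (auto simp: neg_split_def)
  show ?thesis
  proof (rule precedesI_alternating_signs[OF C nonneg deg \<open>A \<noteq> 0\<close>])
    show "coeff A i = 0" if "i < \<beta>" for i
      using that by (rule low[rotated]) (simp add: l coeff_monom_mult)
  next
    fix i assume i: "i < length cs"
    have "poly C (cs ! i) = 0"
      using i by (auto simp: l poly_linear_factors prod_list_zero_iff)
    then have "poly A (cs ! i) * poly B (cs ! i) < 0"
      using AB l(2) i by simp
    then show "0 < (-1) ^ (degree C + i) * poly A (cs ! i)"
      using sign[OF i] by (cases "even (degree C + i)") (auto simp: mult_less_0_iff)
  qed
qed

subsection \<open>Interlacing of consecutive minors\<close>

lemma cnt_nonzero_Suc_iff:
  assumes a: "\<And>j. a j > 0"
  shows "cnt p k a (Suc t) y \<noteq> 0 \<longleftrightarrow> cnt p k a t y \<noteq> 0 \<or>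
    \<not> t < k \<and> occupied p y (int t + 1) \<and> \<not> occupied p y (int t) \<and> cnt p k a t (hop_back p (int t + 1) y) \<noteq> 0"
proof -
  have "0 \<le> cnt p k a t y" and z: "0 \<le> cnt p k a t (hop_back p (int t + 1) y)"
    using cnt_nonneg[of a, OF a] by blast+
  then have x: "0 \<le> a (t - p) * cnt p k a t y"
    by (simp add: less_imp_le[OF a])
  show ?thesis
    using add_nonneg_eq_0_iff[OF x z] less_imp_neq[OF a, of "t - p"] by simp
qed

text \<open>No cancellation occurs among nonnegative weights, so reachability depends on the moves
  alone. This allows orders of vanishing to be compared between the weights \<open>a\<close> and
  their shift.\<close>

lemma cnt_nonzero_indep:
  assumes a: "\<And>j. a j > 0" and a': "\<And>j. a' j > 0"
  shows "cnt p k a t y \<noteq> 0 \<longleftrightarrow> cnt p k a' t y \<noteq> 0"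
proof (induction t arbitrary: y)
  case (Suc t)
  then show ?case
    unfolding cnt_nonzero_Suc_iff[of a, OF a] cnt_nonzero_Suc_iff[of a', OF a'] by blast
qed simp

text \<open>The substitution \<open>u = (-1) ^ k * v\<close> cancels the sign in
  \<open>coeff_minor\<close>.\<close>

definition signed_minor :: "nat \<Rightarrow> nat \<Rightarrow> (nat \<Rightarrow> real) \<Rightarrow> nat \<Rightarrow> real poly" where
  "signed_minor p k a n = pcompose (minor p a (Suc k) (arc p k n)) [:0, (-1) ^ k:]"

lemma poly_signed_minor: "poly (signed_minor p k a n) v = poly (minor p a (Suc k) (arc p k n)) ((-1) ^ k * v)"
  by (simp add: signed_minor_def poly_pcompose mult.commute)

lemma coeff_signed_minor:
  assumes "k \<le> p" "1 \<le> p" "k \<le> n"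
  shows "coeff (signed_minor p k a n) b = cnt p k a n (\<lambda>i. arc p k n (i - int b))"
proof -
  have "coeff (signed_minor p k a n) b = ((-1) ^ k) ^ b * ((-1) ^ (k * b) * cnt p k a n (\<lambda>i. arc p k n (i - int b)))"
    unfolding signed_minor_def coeff_pcompose_linear using assms
    by (subst coeff_minor[OF assms(1,2) conf_arc0[OF assms(1)] assms(3)]) (auto simp: arc_small)
  also have "\<dots> = cnt p k a n (\<lambda>i. arc p k n (i - int b))"
    by (simp flip: power_mult mult.assoc power_add)
  finally show ?thesis .
qed

lemma nondegenerate_le: "nondegenerate p k n \<Longrightarrow> k \<le> n"
proof -
  assume nd: "nondegenerate p k n"
  let ?r = "n div (p + 1)" and ?j = "n mod (p + 1)"
  have "?r + ?j \<le> ?r * (p + 1) + ?j"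
    by simp
  also have "\<dots> = n"
    by (rule div_mult_mod_eq)
  finally have "?r + ?j \<le> n" .
  then show ?thesis
    using nd by (auto simp: nondegenerate_def Let_def split: if_splits)
qed

lemma coeff_signed_minor_nonneg:
  assumes "\<And>j. a j > 0" "k \<le> p" "1 \<le> p" "k \<le> n"
  shows "0 \<le> coeff (signed_minor p k a n) b"
  using cnt_nonneg[of a, OF assms(1)] by (simp add: coeff_signed_minor[OF assms(2-4)])

lemma signed_minor_nondegenerate:
  assumes a: "\<And>j. a j > 0" and "k \<le> p" "1 \<le> p" and nd: "nondegenerate p k n"
  shows "0 \<le> top_shift p k n" "degree (signed_minor p k a n) = nat (top_shift p k n)" "signed_minor p k a n \<noteq> 0"
    "0 < coeff (signed_minor p k a n) (nat (top_shift p k n))"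
proof -
  note c = coeff_signed_minor[OF assms(2,3) nondegenerate_le[OF nd], of a]
  have top: "cnt p k a n (\<lambda>i. arc p k n (i - top_shift p k n)) > 0"
    using cnt_arc_top_pos[of a, OF a assms(2) nd] .
  then show nonneg: "0 \<le> top_shift p k n"
    using cnt_arc_shift_nonneg[OF assms(2) nondegenerate_le[OF nd]] by (metis less_irrefl)
  show pos: "0 < coeff (signed_minor p k a n) (nat (top_shift p k n))"
    using top nonneg by (simp add: c)
  have "coeff (signed_minor p k a n) b = 0" if "b > nat (top_shift p k n)" for b
  proof (rule ccontr)
    assume "\<not> ?thesis"
    then have "int b \<le> top_shift p k n"
      using cnt_arc_shift_le[OF assms(2)] by (simp add: c)
    then show False
      using that by linarith
  qed
  then show "degree (signed_minor p k a n) = nat (top_shift p k n)"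
    using pos by (intro antisym degree_le le_degree) auto
  show "signed_minor p k a n \<noteq> 0"
    using pos by auto
qed

lemma poly_pos_if_coeffs_nonneg:
  fixes f :: "real poly"
  assumes "\<And>i. 0 \<le> coeff f i" "f \<noteq> 0" "0 < x"
  shows "0 < poly f x"
proof -
  have "0 < coeff f (degree f)"
    using assms(1)[of "degree f"] assms(2) by (metis leading_coeff_0_iff order_le_less)
  then have "0 < coeff f (degree f) * x ^ degree f"
    using assms(3) by simp
  also have "\<dots> \<le> poly f x"
    unfolding poly_altdef using assms by (intro member_le_sum) auto
  finally show ?thesis .
qed

lemma signed_minor_pos:
  assumes "\<And>j. a j > 0" "k \<le> p" "1 \<le> p" "nondegenerate p k n" "0 < v"
  shows "0 < poly (signed_minor p k a n) v"
  by (rule poly_pos_if_coeffs_nonneg[OF coeff_signed_minor_nonneg[of a, OF assms(1-3) nondegenerate_le[OF assms(4)]]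
        signed_minor_nondegenerate(3)[of a, OF assms(1-4)] assms(5)])

text \<open>The two cases for the degree are those of part (b): a constant degree starts the chain
  with the zeros for \<open>n\<close>, a growing one with those for \<open>n + 1\<close>.\<close>

lemma top_shift_Suc:
  assumes "k < p"
  shows "top_shift p k (Suc n) = top_shift p k n + (if k \<le> n mod (p + 1) \<and> n mod (p + 1) < p then 0 else 1)"
proof (cases "n mod (p + 1) = p")
  case True
  have "Suc n mod (p + 1) = 0" "Suc n div (p + 1) = Suc (n div (p + 1))"
    using True by (simp_all add: mod_Suc div_Suc)
  then show ?thesis
    using True assms by (simp add: top_shift_def Let_def distrib_left)
next
  case False
  then have "Suc n mod (p + 1) = Suc (n mod (p + 1))" "Suc n div (p + 1) = n div (p + 1)"
    by (simp_all add: mod_Suc div_Suc)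
  moreover have "n mod (p + 1) < p"
    using False mod_less_divisor[of "p + 1" n] by linarith
  ultimately show ?thesis
    using False assms by (auto simp: top_shift_def Let_def)
qed

lemma top_shift_add_period: "top_shift p k (n + p + 1) = top_shift p k n + (int k + 1)"
proof -
  have "(n + p + 1) mod (p + 1) = n mod (p + 1)" "(n + p + 1) div (p + 1) = Suc (n div (p + 1))"
    using mod_add_self2[of n "p + 1"] div_add_self2[of "p + 1" n] by (simp_all add: add.assoc)
  then show ?thesis
    by (simp add: top_shift_def Let_def distrib_left)
qed

lemma nondegenerate_add_period: "nondegenerate p k n \<Longrightarrow> nondegenerate p k (n + p + 1)"
proof -
  have "(n + p + 1) mod (p + 1) = n mod (p + 1)" "(n + p + 1) div (p + 1) = Suc (n div (p + 1))"
    using mod_add_self2[of n "p + 1"] div_add_self2[of "p + 1" n] by (simp_all add: add.assoc)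
  then show "nondegenerate p k n \<Longrightarrow> nondegenerate p k (n + p + 1)"
    by (simp add: nondegenerate_def Let_def split: if_splits)
qed

lemma coeff_signed_minor_Suc_low:
  assumes a: "\<And>j. a j > 0" and a': "\<And>j. a' j > 0" and "k < p" and nd: "nondegenerate p k n"
    and low: "\<And>i. i < b \<Longrightarrow> coeff (signed_minor p k a' n) i = 0" and "i < b"
  shows "coeff (signed_minor p k a (Suc n)) i = 0"
proof (rule ccontr)
  assume nz: "\<not> ?thesis"
  have kp: "k \<le> p" "1 \<le> p" and kn: "k \<le> n"
    using assms(3) nondegenerate_le[OF nd] by auto
  have "cnt p k a (n + 1) (\<lambda>i'. arc p k (n + 1) (i' - int i)) \<noteq> 0"
    using nz kn by (simp add: coeff_signed_minor[OF kp])
  then obtain b' where b': "b' \<le> int i" "cnt p k a n (\<lambda>i. arc p k n (i - b')) \<noteq> 0"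
    using cnt_arc_Suc[of a, OF a \<open>k < p\<close> nd] by blast
  have "0 \<le> b'"
    using cnt_arc_shift_nonneg[OF kp(1) kn b'(2)] .
  then have "coeff (signed_minor p k a' n) (nat b') \<noteq> 0"
    using b'(2) cnt_nonzero_indep[of a a', OF a a'] by (simp add: coeff_signed_minor[OF kp kn])
  then show False
    using low[of "nat b'"] b'(1) \<open>i < b\<close> by linarith
qed

lemma coeff_signed_minor_add_period_low:
  assumes a: "\<And>j. a j > 0" and "k < p" and nd: "nondegenerate p k n"
    and low: "\<And>i. i < b \<Longrightarrow> coeff (signed_minor p k a n) i = 0" and "i < b + k"
  shows "coeff (signed_minor p k a (n + p + 1)) i = 0"
proof (rule ccontr)
  assume nz: "\<not> ?thesis"
  have kp: "k \<le> p" "1 \<le> p" and kn: "k \<le> n"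
    using assms(2) nondegenerate_le[OF nd] by auto
  have "cnt p k a (n + p + 1) (\<lambda>i'. arc p k (n + p + 1) (i' - int i)) \<noteq> 0"
    using nz kn kp by (simp add: coeff_signed_minor)
  then obtain b' where b': "b' \<le> int i - int k" "cnt p k a n (\<lambda>i. arc p k n (i - b')) \<noteq> 0"
    using cnt_arc_add_period[of a, OF a \<open>k < p\<close> nd] by blast
  have "0 \<le> b'"
    using cnt_arc_shift_nonneg[OF kp(1) kn b'(2)] .
  then have "coeff (signed_minor p k a n) (nat b') \<noteq> 0"
    using b'(2) by (simp add: coeff_signed_minor[OF kp kn])
  then show False
    using low[of "nat b'"] b'(1) \<open>0 \<le> b'\<close> \<open>i < b + k\<close> by linarith
qed

lemma signed_minor_monomial:
  assumes a: "\<And>j. a j > 0" and "k \<le> p" "1 \<le> p" and nd: "nondegenerate p k n" and "n < (k + 1) * (p + 1)"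
  obtains \<beta> where "neg_split (signed_minor p k a n) \<beta> []"
proof
  let ?b = "nat (top_shift p k n)"
  define l where "l = coeff (signed_minor p k a n) ?b"
  have "coeff (signed_minor p k a n) b = 0" if "b \<noteq> ?b" for b
    using that cnt_arc_monomial[OF assms(2,3,5), of "int b" a] signed_minor_nondegenerate(1)[of a, OF a assms(2-4)]
    by (subst coeff_signed_minor[OF assms(2,3) nondegenerate_le[OF nd]]) auto
  then have "signed_minor p k a n = Polynomial.smult l (monom 1 ?b)"
    by (intro poly_eqI) (auto simp: l_def)
  moreover have "l > 0"
    unfolding l_def using signed_minor_nondegenerate(4)[of a, OF a assms(2-4)] .
  ultimately show "neg_split (signed_minor p k a n) ?b []"
    by (auto simp: neg_split_def)
qed

text \<open>For size \<open>k\<close> the sign belonging to the variable is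
  \<open>(-1) ^ (k - 1)\<close>, so the point corresponds to the positive argument
  \<open>- v\<close>. For \<open>k = 0\<close> the determinant is empty.\<close>

lemma inner_minor_pos:
  assumes a: "\<And>j. a j > 0" and "k \<le> p" "1 \<le> p" "k * (p + 1) \<le> n" "v < 0"
  shows "0 < poly (minor p a k (\<lambda>j. int n - int k + j + 1)) ((-1) ^ k * v)"
proof (cases k)
  case (Suc k')
  have "minor p a k (\<lambda>j. int n - int k + j + 1) = minor p a (Suc k') (arc p k' n)"
    unfolding Suc by (intro minor_cong) (auto simp: arc_small)
  moreover have "0 < poly (signed_minor p k' a n) (- v)"
  proof (rule signed_minor_pos[of a, OF a])
    have "k' * (p + 1) \<le> k * (p + 1)"
      unfolding Suc by simp
    then show "nondegenerate p k' n"
      using assms(4) by (intro nondegenerate_if_large) simp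
  qed (use assms Suc in auto)
  ultimately show ?thesis
    by (simp add: poly_signed_minor Suc)
qed (simp add: minor_def)

text \<open>
  Jacobi's identity reads \<open>C D - A B = E\<close>, where \<open>E\<close> is a product of minors of sizes \<open>k + 2\<close> and \<open>k\<close>.
  For these the sign \<open>(-1)\<^sup>k\<close> is the opposite one, so that \<open>E > 0\<close> on the half-line \<open>v < 0\<close>.
\<close>

lemma desnanot_signed_minor:
  assumes a: "\<And>j. a j > 0" and "k < p" "(k + 1) * (p + 1) \<le> Suc (Suc n)" "v < 0"
  defines "a' \<equiv> \<lambda>n. a (Suc n)"
  shows "poly (signed_minor p k a (Suc (Suc n))) v * poly (signed_minor p k a' n) v <
    poly (signed_minor p k a (Suc n)) v * poly (signed_minor p k a' (Suc n)) v"
proof -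
  define g where "g = (\<lambda>i j. sol p a i (int n + 1 - int k + int j))"
  define D where "D = (\<lambda>m r s. det (mat m m (\<lambda>(i, j). g (i + r) (j + s))))"
  let ?u = "(-1) ^ k * v"
  have C: "D (k + 1) 0 0 = minor p a (Suc k) (arc p k (Suc n))"
    "D (k + 1) 0 1 = minor p a (Suc k) (arc p k (Suc (Suc n)))"
    "D (k + 2) 0 0 = minor p a (Suc (Suc k)) (arc p (Suc k) (Suc (Suc n)))"
    unfolding D_def g_def minor_def by (intro arg_cong[of _ _ det] cong_mat; simp add: arc_small algebra_simps)+
  have C': "D (k + 1) 1 1 = minor p a' (Suc k) (arc p k (Suc n))"
    "D (k + 1) 1 0 = minor p a' (Suc k) (arc p k n)"
    "D k 1 1 = minor p a' k (\<lambda>j. int n - int k + j + 1)"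
    unfolding D_def g_def minor_def a'_def by (intro arg_cong[of _ _ det] cong_mat; simp add: arc_small sol_Suc algebra_simps)+
  have "nondegenerate p (Suc k) (Suc (Suc n))"
    using assms(3) by (intro nondegenerate_if_large) simp
  then have "0 < poly (signed_minor p (Suc k) a (Suc (Suc n))) (- v)"
    using assms by (intro signed_minor_pos[of a]) auto
  then have pos: "0 < poly (D (k + 2) 0 0) ?u"
    unfolding poly_signed_minor C by simp
  have "(k + 1) * (p + 1) = k * (p + 1) + p + 1"
    by simp
  then have "0 < poly (D k 1 1) ?u"
    unfolding C' using assms by (intro inner_minor_pos) auto
  with pos have "0 < poly (D (k + 2) 0 0) ?u * poly (D k 1 1) ?u"
    by simp
  also have "\<dots> = poly (D (k + 1) 0 0) ?u * poly (D (k + 1) 1 1) ?u - poly (D (k + 1) 0 1) ?u * poly (D (k + 1) 1 0) ?u"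
  proof -
    have "D (k + 2) 0 0 \<noteq> 0"
      using pos by auto
    then have "D (k + 2) 0 0 * D k 1 1 = D (k + 1) 0 0 * D (k + 1) 1 1 - D (k + 1) 0 1 * D (k + 1) 1 0"
      unfolding D_def by (rule desnanot_jacobi)
    then show ?thesis
      by (metis poly_mult poly_diff)
  qed
  finally show ?thesis
    unfolding poly_signed_minor C C' by simp
qed

text \<open>Let \<open>n = Suc m\<close>. By \<open>desnanot_signed_minor\<close>, the polynomials
  for \<open>(a, Suc n)\<close> and \<open>(a', m)\<close> have opposite signs at each negative zero
  of the one for \<open>(a, n)\<close> or \<open>(a', n)\<close>. That the one for
  \<open>(a', m)\<close> precedes these two is the second claim of the induction hypothesis for
  \<open>a\<close> and the first claim for \<open>a'\<close>; hence the pair of claims and the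
  induction over all \<open>a\<close>.\<close>

lemma precedes_signed_minor:
  assumes "k < p"
  shows "(\<And>j. a j > 0) \<Longrightarrow> nondegenerate p k n \<Longrightarrow> nondegenerate p k (Suc n) \<Longrightarrow>
    precedes (signed_minor p k a n) (signed_minor p k a (Suc n)) \<and> precedes (signed_minor p k (\<lambda>n. a (Suc n)) n) (signed_minor p k a (Suc n))"
proof (induction n arbitrary: a rule: less_induct)
  case (less n)
  note IH = less.IH and a = less.prems(1) and nd = less.prems(2,3)
  have kp: "k \<le> p" "1 \<le> p"
    using assms by auto
  define a' where "a' = (\<lambda>n. a (Suc n))"
  have a': "\<And>j. a' j > 0"
    using a by (simp add: a'_def)
  note nonneg = coeff_signed_minor_nonneg[of a, OF a kp nondegenerate_le[OF nd(2)]]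
    and nz = signed_minor_nondegenerate(3)[of a, OF a kp nd(2)]
  have deg: "degree (signed_minor p k a (Suc n)) = degree (signed_minor p k b n) \<or> degree (signed_minor p k a (Suc n)) = degree (signed_minor p k b n) + 1"
    if "\<And>j. b j > 0" for b
    using signed_minor_nondegenerate(1,2)[of a, OF a kp nd(2)] signed_minor_nondegenerate(1,2)[of b, OF that kp nd(1)] top_shift_Suc[OF assms, of n]
    by (auto split: if_splits)
  \<comment> \<open>In the first range \<open>signed_minor\<close> is a monomial at
    \<open>n\<close>, so there are no sign conditions to check. In the second range \<open>n\<close>
    is large enough for the minors of sizes \<open>k\<close> and \<open>k + 2\<close>.\<close>
  show ?case
  proof (cases "Suc n < (k + 1) * (p + 1)")
    case True
    have "precedes (signed_minor p k b n) (signed_minor p k a (Suc n))" if b: "\<And>j. b j > 0" for b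
    proof -
      obtain \<beta> where \<beta>: "neg_split (signed_minor p k b n) \<beta> []"
        using signed_minor_monomial[of b, OF b kp nd(1)] True by (metis Suc_lessD)
      then have low: "coeff (signed_minor p k b n) i = 0" if "i < \<beta>" for i
        using that by (auto simp: neg_split_def)
      show ?thesis
      proof (rule precedesI_alternating_signs[OF \<beta> nonneg deg[of b, OF b] nz])
        show "coeff (signed_minor p k a (Suc n)) i = 0" if "i < \<beta>" for i
          using coeff_signed_minor_Suc_low[of a b, OF a b assms nd(1) low that] .
      qed simp
    qed
    from this[of a, OF a] this[of a', OF a'] show ?thesis
      unfolding a'_def ..
  next
    case False
    then obtain m where m: "n = Suc m"
      using kp by (cases n) auto
    have "(k + 1) * (p + 1) = k * (p + 1) + p + 1"
      by simp
    then have "k * (p + 1) \<le> m"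
      using False m kp by linarith
    then have nd0: "nondegenerate p k m"
      by (rule nondegenerate_if_large)
    have sign: "poly (signed_minor p k a (Suc n)) v * poly (signed_minor p k a' m) v < poly (signed_minor p k a n) v * poly (signed_minor p k a' n) v" if "v < 0" for v
      unfolding m a'_def using desnanot_signed_minor[of a, OF a assms _ that, of m] False m by simp
    have "precedes (signed_minor p k a' m) (signed_minor p k a n)"
      using IH[of m a] m a nd nd0 by (simp add: a'_def)
    then have 1: "precedes (signed_minor p k a n) (signed_minor p k a (Suc n))"
    proof (rule precedes_step[OF _ nonneg deg[of a, OF a] nz])
      show "coeff (signed_minor p k a (Suc n)) i = 0" if "\<And>i. i < b \<Longrightarrow> coeff (signed_minor p k a n) i = 0" "i < b" for b i
        using coeff_signed_minor_Suc_low[of a a, OF a a assms nd(1) that] .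
      show "poly (signed_minor p k a (Suc n)) c * poly (signed_minor p k a' m) c < 0" if "c < 0" "poly (signed_minor p k a n) c = 0" for c
        using sign[OF that(1)] that(2) by simp
    qed
    have "precedes (signed_minor p k a' m) (signed_minor p k a' n)"
      using IH[of m a'] m a' nd nd0 by simp
    then have 2: "precedes (signed_minor p k a' n) (signed_minor p k a (Suc n))"
    proof (rule precedes_step[OF _ nonneg deg[of a', OF a'] nz])
      show "coeff (signed_minor p k a (Suc n)) i = 0" if "\<And>i. i < b \<Longrightarrow> coeff (signed_minor p k a' n) i = 0" "i < b" for b i
        using coeff_signed_minor_Suc_low[of a a', OF a a' assms nd(1) that] .
      show "poly (signed_minor p k a (Suc n)) c * poly (signed_minor p k a' m) c < 0" if "c < 0" "poly (signed_minor p k a' n) c = 0" for c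
        using sign[OF that(1)] that(2) by simp
    qed
    from 1 2 show ?thesis
      unfolding a'_def ..
  qed
qed

subsection \<open>Interlacing over a full period\<close>

text \<open>While the site behind the front particle is occupied, the hop term of
  \<open>minor_conf_rec\<close> vanishes. Each step then only rotates the labels and splits off a
  factor of the variable.\<close>

lemma minor_steps:
  assumes a: "\<And>j. a j > 0" and c: "conf p k y" and "1 \<le> p"
  shows "(\<And>j. j \<le> d \<Longrightarrow> y (int k - int j) = T + 1 - int j) \<Longrightarrow> int k + int d \<le> T + 1 \<Longrightarrow>
    \<exists>c>0. minor p a (Suc k) y = monom (c * ((-1) ^ k) ^ d) d * minor p a (Suc k) (\<lambda>i. y (i - int d))"
proof (induction d)
  case 0
  show ?case
    by (rule exI[of _ 1]) simp
next
  case (Suc d)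
  then obtain c where c0: "c > 0" and
    IH: "minor p a (Suc k) y = monom (c * ((-1) ^ k) ^ d) d * minor p a (Suc k) (\<lambda>i. y (i - int d))"
    by auto
  let ?y = "\<lambda>i. y (i - int d)" and ?t = "T - int d"
  have cy: "conf p k ?y"
    using conf_shift[OF c] .
  have yk: "?y (int k) = ?t + 1"
    using Suc.prems(1)[of d] by simp
  have "?y (int k - 1) = ?t"
    using Suc.prems(1)[of "Suc d"] by (simp add: algebra_simps)
  then have occ: "occupied p ?y ?t"
    using occupied_iff[OF cy] by blast
  have "int k \<le> ?t"
    using Suc.prems(2) by simp
  then have "minor p a (Suc k) ?y =
      [:0, (-1) ^ k * a (nat (?t - int p)):] * minor p a (Suc k) (\<lambda>i. y (i - int (Suc d)))"
    using minor_conf_rec[OF cy \<open>1 \<le> p\<close> yk, of a] occ by (simp add: algebra_simps)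
  also have "[:0, (-1) ^ k * a (nat (?t - int p)):] = monom ((-1) ^ k * a (nat (?t - int p))) 1"
    by (simp add: monom_altdef)
  finally have step: "minor p a (Suc k) ?y =
      monom ((-1) ^ k * a (nat (?t - int p))) 1 * minor p a (Suc k) (\<lambda>i. y (i - int (Suc d)))" .
  have eq: "c * s ^ d * (s * \<alpha>) = (c * \<alpha>) * s ^ Suc d" for s \<alpha> :: real
    by simp
  have "minor p a (Suc k) y =
      monom ((c * a (nat (?t - int p))) * ((-1) ^ k) ^ Suc d) (Suc d) * minor p a (Suc k) (\<lambda>i. y (i - int (Suc d)))"
    unfolding IH step by (subst mult.assoc[symmetric], subst mult_monom, subst eq) (simp only: Suc_eq_plus1)
  then show ?case
    using c0 a by (intro exI[of _ "c * a (nat (?t - int p))"]) simp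
qed

lemma poly_sign_monom: "poly (monom (c * s ^ d) d) x = c * (s * x) ^ d" for x :: real
  by (simp add: poly_monom power_mult_distrib)

text \<open>The determinant identity for the columns \<open>n - k, \<dots>, n, n + p + 1 - k\<close>.\<close>

lemma desnanot_signed_minor_period:
  assumes a: "\<And>j. a j > 0" and kp: "k < p" and m: "k * (p + 1) \<le> m" and v: "v < 0"
    and root: "poly (signed_minor p k a (Suc m)) v = 0"
  defines "a' \<equiv> \<lambda>n. a (Suc n)"
  shows "\<exists>x. poly (signed_minor p k a (Suc m + p + 1)) v = v ^ k * x \<and> x * poly (signed_minor p k a' m) v < 0"
proof -
  let ?n = "Suc m" and ?u = "(-1) ^ k * v"
  let ?N = "?n + p + 1"
  define g where "g = (\<lambda>i j. sol p a i (if j \<le> k then int ?n - int k + int j else int ?n + int p + 1 - int k))"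
  define D where "D = (\<lambda>m r s. det (mat m m (\<lambda>(i, j). g (i + r) (j + s))))"
  have "k * 1 \<le> k * (p + 1)"
    by (intro mult_left_mono) auto
  then have km: "k \<le> m"
    using m by simp
  have arc_back: "arc p l N (i - (int l + 1)) = arc p l N i - (int p + 1)" for l N i
    using arc_period[of p l N i "-1"] by (simp add: algebra_simps)
  have C: "D (k + 1) 0 0 = minor p a (Suc k) (arc p k ?n)"
    unfolding D_def g_def minor_def by (intro arg_cong[of _ _ det] cong_mat; simp add: arc_small algebra_simps)
  have B: "D (k + 1) 1 0 = minor p a' (Suc k) (arc p k m)"
    unfolding D_def g_def minor_def a'_def by (intro arg_cong[of _ _ det] cong_mat; simp add: arc_small sol_Suc algebra_simps)
  have inner: "D k 1 1 = minor p a' k (\<lambda>j. int m - int k + j + 1)"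
    unfolding D_def g_def minor_def a'_def by (intro arg_cong[of _ _ det] cong_mat; simp add: sol_Suc algebra_simps)
  \<comment> \<open>Rotating the arc of \<open>?N\<close> by \<open>k\<close> labels takes all its
    columns but the lowest one turn back. The rotation accounts for the factor \<open>v ^ k\<close>
    below.\<close>
  have X: "D (k + 1) 0 1 = minor p a (Suc k) (\<lambda>i. arc p k ?N (i - int k))"
  proof -
    have "D (k + 1) 0 1 = minor p a (Suc k) (\<lambda>i. if i < int k then int ?n - int k + i + 1 else int ?n + int p + 1 - int k)"
      unfolding D_def g_def minor_def by (intro arg_cong[of _ _ det] cong_mat; simp add: algebra_simps)
    also have "\<dots> = minor p a (Suc k) (\<lambda>i. arc p k ?N (i - int k))"
    proof (rule minor_cong)
      fix j assume j: "0 \<le> j" "j < int (Suc k)"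
      show "(if j < int k then int ?n - int k + j + 1 else int ?n + int p + 1 - int k) = arc p k ?N (j - int k)"
      proof (cases "j < int k")
        case True
        have "arc p k ?N (j - int k) = arc p k ?N (j + 1) - (int p + 1)"
          using arc_back[of k ?N "j + 1"] by simp
        then show ?thesis
          using True j by (simp add: arc_small)
      next
        case False
        then have "j = int k"
          using j by simp
        then show ?thesis
          by (simp add: arc_small)
      qed
    qed
    finally show ?thesis .
  qed
  \<comment> \<open>One application of the recurrence moves the last column from
    \<open>?n + p + 1 - k\<close> to \<open>?n + p - k\<close>; the other term repeats the first
    column \<open>?n - k\<close> and vanishes. What remains is a rotated arc of \<open>k + 2\<close>
    sites.\<close>
  have M: "D (k + 2) 0 0 = minor p a (Suc (Suc k)) (\<lambda>i. arc p (Suc k) ?N (i - int (Suc k)))"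
  proof -
    define y where "y = (\<lambda>i. if i \<le> int k then int ?n - int k + i else int ?n + int p + 1 - int k)"
    let ?t = "int ?n + int p - int k"
    have "D (k + 2) 0 0 = minor p a (Suc (Suc k)) y"
      unfolding D_def g_def minor_def y_def by (intro arg_cong[of _ _ det] cong_mat; simp add: algebra_simps)
    also have "\<dots> = minor p a (Suc (Suc k)) (y(int (Suc k) := ?t)) +
        [:0, a (nat (?t - int p)):] * minor p a (Suc (Suc k)) (y(int (Suc k) := ?t - int p))"
      using kp km by (intro minor_rec) (simp_all add: y_def)
    also have "minor p a (Suc (Suc k)) (y(int (Suc k) := ?t - int p)) = 0"
      by (rule minor_equal_columns[of _ 0 "Suc k"]) (simp_all add: y_def)
    also have "minor p a (Suc (Suc k)) (y(int (Suc k) := ?t)) =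
        minor p a (Suc (Suc k)) (\<lambda>i. arc p (Suc k) ?N (i - int (Suc k)))"
    proof (rule minor_cong)
      fix j assume j: "0 \<le> j" "j < int (Suc (Suc k))"
      show "(y(int (Suc k) := ?t)) j = arc p (Suc k) ?N (j - int (Suc k))"
      proof (cases "j \<le> int k")
        case True
        have "arc p (Suc k) ?N (j - int (Suc k)) = arc p (Suc k) ?N (j + 1) - (int p + 1)"
          using arc_back[of "Suc k" ?N "j + 1"] by (simp add: algebra_simps)
        then show ?thesis
          using True j by (simp add: arc_small y_def)
      next
        case False
        then have "j = int (Suc k)"
          using j by simp
        then show ?thesis
          by (simp add: arc_small)
      qed
    qed
    finally show ?thesis
      by simp
  qed
  obtain c where c: "c > 0" "minor p a (Suc k) (arc p k ?N) = monom (c * ((-1) ^ k) ^ k) k * D (k + 1) 0 1"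
    using minor_steps[of a, OF a conf_arc0[of k p ?N], of k "int (?n + p)"] kp km unfolding X by (auto simp: arc_small)
  obtain c' where c': "c' > 0" "minor p a (Suc (Suc k)) (arc p (Suc k) ?N) =
      monom (c' * ((-1) ^ Suc k) ^ Suc k) (Suc k) * D (k + 2) 0 0"
    using minor_steps[of a, OF a conf_arc0[of "Suc k" p ?N], of "Suc k" "int (?n + p)"] kp km unfolding M
    by (auto simp: arc_small)
  have "(k + 1) * (p + 1) \<le> ?N"
    using m by simp
  then have "nondegenerate p (Suc k) ?N"
    by (intro nondegenerate_if_large) simp
  then have "0 < poly (signed_minor p (Suc k) a ?N) (- v)"
    using assms by (intro signed_minor_pos[of a]) auto
  also have "\<dots> = c' * (- v) ^ Suc k * poly (D (k + 2) 0 0) ?u"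
    unfolding poly_signed_minor c' poly_mult poly_sign_monom by (simp flip: mult.assoc power_mult_distrib)
  finally have "0 < c' * (- v) ^ Suc k * poly (D (k + 2) 0 0) ?u" .
  moreover have "0 < c' * (- v) ^ Suc k"
    using c'(1) v by (intro mult_pos_pos zero_less_power) auto
  ultimately have pos: "0 < poly (D (k + 2) 0 0) ?u"
    by (rule zero_less_mult_pos)
  moreover have "0 < poly (D k 1 1) ?u"
    unfolding inner a'_def using assms by (intro inner_minor_pos) auto
  ultimately have "0 < poly (D (k + 2) 0 0) ?u * poly (D k 1 1) ?u"
    by simp
  also have "\<dots> = poly (D (k + 1) 0 0) ?u * poly (D (k + 1) 1 1) ?u - poly (D (k + 1) 0 1) ?u * poly (D (k + 1) 1 0) ?u"
  proof -
    have "D (k + 2) 0 0 \<noteq> 0"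
      using pos by auto
    then have "D (k + 2) 0 0 * D k 1 1 = D (k + 1) 0 0 * D (k + 1) 1 1 - D (k + 1) 0 1 * D (k + 1) 1 0"
      unfolding D_def by (rule desnanot_jacobi)
    then show ?thesis
      by (metis poly_mult poly_diff)
  qed
  also have "\<dots> = - (poly (D (k + 1) 0 1) ?u * poly (signed_minor p k a' m) v)"
    using root unfolding poly_signed_minor C B by simp
  finally have "c * poly (D (k + 1) 0 1) ?u * poly (signed_minor p k a' m) v < 0"
    using c(1) by (simp add: mult.assoc mult_pos_neg)
  moreover have "poly (signed_minor p k a ?N) v = v ^ k * (c * poly (D (k + 1) 0 1) ?u)"
    unfolding poly_signed_minor c poly_mult poly_sign_monom by (simp flip: mult.assoc power_mult_distrib)
  ultimately show ?thesis
    by blast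
qed

text \<open>The degree grows by \<open>k + 1\<close> over a period, so splitting off
  \<open>monom 1 k\<close> leaves growth one, as \<open>precedes\<close> requires. The polynomial
  for the shifted weights at \<open>n - 1\<close> serves as the sign reference, as in
  \<open>precedes_signed_minor\<close>.\<close>

lemma precedes_signed_minor_period:
  assumes a: "\<And>j. a j > 0" and kp: "k < p" and nd: "nondegenerate p k n"
  obtains H where "signed_minor p k a (n + p + 1) = monom 1 k * H" "precedes (signed_minor p k a n) H"
    "degree H = degree (signed_minor p k a n) + 1"
proof -
  have kp': "k \<le> p" "1 \<le> p"
    using kp by auto
  define N where "N = n + p + 1"
  have ndN: "nondegenerate p k N"
    unfolding N_def using nd by (rule nondegenerate_add_period)
  define H where "H = poly_shift k (signed_minor p k a N)"
  have low0: "coeff (signed_minor p k a N) i = 0" if "\<And>i. i < b \<Longrightarrow> coeff (signed_minor p k a n) i = 0" "i < b + k" for b i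
    unfolding N_def using coeff_signed_minor_add_period_low[of a, OF a kp nd that] .
  have GH: "signed_minor p k a N = monom 1 k * H"
    using low0[of 0] by (intro poly_eqI) (auto simp: coeff_monom_mult H_def coeff_poly_shift)
  have nzN: "signed_minor p k a N \<noteq> 0"
    using signed_minor_nondegenerate(3)[of a, OF a kp' ndN] .
  then have nz: "H \<noteq> 0"
    using GH by auto
  have "degree (signed_minor p k a N) = k + degree H"
    unfolding GH using nz by (simp add: degree_mult_eq degree_monom_eq)
  then have deg: "degree H = degree (signed_minor p k a n) + 1"
    using signed_minor_nondegenerate(1,2)[of a, OF a kp' nd] signed_minor_nondegenerate(1,2)[of a, OF a kp' ndN]
      top_shift_add_period[of p k n] by (simp add: N_def)
  have nonneg: "0 \<le> coeff H i" for i
    using coeff_signed_minor_nonneg[of a, OF a kp' nondegenerate_le[OF ndN]] by (simp add: H_def coeff_poly_shift)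
  have low: "coeff H i = 0" if "\<And>i. i < b \<Longrightarrow> coeff (signed_minor p k a n) i = 0" "i < b" for b i
    using low0[of b "i + k"] that by (simp add: H_def coeff_poly_shift)
  have "precedes (signed_minor p k a n) H"
  proof (cases "Suc n < (k + 1) * (p + 1)")
    case True
    obtain \<beta> where \<beta>: "neg_split (signed_minor p k a n) \<beta> []"
      using signed_minor_monomial[of a, OF a kp' nd] True by (metis Suc_lessD)
    then have lowG: "coeff (signed_minor p k a n) i = 0" if "i < \<beta>" for i
      using that by (auto simp: neg_split_def)
    show ?thesis
    proof (rule precedesI_alternating_signs[OF \<beta> nonneg disjI2[OF deg] nz])
      show "coeff H i = 0" if "i < \<beta>" for i
        using low[OF lowG that] .
    qed simp
  next
    case False
    then obtain m where m: "n = Suc m"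
      using kp by (cases n) auto
    have "(k + 1) * (p + 1) = k * (p + 1) + p + 1"
      by simp
    then have km: "k * (p + 1) \<le> m"
      using False m kp by linarith
    then have "nondegenerate p k m"
      by (rule nondegenerate_if_large)
    then have prec: "precedes (signed_minor p k (\<lambda>n. a (Suc n)) m) (signed_minor p k a n)"
      using precedes_signed_minor[OF kp, of a m] a nd m by simp
    show ?thesis
    proof (rule precedes_step[OF prec nonneg disjI2[OF deg] nz])
      show "coeff H i = 0" if "\<And>i. i < b \<Longrightarrow> coeff (signed_minor p k a n) i = 0" "i < b" for b i
        using low[OF that] .
      show "poly H c * poly (signed_minor p k (\<lambda>n. a (Suc n)) m) c < 0" if c: "c < 0" "poly (signed_minor p k a n) c = 0" for c
      proof -
        obtain x where x: "poly (signed_minor p k a N) c = c ^ k * x" "x * poly (signed_minor p k (\<lambda>n. a (Suc n)) m) c < 0"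
          using desnanot_signed_minor_period[of a, OF a kp km c(1)] c(2) m unfolding N_def by blast
        have "poly H c = x"
          using x(1) c(1) by (simp add: GH poly_monom)
        then show ?thesis
          using x(2) by simp
      qed
    qed
  qed
  then show thesis
    using that GH deg unfolding N_def by blast
qed

subsection \<open>The Hessenberg determinant as a minor of fundamental solutions\<close>

lemma det_scale_rows_columns:
  fixes f :: "nat \<Rightarrow> nat \<Rightarrow> 'a :: comm_ring_1"
  shows "det (mat m m (\<lambda>(i, j). r i * f i j * c j)) = (\<Prod>i<m. r i) * (\<Prod>i<m. c i) * det (mat m m (\<lambda>(i, j). f i j))"
proof -
  have "signof \<pi> * (\<Prod>i = 0..<m. r i * f i (\<pi> i) * c (\<pi> i)) =
      (\<Prod>i<m. r i) * (\<Prod>i<m. c i) * (signof \<pi> * (\<Prod>i = 0..<m. f i (\<pi> i)))"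
    if "\<pi> permutes {0..<m}" for \<pi>
  proof -
    have "(\<Prod>i = 0..<m. c (\<pi> i)) = (\<Prod>i = 0..<m. c i)"
      using prod.permute[OF that, of c] by (simp add: comp_def)
    then show ?thesis
      by (simp add: prod.distrib lessThan_atLeast0 mult_ac)
  qed
  moreover have "det (mat m m (\<lambda>(i, j). h i j)) = (\<Sum>\<pi> | \<pi> permutes {0..<m}. signof \<pi> * (\<Prod>i = 0..<m. h i (\<pi> i)))"
    for h :: "nat \<Rightarrow> nat \<Rightarrow> 'a"
    by (subst det_def'[of _ m]) (auto intro!: sum.cong arg_cong2[of _ _ _ _ "(*)"] prod.cong dest: permutes_in_image)
  ultimately show ?thesis
    by (simp add: sum_distrib_left)
qed

definition evalc :: "complex \<Rightarrow> real poly \<Rightarrow> complex" where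
  "evalc u q = poly (map_poly complex_of_real q) u"

lemma evalc_hom: "comm_ring_hom (evalc u)"
proof -
  have "map_poly complex_of_real (q + r) = map_poly complex_of_real q + map_poly complex_of_real r" for q r
    by (intro poly_eqI) (simp add: coeff_map_poly)
  moreover have "map_poly complex_of_real (q * r) = map_poly complex_of_real q * map_poly complex_of_real r" for q r
    by (intro poly_eqI) (simp add: coeff_map_poly coeff_mult)
  ultimately show ?thesis
    by unfold_locales (simp_all add: evalc_def)
qed

text \<open>Let \<open>Y\<close> consist of the first \<open>k + 1\<close> columns of
  \<open>Q\<close> followed by unit vectors. Then \<open>W * Y\<close> is block triangular with the
  wanted minor of \<open>W\<close> in its corner, and exchanging the column blocks of
  \<open>Y\<close> exhibits the minor of \<open>Q\<close>.\<close>

lemma det_W_Q: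
  fixes W Q :: "nat \<Rightarrow> nat \<Rightarrow> 'a :: idom"
  assumes lower: "\<And>i j. i < j \<Longrightarrow> W i j = 0" and diag: "\<And>i. W i i = 1"
    and inverse: "\<And>i j. i \<le> n \<Longrightarrow> j \<le> n \<Longrightarrow> (\<Sum>l\<le>n. W i l * Q l j) = (if i = j then 1 else 0)"
    and "k \<le> n"
  shows "det (mat (n - k) (n - k) (\<lambda>(i, j). W (i + k + 1) j)) =
    (-1) ^ ((n - k) * (k + 1)) * det (mat (k + 1) (k + 1) (\<lambda>(i, j). Q (i + (n - k)) j))"
proof -
  let ?m = "n - k + (k + 1)"
  have m: "?m = n + 1" "{0..<?m} = {..n}"
    using \<open>k \<le> n\<close> by auto
  define MW where "MW = mat ?m ?m (\<lambda>(i, j). W i j)"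
  define Y where "Y = mat ?m ?m (\<lambda>(i, j). if j \<le> k then Q i j else if i = j - (k + 1) then 1 else 0)"
  define W2 where "W2 = mat (n - k) (n - k) (\<lambda>(i, j). W (i + k + 1) j)"
  define Q2 where "Q2 = mat (k + 1) (k + 1) (\<lambda>(i, j). Q (i + (n - k)) j)"
  have car: "MW \<in> carrier_mat ?m ?m" "Y \<in> carrier_mat ?m ?m"
    by (simp_all add: MW_def Y_def)
  have "det MW = 1"
    by (subst det_lower_triangular[OF _ car(1)])
      (auto simp: MW_def lower diag prod_list_diag_prod intro!: prod.neutral)
  have "det Y = (-1) ^ ((n - k) * (k + 1)) *
      det (mat ?m ?m (\<lambda>(i, j). Y $$ (i, if j < n - k then j + (k + 1) else j - (n - k))))"
    by (rule det_swap_cols[OF car(2)])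
  also have "mat ?m ?m (\<lambda>(i, j). Y $$ (i, if j < n - k then j + (k + 1) else j - (n - k))) =
      four_block_mat (1\<^sub>m (n - k)) (mat (n - k) (k + 1) (\<lambda>(i, j). Q i j)) (0\<^sub>m (k + 1) (n - k)) Q2"
    using \<open>k \<le> n\<close> by (intro eq_matI) (auto simp: Y_def Q2_def)
  also have "det \<dots> = det Q2"
    by (subst det_four_block_mat_lower_left_zero[of _ "n - k" _ "k + 1"]) (auto simp: Q2_def)
  finally have "det Y = (-1) ^ ((n - k) * (k + 1)) * det Q2" .
  moreover have "det (MW * Y) = det W2"
  proof -
    have "MW * Y = four_block_mat (1\<^sub>m (k + 1)) (mat (k + 1) (n - k) (\<lambda>(i, j). W i j)) (0\<^sub>m (n - k) (k + 1)) W2"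
    proof (rule eq_matI)
      fix i j
      assume "i < dim_row (four_block_mat (1\<^sub>m (k + 1)) (mat (k + 1) (n - k) (\<lambda>(i, j). W i j)) (0\<^sub>m (n - k) (k + 1)) W2)"
        "j < dim_col (four_block_mat (1\<^sub>m (k + 1)) (mat (k + 1) (n - k) (\<lambda>(i, j). W i j)) (0\<^sub>m (n - k) (k + 1)) W2)"
      then have ij: "i < ?m" "j < ?m"
        by (auto simp: W2_def)
      have e: "(MW * Y) $$ (i, j) = (\<Sum>l\<le>n. MW $$ (i, l) * Y $$ (l, j))"
      proof -
        have "(MW * Y) $$ (i, j) = (\<Sum>l = 0..<?m. MW $$ (i, l) * Y $$ (l, j))"
          using ij car by (simp add: scalar_prod_def del: sum.op_ivl_Suc)
        then show ?thesis
          by (simp only: m(2))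
      qed
      have "(MW * Y) $$ (i, j) = (if j \<le> k then if i = j then 1 else 0 else W i (j - (k + 1)))"
      proof (cases "j \<le> k")
        case True
        then have "(MW * Y) $$ (i, j) = (\<Sum>l\<le>n. W i l * Q l j)"
          unfolding e using ij m by (intro sum.cong) (auto simp: MW_def Y_def)
        then show ?thesis
          using inverse[of i j] True ij m by simp
      next
        case False
        then have "(MW * Y) $$ (i, j) = (\<Sum>l\<le>n. if l = j - (k + 1) then W i l else 0)"
          unfolding e using ij m by (intro sum.cong) (auto simp: MW_def Y_def)
        then show ?thesis
          using False ij m by (simp add: sum.delta)
      qed
      then show "(MW * Y) $$ (i, j) =
          four_block_mat (1\<^sub>m (k + 1)) (mat (k + 1) (n - k) (\<lambda>(i, j). W i j)) (0\<^sub>m (n - k) (k + 1)) W2 $$ (i, j)"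
        using ij m by (auto simp: W2_def)
    qed (use car in \<open>auto simp: W2_def\<close>)
    also have "det \<dots> = det (1\<^sub>m (k + 1) :: 'a mat) * det W2"
      by (rule det_four_block_mat_lower_left_zero) (auto simp: W2_def)
    finally show ?thesis
      by simp
  qed
  ultimately show ?thesis
    using det_mult[OF car] \<open>det MW = 1\<close> by (simp add: W2_def Q2_def)
qed

text \<open>The scaling by \<open>x ^ i / x ^ j\<close> and the choice of \<open>u\<close> turn the
  recurrence of \<open>sol\<close> into the equations for the columns of the inverse of
  \<open>W\<close> in the next lemma.\<close>

lemma evalc_sol_rec:
  fixes a :: "nat \<Rightarrow> real"
  assumes "x \<noteq> 0" "1 \<le> p"
  defines "u \<equiv> - 1 / x ^ (p + 1)"
  defines "Q \<equiv> \<lambda>i j. x ^ i * evalc u (sol p a j (int i)) / x ^ j"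
  shows "Q (Suc i) j - x * Q i j + (if p \<le> i then complex_of_real (a (i - p)) * Q (i - p) j else 0) =
    (if Suc i = j then 1 else 0)"
proof -
  interpret comm_ring_hom "evalc u"
    by (rule evalc_hom)
  have u: "u * x ^ (p + 1) = - 1"
    using \<open>x \<noteq> 0\<close> by (simp add: u_def)
  show ?thesis
  proof (cases "j \<le> i")
    case True
    have X: "evalc u [:0, c:] = complex_of_real c * u" for c
      by (simp add: evalc_def map_poly_pCons)
    have *: "evalc u (sol p a j (int (Suc i))) = evalc u (sol p a j (int i)) +
        complex_of_real (a (i - p)) * u * evalc u (sol p a j (int i - int p))"
    proof -
      have "int (Suc i) = int i + 1" "nat (int i - int p) = i - p"
        by simp_all
      then show ?thesis
        using sol_rec[of j "int i" p a] True by (simp only: hom_add hom_mult X of_nat_le_iff)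
    qed
    show ?thesis
    proof (cases "p \<le> i")
      case pi: True
      define E where "E = evalc u (sol p a j (int (i - p)))"
      have "int i - int p = int (i - p)"
        using pi by simp
      then have "Q (Suc i) j = x * Q i j + complex_of_real (a (i - p)) * ((u * x ^ (p + 1)) * x ^ (i - p)) * E / x ^ j"
      proof -
        have "(u * x ^ (p + 1)) * x ^ (i - p) = u * x ^ Suc i"
          using pi by (simp flip: power_add power_Suc add: mult.assoc)
        then show ?thesis
          unfolding Q_def * \<open>int i - int p = int (i - p)\<close> E_def[symmetric]
          by (simp only:) (simp add: distrib_left add_divide_distrib mult_ac)
      qed
      then show ?thesis
        unfolding u using pi True by (simp add: Q_def E_def)
    next
      case False
      then have "sol p a j (int i - int p) = 0"
        by (simp add: sol_less)
      then show ?thesis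
        unfolding Q_def * using False True by (simp add: hom_zero)
    qed
  next
    case False
    then have z: "sol p a j (int i) = 0" "p \<le> i \<Longrightarrow> sol p a j (int (i - p)) = 0"
      by (auto simp: sol_less)
    have "sol p a j (int (Suc i)) = (if Suc i = j then 1 else 0)"
      using False by (auto simp: sol_less simp del: of_nat_Suc)
    then show ?thesis
      using z \<open>x \<noteq> 0\<close> by (auto simp: Q_def hom_zero hom_one simp del: of_nat_Suc)
  qed
qed

lemma poly_P_poly:
  assumes "1 \<le> p" "k \<le> n" "x \<noteq> 0"
  shows "poly (P_poly p a k n) x =
    (-1) ^ ((n - k) * (k + 1)) * x ^ ((n - k) * (k + 1)) * evalc (- 1 / x ^ (p + 1)) (minor p a (Suc k) (arc p k n))"
proof -
  define u where "u = - 1 / x ^ (p + 1)"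
  define Q where "Q = (\<lambda>i j. x ^ i * evalc u (sol p a j (int i)) / x ^ j)"
  \<comment> \<open>\<open>H - x\<close> with a unit row on top and one more column: the
    superdiagonal of ones becomes the main diagonal, so \<open>W\<close> is lower unitriangular and
    row \<open>i\<close> of \<open>H - x\<close> is its row \<open>i + 1\<close>.\<close>
  define W where "W = (\<lambda>i j. if i = j then 1 else if i = j + 1 then - x else if i = j + p + 1 then complex_of_real (a j) else 0)"
  interpret ev: comm_ring_hom "\<lambda>q :: complex poly. poly q x"
    by unfold_locales auto
  interpret comm_ring_hom "evalc u"
    by (rule evalc_hom)
  have P: "P_poly p a k n = det (mat (n - k) (n - k) (\<lambda>(i, j). hessenberg_minus_x p a n $$ (i + k, j)))"
    using \<open>k \<le> n\<close> by (auto simp: P_poly_def)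
  have "poly (P_poly p a k n) x = det (mat (n - k) (n - k) (\<lambda>(i, j). W (i + k + 1) j))"
    unfolding P ev.hom_det[symmetric]
    by (intro arg_cong[of _ _ det] eq_matI)
      (use assms in \<open>auto simp: W_def hessenberg_minus_x_def hessenberg_mat_def hessenberg_def\<close>)
  also have "\<dots> = (-1) ^ ((n - k) * (k + 1)) * det (mat (k + 1) (k + 1) (\<lambda>(i, j). Q (i + (n - k)) j))"
  proof (rule det_W_Q)
    fix i j assume ij: "i \<le> n" "j \<le> n"
    have "(\<Sum>l\<le>n. W i l * Q l j) = (\<Sum>l\<le>n. (if l = i then Q i j else 0) +
        ((if l + 1 = i then - x * Q l j else 0) + (if l + p + 1 = i then complex_of_real (a l) * Q l j else 0)))"
      by (intro sum.cong) (use assms(1) in \<open>auto simp: W_def\<close>)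
    also have "\<dots> = Q i j + ((\<Sum>l\<le>n. if l + 1 = i then - x * Q l j else 0) +
        (\<Sum>l\<le>n. if l + p + 1 = i then complex_of_real (a l) * Q l j else 0))"
      using ij by (simp add: sum.distrib)
    also have "\<dots> = (if i = j then 1 else 0)"
    proof (cases i)
      case 0
      then show ?thesis
        using assms(3) by (auto simp: Q_def sol_def hom_one hom_zero)
    next
      case (Suc i')
      have "(\<Sum>l\<le>n. if l + 1 = i then - x * Q l j else 0) = (\<Sum>l\<le>n. if l = i' then - x * Q i' j else 0)"
        using Suc by (intro sum.cong) auto
      also have "\<dots> = - x * Q i' j"
        using Suc ij by simp
      finally have 1: "(\<Sum>l\<le>n. if l + 1 = i then - x * Q l j else 0) = - x * Q i' j" .
      have 2: "(\<Sum>l\<le>n. if l + p + 1 = i then complex_of_real (a l) * Q l j else 0) =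
          (if p \<le> i' then complex_of_real (a (i' - p)) * Q (i' - p) j else 0)"
      proof (cases "p \<le> i'")
        case True
        have "(\<Sum>l\<le>n. if l + p + 1 = i then complex_of_real (a l) * Q l j else 0) =
            (\<Sum>l\<le>n. if l = i' - p then complex_of_real (a l) * Q l j else 0)"
          using Suc True by (intro sum.cong) auto
        then show ?thesis
          using True Suc ij by simp
      next
        case False
        then show ?thesis
          using Suc by (auto intro!: sum.neutral)
      qed
      have "Q (Suc i') j - x * Q i' j + (if p \<le> i' then complex_of_real (a (i' - p)) * Q (i' - p) j else 0) =
          (if Suc i' = j then 1 else 0)"
        using evalc_sol_rec[OF assms(3,1), where a = a and i = i' and j = j] unfolding Q_def u_def .
      moreover have "A + (- x * B + C) = A - x * B + C" for A B C :: complex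
        by simp
      ultimately show ?thesis
        unfolding 1 2 unfolding Suc by metis
    qed
    finally show "(\<Sum>l\<le>n. W i l * Q l j) = (if i = j then 1 else 0)" .
  qed (use assms in \<open>auto simp: W_def\<close>)
  also have "det (mat (k + 1) (k + 1) (\<lambda>(i, j). Q (i + (n - k)) j)) =
      det (mat (k + 1) (k + 1) (\<lambda>(i, j). x ^ (i + (n - k)) * evalc u (sol p a j (int (i + (n - k)))) * (1 / x) ^ j))"
    unfolding Q_def by (intro arg_cong[of _ _ det] cong_mat) (auto simp: power_one_over field_simps)
  also have "\<dots> = (\<Prod>i<k + 1. x ^ (i + (n - k))) * (\<Prod>i<k + 1. (1 / x) ^ i) *
      det (mat (k + 1) (k + 1) (\<lambda>(i, j). evalc u (sol p a j (int (i + (n - k))))))"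
    by (rule det_scale_rows_columns)
  also have "(\<Prod>i<k + 1. x ^ (i + (n - k))) * (\<Prod>i<k + 1. (1 / x) ^ i) = x ^ ((n - k) * (k + 1))"
  proof -
    have "(\<Prod>i<k + 1. x ^ (i + (n - k))) * (\<Prod>i<k + 1. (1 / x) ^ i) = (\<Prod>i<k + 1. x ^ (n - k))"
      unfolding prod.distrib[symmetric] using \<open>x \<noteq> 0\<close>
      by (intro prod.cong) (auto simp: power_add power_one_over)
    then show ?thesis
      by (simp add: power_mult[symmetric] del: prod.lessThan_Suc power_Suc mult_Suc_right)
  qed
  also have "det (mat (k + 1) (k + 1) (\<lambda>(i, j). evalc u (sol p a j (int (i + (n - k)))))) =
      evalc u (minor p a (Suc k) (arc p k n))"
  proof -
    have "mat (k + 1) (k + 1) (\<lambda>(i, j). evalc u (sol p a j (int (i + (n - k))))) =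
        transpose_mat (map_mat (evalc u) (mat (Suc k) (Suc k) (\<lambda>(i, j). sol p a i (arc p k n (int j)))))"
      using \<open>k \<le> n\<close> by (intro eq_matI) (auto simp: arc_small of_nat_diff algebra_simps)
    then show ?thesis
      unfolding minor_def hom_det[symmetric] by (simp add: det_transpose[of _ "Suc k"])
  qed
  finally show ?thesis
    by (simp add: u_def)
qed

subsection \<open>The zeros of \<open>P\<close>-tilde\<close>

lemma evalc_pCons: "evalc w (pCons c q) = complex_of_real c + w * evalc w q"
  by (simp add: evalc_def map_poly_pCons)

lemma evalc_pcompose_scale: "evalc w (pcompose q [:0, s:]) = evalc (complex_of_real s * w) q"
proof (induction q)
  case (pCons c q)
  interpret comm_ring_hom "evalc w"
    by (rule evalc_hom)
  show ?case
    unfolding pcompose_pCons hom_add hom_mult pCons.IH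
    by (simp add: evalc_pCons hom_zero mult_ac)
qed (simp add: evalc_def)

lemma evalc_neg_split:
  assumes "C = Polynomial.smult l (monom 1 \<beta> * (\<Prod>c\<leftarrow>cs. [:- c, 1:]))"
  shows "evalc w C = complex_of_real l * w ^ \<beta> * (\<Prod>c\<leftarrow>cs. w - complex_of_real c)"
proof -
  interpret comm_ring_hom "evalc w"
    by (rule evalc_hom)
  have "evalc w (monom 1 \<beta>) = w ^ \<beta>"
    by (simp add: evalc_def map_poly_monom poly_monom)
  moreover have "evalc w (\<Prod>c\<leftarrow>cs. [:- c, 1:]) = (\<Prod>c\<leftarrow>cs. w - complex_of_real c)"
  proof (induction cs)
    case (Cons c cs)
    have "evalc w [:- c, 1:] = w - complex_of_real c"
      by (simp add: evalc_pCons hom_zero)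
    then show ?case
      using Cons by (simp add: hom_mult del: mult_pCons_left)
  qed (simp add: hom_one)
  moreover have "evalc w (Polynomial.smult l q) = complex_of_real l * evalc w q" for q
    by (simp add: evalc_def map_poly_smult)
  ultimately show ?thesis
    by (simp add: assms hom_mult)
qed

text \<open>Both sides count hops: each of the \<open>k + 1\<close> particles of the unshifted arc
  is \<open>n - k\<close> sites ahead of its start, every label shift saves \<open>p + 1\<close>
  hops, and the cheapest evolution keeps \<open>m_exp\<close> of them.\<close>

lemma m_exp_top_shift:
  assumes "k \<le> p" "k \<le> n" "0 \<le> top_shift p k n"
  shows "(n - k) * (k + 1) = m_exp p k n + (p + 1) * nat (top_shift p k n)"
proof -
  define j r where "j = n mod (p + 1)" and "r = n div (p + 1)"
  have "n = r * (p + 1) + j"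
    unfolding j_def r_def by (rule div_mult_mod_eq[symmetric])
  then have n: "int n = int r * (int p + 1) + int j"
    by (simp add: algebra_simps)
  have t: "top_shift p k n = (int k + 1) * int r - (if k \<le> j then 0 else int k - int j)"
    by (simp add: top_shift_def j_def r_def Let_def)
  have m: "m_exp p k n = (if k \<le> j then (j - k) * (k + 1) else (k - j) * (p - k))"
    by (simp only: m_exp_def Let_def j_def)
  have "int ((n - k) * (k + 1)) = int (m_exp p k n + (p + 1) * nat (top_shift p k n))"
  proof (cases "k \<le> j")
    case True
    then have "int (m_exp p k n) = (int j - int k) * (int k + 1)"
      by (simp add: m of_nat_diff) (simp add: algebra_simps)
    then show ?thesis
      using assms True by (simp add: of_nat_diff n t) (simp add: algebra_simps)
  next
    case False
    then have "int (m_exp p k n) = (int k - int j) * (int p - int k)"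
      using assms by (simp add: m of_nat_diff)
    then show ?thesis
      using assms False by (simp add: of_nat_diff n t) (simp add: algebra_simps)
  qed
  then show ?thesis
    by (simp only: of_nat_eq_iff)
qed

text \<open>Needed because the formulas for the determinant divide by \<open>x\<close>.\<close>

lemma poly_eqI_nonzero:
  fixes f g :: "complex poly"
  assumes "\<And>x. x \<noteq> 0 \<Longrightarrow> poly f x = poly g x"
  shows "f = g"
proof -
  have "poly ([:0, 1:] * f) = poly ([:0, 1:] * g)"
    using assms by (auto simp: fun_eq_iff)
  then have "[:0, 1:] * f = [:0, 1:] * g"
    by (simp only: poly_eq_poly_eq_iff)
  then show ?thesis
    by simp
qed

lemma minor_eq_signed_minor: "evalc u (minor p a (Suc k) (arc p k n)) = evalc ((-1) ^ k * u) (signed_minor p k a n)"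
  unfolding signed_minor_def evalc_pcompose_scale by (simp flip: power_mult_distrib mult.assoc)

lemma poly_P_poly_signed_minor:
  assumes "1 \<le> p" "k \<le> n" "x \<noteq> 0"
  shows "poly (P_poly p a k n) x =
    (-1) ^ ((n - k) * (k + 1)) * x ^ ((n - k) * (k + 1)) * evalc ((-1) ^ (k + 1) / x ^ (p + 1)) (signed_minor p k a n)"
  unfolding poly_P_poly[OF assms] minor_eq_signed_minor by simp

text \<open>A nonzero zero \<open>c\<close> of \<open>signed_minor\<close> corresponds to the zero \<open>(-1)\<^sup>k\<^sup>+\<^sup>1 / c\<close> of \<open>P\<close>-tilde.\<close>

definition zero_of :: "nat \<Rightarrow> real \<Rightarrow> complex" where
  "zero_of k c = complex_of_real ((-1) ^ (k + 1) / c)"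

text \<open>With \<open>z = x ^ (p + 1)\<close>, each factor of \<open>G\<close> at
  \<open>s / z\<close> absorbs one \<open>z\<close>: the power of the variable becomes a constant,
  and the factor of \<open>c\<close> becomes a multiple of \<open>z - zero_of k c\<close>. As the
  degree of \<open>G\<close> is \<open>top_shift\<close>, exactly \<open>m_exp\<close> powers of
  \<open>x\<close> are left over.\<close>

lemma P_poly_split:
  assumes a: "\<And>j. a j > 0" and "k < p" and nd: "nondegenerate p k n" and G: "neg_split (signed_minor p k a n) \<beta> cs"
  obtains C where "C \<noteq> 0" "P_poly p a k n = monom 1 (m_exp p k n) *
    pcompose (Polynomial.smult C (\<Prod>c\<leftarrow>cs. [:- zero_of k c, 1:])) (monom 1 (p + 1))"
proof -
  have kp: "k \<le> p" "1 \<le> p" and kn: "k \<le> n"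
    using assms(2) nondegenerate_le[OF nd] by auto
  obtain l where l: "l > 0" "signed_minor p k a n = Polynomial.smult l (monom 1 \<beta> * (\<Prod>c\<leftarrow>cs. [:- c, 1:]))"
    and neg: "\<And>c. c \<in> set cs \<Longrightarrow> c < 0"
    using G by (auto simp: neg_split_def)
  define s where "s = ((-1) ^ (k + 1) :: complex)"
  define C where "C = (-1) ^ ((n - k) * (k + 1)) * complex_of_real l * s ^ \<beta> * (\<Prod>c\<leftarrow>cs. - complex_of_real c)"
  have "s \<noteq> 0"
    by (simp add: s_def)
  then have "C \<noteq> 0"
    using l neg by (auto simp: C_def prod_list_zero_iff dest: neg)
  have prod: "z ^ length cs * (\<Prod>c\<leftarrow>cs. s / z - complex_of_real c) =
      (\<Prod>c\<leftarrow>cs. - complex_of_real c) * (\<Prod>c\<leftarrow>cs. z - zero_of k c)" if "z \<noteq> 0" for z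
    using neg
  proof (induction cs)
    case (Cons c cs)
    have "z * (s / z - complex_of_real c) = - complex_of_real c * (z - zero_of k c)"
      using Cons.prems[of c] that by (simp add: zero_of_def s_def field_simps)
    moreover have "z ^ length (c # cs) * (\<Prod>c\<leftarrow>c # cs. s / z - complex_of_real c) =
      (z * (s / z - complex_of_real c)) * (z ^ length cs * (\<Prod>c\<leftarrow>cs. s / z - complex_of_real c))"
      by (simp add: mult_ac)
    moreover have "z ^ length cs * (\<Prod>c\<leftarrow>cs. s / z - complex_of_real c) =
      (\<Prod>c\<leftarrow>cs. - complex_of_real c) * (\<Prod>c\<leftarrow>cs. z - zero_of k c)"
      using Cons by simp
    ultimately show ?case
      by (simp only: list.map prod_list.Cons mult_ac)
  qed simp
  have top: "nat (top_shift p k n) = \<beta> + length cs"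
    using signed_minor_nondegenerate(2)[of a, OF a kp nd] neg_split_degree[OF G] by simp
  have e: "(n - k) * (k + 1) = m_exp p k n + (p + 1) * (\<beta> + length cs)"
    using m_exp_top_shift[OF kp(1) kn signed_minor_nondegenerate(1)[of a, OF a kp nd]] unfolding top .
  have "P_poly p a k n = monom 1 (m_exp p k n) *
    pcompose (Polynomial.smult C (\<Prod>c\<leftarrow>cs. [:- zero_of k c, 1:])) (monom 1 (p + 1))"
  proof (rule poly_eqI_nonzero)
    fix x :: complex
    assume "x \<noteq> 0"
    define z where "z = x ^ (p + 1)"
    have z: "z \<noteq> 0"
      using \<open>x \<noteq> 0\<close> by (simp add: z_def)
    have xz: "x ^ ((n - k) * (k + 1)) = x ^ m_exp p k n * (z ^ \<beta> * z ^ length cs)"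
      unfolding e power_add power_mult z_def by simp
    have sz: "z ^ \<beta> * (s / z) ^ \<beta> = s ^ \<beta>"
      using z by (simp add: power_divide)
    have "poly (P_poly p a k n) x = x ^ m_exp p k n * ((-1) ^ ((n - k) * (k + 1)) * complex_of_real l *
        (z ^ \<beta> * (s / z) ^ \<beta>) * (z ^ length cs * (\<Prod>c\<leftarrow>cs. s / z - complex_of_real c)))"
      unfolding poly_P_poly_signed_minor[OF kp(2) kn \<open>x \<noteq> 0\<close>] xz evalc_neg_split[OF l(2)] z_def[symmetric] s_def[symmetric]
      by (simp only: mult_ac)
    also have "\<dots> = x ^ m_exp p k n * (C * (\<Prod>c\<leftarrow>cs. z - zero_of k c))"
      unfolding prod[OF z] sz C_def by (simp only: mult_ac)
    also have "\<dots> = poly (monom 1 (m_exp p k n) *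
      pcompose (Polynomial.smult C (\<Prod>c\<leftarrow>cs. [:- zero_of k c, 1:])) (monom 1 (p + 1))) x"
      by (simp add: poly_monom poly_pcompose poly_linear_factors z_def)
    finally show "poly (P_poly p a k n) x = \<dots>" .
  qed
  with \<open>C \<noteq> 0\<close> show thesis
    using that by blast
qed

lemma is_P_tilde_split:
  assumes a: "\<And>j. a j > 0" and "k < p" and nd: "nondegenerate p k n" and G: "neg_split (signed_minor p k a n) \<beta> cs"
  obtains C where "C \<noteq> 0"
    "\<And>R. is_P_tilde p a k n R \<longleftrightarrow> R = Polynomial.smult C (\<Prod>c\<leftarrow>cs. [:- zero_of k c, 1:])"
proof -
  obtain C where C: "C \<noteq> 0" "P_poly p a k n = monom 1 (m_exp p k n) *
    pcompose (Polynomial.smult C (\<Prod>c\<leftarrow>cs. [:- zero_of k c, 1:])) (monom 1 (p + 1))"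
    using P_poly_split[of a, OF assms] by blast
  let ?R = "Polynomial.smult C (\<Prod>c\<leftarrow>cs. [:- zero_of k c, 1:])"
  have "zero_of k c \<noteq> 0" if "c \<in> set cs" for c
    using G that by (auto simp: zero_of_def neg_split_def)
  then have "poly ?R 0 \<noteq> 0"
    using C(1) by (auto simp: poly_linear_factors prod_list_zero_iff)
  then have "is_P_tilde p a k n ?R"
    using C(2) by (simp add: is_P_tilde_def)
  moreover have "R = ?R" if "is_P_tilde p a k n R" for R
  proof -
    have "monom 1 (m_exp p k n) * pcompose R (monom 1 (p + 1)) = monom 1 (m_exp p k n) * pcompose ?R (monom 1 (p + 1))"
      using that C(2) by (simp add: is_P_tilde_def)
    then have "pcompose R (monom 1 (p + 1)) = pcompose ?R (monom 1 (p + 1))"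
      by (simp only: mult_cancel_left) (simp add: monom_eq_0_iff)
    then have "pcompose (R - ?R) (monom 1 (p + 1)) = 0"
      by (simp add: pcompose_diff)
    then have "R - ?R = 0"
      by (rule pcompose_eq_0) (simp add: degree_monom_eq)
    then show ?thesis
      by simp
  qed
  ultimately show thesis
    using that[OF C(1)] by blast
qed

text \<open>On the negative half-line \<open>1 / \<bar>c\<bar>\<close> increases with
  \<open>c\<close>, so the zeros of \<open>G\<close> in increasing order give those of
  \<open>P\<close>-tilde by increasing modulus. Their common sign is
  \<open>(-1) ^ k\<close>.\<close>

lemma zeros_by_modulus_split:
  assumes C: "C \<noteq> 0" and z: "zeros_by_modulus (Polynomial.smult C (\<Prod>c\<leftarrow>cs. [:- zero_of k c, 1:])) xs"
    and cs: "sorted_wrt (<) cs" "\<And>c. c \<in> set cs \<Longrightarrow> c < 0"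
  shows "map cmod xs = map (\<lambda>c. 1 / \<bar>c\<bar>) cs"
    and "if even k then map Re xs = map (\<lambda>c. 1 / \<bar>c\<bar>) cs else map (\<lambda>z. - Re z) xs = map (\<lambda>c. 1 / \<bar>c\<bar>) cs"
proof -
  have "proots (\<Prod>c\<leftarrow>cs. [:- zero_of k c, 1:]) = mset (map (zero_of k) cs)" for cs
  proof (induction cs)
    case (Cons c cs)
    have "[:- zero_of k c, 1:] \<noteq> 0" "(\<Prod>c\<leftarrow>cs. [:- zero_of k c, 1:]) \<noteq> 0"
      using linear_factors_nz[of "map (zero_of k) cs"] by (simp_all add: comp_def)
    then show ?case
      using Cons by (simp add: proots_mult del: mult_pCons_left)
  qed simp
  then have mset: "mset xs = mset (map (zero_of k) cs)" and sorted: "sorted (map cmod xs)"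
    using z C by (auto simp: zeros_by_modulus_def)
  have cm: "cmod (zero_of k c) = 1 / \<bar>c\<bar>" if "c \<in> set cs" for c
    using cs(2)[OF that] by (simp add: zero_of_def norm_divide norm_power)
  have "mset (map cmod xs) = image_mset cmod (mset (map (zero_of k) cs))"
    by (simp only: mset_map[of cmod] mset)
  also have "\<dots> = mset (map (\<lambda>c. 1 / \<bar>c\<bar>) cs)"
    unfolding mset_map multiset.map_comp by (intro image_mset_cong) (auto simp: cm)
  finally have "mset (map cmod xs) = mset (map (\<lambda>c. 1 / \<bar>c\<bar>) cs)" .
  moreover have "sorted (map (\<lambda>c. 1 / \<bar>c\<bar>) cs)"
    unfolding sorted_map using cs(1)
  proof (rule sorted_wrt_mono_rel[rotated])
    fix x y assume "x \<in> set cs" "y \<in> set cs" "x < y"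
    then show "1 / \<bar>x\<bar> \<le> 1 / \<bar>y\<bar>"
      using cs(2)[of x] cs(2)[of y] by (intro frac_le) auto
  qed
  ultimately show 1: "map cmod xs = map (\<lambda>c. 1 / \<bar>c\<bar>) cs"
    using sorted properties_for_sort by metis
  have Re: "Re z = (-1) ^ k * cmod z" if "z \<in> set xs" for z
  proof -
    have "z \<in> zero_of k ` set cs"
      using that mset_eq_setD[OF mset] by simp
    then obtain c where c: "c \<in> set cs" "z = zero_of k c"
      by blast
    then show ?thesis
      using cm[OF c(1)] cs(2)[OF c(1)] c(2) by (simp add: zero_of_def)
  qed
  show "if even k then map Re xs = map (\<lambda>c. 1 / \<bar>c\<bar>) cs else map (\<lambda>z. - Re z) xs = map (\<lambda>c. 1 / \<bar>c\<bar>) cs"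
    unfolding 1[symmetric] using Re by simp
qed

lemma interlacing_chain_alternating:
  assumes "alternating us vs" "\<And>c. c \<in> set us \<union> set vs \<Longrightarrow> c < 0"
  shows "interlacing_chain (map (\<lambda>c. 1 / \<bar>c\<bar>) us) (map (\<lambda>c. 1 / \<bar>c\<bar>) vs)"
proof -
  have mono: "1 / \<bar>x\<bar> \<le> 1 / \<bar>y\<bar>" if "x < y" "y < 0" for x y :: real
    using that by (intro frac_le) auto
  have neg: "us ! i < 0" if "i < length us" for i
    using assms(2) that by simp
  have neg': "vs ! i < 0" if "i < length vs" for i
    using assms(2) that by simp
  show ?thesis
    using assms(1) unfolding interlacing_chain_def alternating_def
    using neg[of 0] by (auto intro!: mono neg neg')
qed

text \<open>Passing from \<open>n\<close> to \<open>n + 1\<close> can lose the condition only when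
  the residue goes from \<open>k\<close> to \<open>k + 1\<close> with fewer than \<open>k\<close>
  full turns.\<close>

lemma degenerate_successor:
  assumes "k < p" "nondegenerate p k n" "\<not> nondegenerate p k (Suc n)"
  shows "Suc n mod (p + 1) = k + 1" "Suc n \<le> k * (p + 1)"
proof -
  define j r where "j = n mod (p + 1)" and "r = n div (p + 1)"
  have n: "n = r * (p + 1) + j"
    unfolding j_def r_def by (rule div_mult_mod_eq[symmetric])
  have nd: "if j \<le> k then k \<le> r + j else k \<le> r"
    using assms(2) by (simp add: nondegenerate_def Let_def j_def r_def)
  have "j \<noteq> p"
  proof
    assume "j = p"
    then have "Suc n mod (p + 1) = 0" "Suc n div (p + 1) = Suc r"
      by (simp_all add: j_def r_def mod_Suc div_Suc)
    then show False
      using assms(1,3) nd \<open>j = p\<close> by (simp add: nondegenerate_def Let_def)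
  qed
  then have s: "Suc n mod (p + 1) = Suc j" "Suc n div (p + 1) = r"
    by (simp_all add: j_def r_def mod_Suc div_Suc)
  then have *: "j = k \<and> r < k"
    using assms(3) nd by (auto simp: nondegenerate_def Let_def split: if_splits)
  then show "Suc n mod (p + 1) = k + 1"
    using s by simp
  have "Suc n \<le> Suc r * (p + 1)"
    using n * assms(1) by simp
  also have "\<dots> \<le> k * (p + 1)"
    using * by (intro mult_right_mono) auto
  finally show "Suc n \<le> k * (p + 1)" .
qed

text \<open>By \<open>cnt_arc_degenerate\<close> all coefficients vanish, so the determinant is
  identically zero and admits no factor that is nonzero at \<open>0\<close>.\<close>

lemma not_is_P_tilde_degenerate:
  assumes "k < p" "nondegenerate p k n" "\<not> nondegenerate p k (Suc n)"
  shows "\<not> is_P_tilde p a k (Suc n) S"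
proof
  assume S: "is_P_tilde p a k (Suc n) S"
  have "k \<le> Suc n"
    using nondegenerate_le[OF assms(2)] by simp
  have "coeff (signed_minor p k a (Suc n)) b = 0" for b
    using assms \<open>k \<le> Suc n\<close> cnt_arc_degenerate[OF _ _ degenerate_successor[OF assms], of a "int b"]
    by (subst coeff_signed_minor) auto
  then have "signed_minor p k a (Suc n) = 0"
    by (intro poly_eqI) simp
  then have "P_poly p a k (Suc n) = 0"
    using assms(1) \<open>k \<le> Suc n\<close> by (intro poly_eqI_nonzero) (simp add: poly_P_poly_signed_minor evalc_def)
  then have "pcompose S (monom 1 (p + 1)) = 0"
    using S by (simp add: is_P_tilde_def monom_eq_0_iff)
  then have "S = 0"
    by (rule pcompose_eq_0) (simp add: degree_monom_eq)
  then show False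
    using S by (simp add: is_P_tilde_def)
qed

lemma interlacing_of_neg_split:
  assumes a: "\<And>j. a j > 0" and "k < p" and nd: "nondegenerate p k n" "nondegenerate p k n'"
    and G: "neg_split (signed_minor p k a n) \<beta> us" "neg_split (signed_minor p k a n') \<gamma> vs" and alt: "alternating us vs"
    and R: "is_P_tilde p a k n R" "is_P_tilde p a k n' S" and xs: "zeros_by_modulus R xs" "zeros_by_modulus S ys"
  shows "interlacing_chain (map cmod xs) (map cmod ys)"
    "if even k then interlacing_chain (map Re xs) (map Re ys)
      else interlacing_chain (map (\<lambda>z. - Re z) xs) (map (\<lambda>z. - Re z) ys)"
proof -
  obtain C where C: "C \<noteq> 0" "R = Polynomial.smult C (\<Prod>c\<leftarrow>us. [:- zero_of k c, 1:])"
    using is_P_tilde_split[of a, OF a assms(2) nd(1) G(1)] R(1) by metis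
  obtain D where D: "D \<noteq> 0" "S = Polynomial.smult D (\<Prod>c\<leftarrow>vs. [:- zero_of k c, 1:])"
    using is_P_tilde_split[of a, OF a assms(2) nd(2) G(2)] R(2) by metis
  have us: "sorted_wrt (<) us" "\<And>c. c \<in> set us \<Longrightarrow> c < 0" and vs: "sorted_wrt (<) vs" "\<And>c. c \<in> set vs \<Longrightarrow> c < 0"
    using G by (auto simp: neg_split_def)
  have chain: "interlacing_chain (map (\<lambda>c. 1 / \<bar>c\<bar>) us) (map (\<lambda>c. 1 / \<bar>c\<bar>) vs)"
    using us vs by (intro interlacing_chain_alternating[OF alt]) auto
  note zx = zeros_by_modulus_split[OF C(1) xs(1)[unfolded C(2)] us]
    and zy = zeros_by_modulus_split[OF D(1) xs(2)[unfolded D(2)] vs]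
  show "interlacing_chain (map cmod xs) (map cmod ys)"
    using chain zx(1) zy(1) by simp
  show "if even k then interlacing_chain (map Re xs) (map Re ys)
      else interlacing_chain (map (\<lambda>z. - Re z) xs) (map (\<lambda>z. - Re z) ys)"
    using zx(2) zy(2) chain by (auto split: if_splits)
qed

theorem theorem2p7:
  fixes p k n :: nat and a :: "nat \<Rightarrow> real"
  assumes "p \<ge> 1"
    and "\<And>j. a j > 0"
    and "n \<ge> 1"
    and "k \<in> {0..p - 1}"
    and "nondegenerate p k n"
  shows
    "(\<exists>R. is_P_tilde p a k n R \<and>
       (\<forall>z. poly R z = 0 \<longrightarrow> z \<in> \<real> \<and> (if even k then Re z > 0 else Re z < 0)))
     \<and>
     (\<forall>R S xs ys.
       is_P_tilde p a k n R \<and> is_P_tilde p a k (n + 1) S \<and>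
       zeros_by_modulus R xs \<and> zeros_by_modulus S ys \<longrightarrow>
         ((\<exists>j\<in>{k..p - 1}. [n = j] (mod (p + 1))) \<longrightarrow>
            interlacing_chain (map cmod xs) (map cmod ys)) \<and>
         ((\<exists>j\<in>{-1..int k - 1}. [int n = j] (mod (int p + 1))) \<longrightarrow>
            interlacing_chain (map cmod ys) (map cmod xs)))
     \<and>
     (\<forall>R S xs ws.
       is_P_tilde p a k n R \<and> is_P_tilde p a k (n + p + 1) S \<and>
       zeros_by_modulus R xs \<and> zeros_by_modulus S ws \<longrightarrow>
         interlacing_chain (map cmod ws) (map cmod xs) \<and>
         (if even k then interlacing_chain (map Re ws) (map Re xs)
          else interlacing_chain (map (\<lambda>z. - Re z) ws) (map (\<lambda>z. - Re z) xs)))"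
proof -
  note a = assms(2) and nd = assms(5)
  have kp: "k < p" "k \<le> p" "1 \<le> p"
    using assms(1,4) by auto
  have ndN: "nondegenerate p k (n + p + 1)"
    using nd by (rule nondegenerate_add_period)
  obtain H where H: "signed_minor p k a (n + p + 1) = monom 1 k * H" "precedes (signed_minor p k a n) H"
      "degree H = degree (signed_minor p k a n) + 1"
    using precedes_signed_minor_period[of a, OF a kp(1) nd] by blast
  \<comment> \<open>The degree of \<open>H\<close> excludes the other alternative in
    \<open>precedes\<close>.\<close>
  then obtain \<beta> cs \<gamma> as where cs: "neg_split (signed_minor p k a n) \<beta> cs" and as: "neg_split H \<gamma> as" and alt: "alternating as cs"
    by (auto simp: precedes_def)
  have as': "neg_split (signed_minor p k a (n + p + 1)) (k + \<gamma>) as"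
    unfolding H(1) using as by (rule neg_split_monom_mult)
  obtain C where C: "C \<noteq> 0"
    "\<And>R. is_P_tilde p a k n R \<longleftrightarrow> R = Polynomial.smult C (\<Prod>c\<leftarrow>cs. [:- zero_of k c, 1:])"
    using is_P_tilde_split[of a, OF a kp(1) nd cs] by blast
  have part_a: "\<exists>R. is_P_tilde p a k n R \<and>
       (\<forall>z. poly R z = 0 \<longrightarrow> z \<in> \<real> \<and> (if even k then Re z > 0 else Re z < 0))"
  proof (intro exI conjI allI impI)
    show "is_P_tilde p a k n (Polynomial.smult C (\<Prod>c\<leftarrow>cs. [:- zero_of k c, 1:]))"
      by (simp add: C(2))
    fix z assume "poly (Polynomial.smult C (\<Prod>c\<leftarrow>cs. [:- zero_of k c, 1:])) z = 0"
    then obtain c where c: "c \<in> set cs" "z = zero_of k c"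
      using C(1) by (auto simp: poly_linear_factors prod_list_zero_iff)
    then have "c < 0"
      using cs by (simp add: neg_split_def)
    then show "z \<in> \<real>" "if even k then Re z > 0 else Re z < 0"
      using c by (auto simp: zero_of_def divide_neg_neg divide_pos_neg)
  qed
  have part_b: "((\<exists>j\<in>{k..p - 1}. [n = j] (mod (p + 1))) \<longrightarrow> interlacing_chain (map cmod xs) (map cmod ys)) \<and>
      ((\<exists>j\<in>{-1..int k - 1}. [int n = j] (mod (int p + 1))) \<longrightarrow> interlacing_chain (map cmod ys) (map cmod xs))"
    if R: "is_P_tilde p a k n R" "is_P_tilde p a k (n + 1) S" and xs: "zeros_by_modulus R xs" "zeros_by_modulus S ys"
    for R S xs ys
  proof -
    \<comment> \<open>The existence of \<open>S\<close> excludes a degenerate \<open>n + 1\<close>,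
      where the determinant vanishes.\<close>
    have nd1: "nondegenerate p k (Suc n)"
      using not_is_P_tilde_degenerate[OF kp(1) nd] R(2) by auto
    obtain \<beta> us \<gamma> vs where us: "neg_split (signed_minor p k a n) \<beta> us" and vs: "neg_split (signed_minor p k a (Suc n)) \<gamma> vs"
      and alt: "degree (signed_minor p k a (Suc n)) = degree (signed_minor p k a n) \<and> alternating us vs \<or>
        degree (signed_minor p k a (Suc n)) = degree (signed_minor p k a n) + 1 \<and> alternating vs us"
      using precedes_signed_minor[OF kp(1), of a, OF a nd nd1] by (auto simp: precedes_def)
    have R': "is_P_tilde p a k (Suc n) S"
      using R(2) by simp
    have deg: "degree (signed_minor p k a (Suc n)) =
        degree (signed_minor p k a n) + (if k \<le> n mod (p + 1) \<and> n mod (p + 1) < p then 0 else 1)"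
      using signed_minor_nondegenerate(1,2)[of a, OF a kp(2,3) nd] signed_minor_nondegenerate(1,2)[of a, OF a kp(2,3) nd1]
        top_shift_Suc[OF kp(1), of n] by (auto simp: nat_add_distrib)
    show ?thesis
    proof (intro conjI impI)
      assume "\<exists>j\<in>{k..p - 1}. [n = j] (mod (p + 1))"
      then obtain j where "j \<in> {k..p - 1}" "n mod (p + 1) = j mod (p + 1)"
        by (auto simp: cong_def)
      then have "k \<le> n mod (p + 1) \<and> n mod (p + 1) < p"
        using kp by auto
      then have "alternating us vs"
        using deg alt by simp
      then show "interlacing_chain (map cmod xs) (map cmod ys)"
        by (rule interlacing_of_neg_split(1)[of a, OF a kp(1) nd nd1 us vs _ R(1) R' xs])
    next
      assume "\<exists>j\<in>{-1..int k - 1}. [int n = j] (mod (int p + 1))"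
      then obtain j where j: "-1 \<le> j" "j \<le> int k - 1" "int n mod (int p + 1) = j mod (int p + 1)"
        by (auto simp: cong_def)
      have "\<not> (k \<le> n mod (p + 1) \<and> n mod (p + 1) < p)"
      proof -
        have n: "int (n mod (p + 1)) = j mod (int p + 1)"
          using j(3) by (simp add: of_nat_mod add.commute)
        show ?thesis
        proof (cases "j = -1")
          case True
          then have "int (n mod (p + 1)) = int p"
            using n by (simp add: zmod_minus1)
          then show ?thesis
            by simp
        next
          case False
          then have "j mod (int p + 1) = j"
            using j kp by (intro mod_pos_pos_trivial) auto
          then show ?thesis
            using n j by simp
        qed
      qed
      then have "alternating vs us"
        using deg alt by auto
      then show "interlacing_chain (map cmod ys) (map cmod xs)"
        by (rule interlacing_of_neg_split(1)[of a, OF a kp(1) nd1 nd vs us _ R' R(1) xs(2,1)])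
    qed
  qed
  have part_c: "interlacing_chain (map cmod ws) (map cmod xs) \<and>
      (if even k then interlacing_chain (map Re ws) (map Re xs)
        else interlacing_chain (map (\<lambda>z. - Re z) ws) (map (\<lambda>z. - Re z) xs))"
    if R: "is_P_tilde p a k n R" "is_P_tilde p a k (n + p + 1) S" and xs: "zeros_by_modulus R xs" "zeros_by_modulus S ws"
    for R S xs ws
    using interlacing_of_neg_split[of a, OF a kp(1) ndN nd as' cs alt R(2,1) xs(2,1)] by blast
  show ?thesis
    using part_a part_b part_c by blast
qed

end
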